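(* Let $k$ be a positive integer and let $\lambda = (a_1,\dots,a_r)$ be a partition of $k$ with exactly $r$ (positive) parts. Then $d_i(\lambda) = 0$ for every integer $i$ with $0\le i < r$.
   Context: For $n \ge 1$ let $\operatorname{PConf}_n(\mathbb{C}) = \{(x_1,\dots,x_n)\in\mathbb{C}^n : x_i \ne x_j \text{ for } i\neq j\}$. The symmetric group $S_n$ acts on it by permuting coordinates, making $H^i(\operatorname{PConf}_n(\mathbb{C});\mathbb{C})$ a finite-dimensional $S_n$-representation. For a partition $\lambda = (a_1,\dots,a_r)$ of $k$ (so $a_1\ge\dots\ge a_r>0$ and $k=\sum_j a_j$) and $n \ge k + a_1$, let $V(\lambda)_n$ denote the irreducible complex representation of $S_n$ corresponding (in the usual Young labelling, where the one-row partition $(n)$ gives the trivial representation) to the partition $(n-k, a_1,\dots,a_r)$ of $n$. Let $d_{i,n}(\lambda)$ be the multiplicity of $V(\lambda)_n$ in $H^i(\operatorname{PConf}_n(\mathbb{C});\mathbb{C})$. By representation stability (Church–Farb), for fixed $i$ and $\lambda$ the number $d_{i,n}(\lambda)$ is constant for all sufficiently large $n$; this eventual value is denoted $d_i(\lambda)$ (the stable multiplicity). *)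

theory Defs
  imports
    "HOL-Homology.Homology"
    "HOL-Algebra.Sym_Groups"
    "Jordan_Normal_Form.VS_Connect"
begin

section \<open>Complex representations of the symmetric group\<close>

text \<open>
  Vector spaces over the complex numbers are modules over
  \<^term>\<open>class_ring :: complex ring\<close>; their fields \<^const>\<open>monoid.mult\<close> and \<^const>\<open>one\<close> play no role.
\<close>

record 'v rep = "(complex, 'v) module" +
  act :: "(nat \<Rightarrow> nat) \<Rightarrow> 'v \<Rightarrow> 'v"

definition is_rep :: "nat \<Rightarrow> 'v rep \<Rightarrow> bool" where
  "is_rep n V \<longleftrightarrow>
     vectorspace class_ring V \<and>
     (\<forall>g \<in> carrier (sym_group n). act V g \<in> module_hom class_ring V V) \<and>
     (\<forall>v \<in> carrier V. act V id v = v) \<and>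
     (\<forall>g \<in> carrier (sym_group n). \<forall>h \<in> carrier (sym_group n). \<forall>v \<in> carrier V.
        act V (g \<circ> h) v = act V g (act V h v))"

definition subrep :: "nat \<Rightarrow> 'v set \<Rightarrow> 'v rep \<Rightarrow> bool" where
  "subrep n U V \<longleftrightarrow>
     subspace class_ring U V \<and> (\<forall>g \<in> carrier (sym_group n). act V g ` U \<subseteq> U)"

definition irreducible_rep :: "nat \<Rightarrow> 'v rep \<Rightarrow> bool" where
  "irreducible_rep n V \<longleftrightarrow>
     is_rep n V \<and> carrier V \<noteq> {\<zero>\<^bsub>V\<^esub>} \<and>
     (\<forall>U. subrep n U V \<longrightarrow> U = {\<zero>\<^bsub>V\<^esub>} \<or> U = carrier V)"

definition rep_iso :: "nat \<Rightarrow> 'v rep \<Rightarrow> 'w rep \<Rightarrow> bool" where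
  "rep_iso n V W \<longleftrightarrow>
     (\<exists>f \<in> module_hom class_ring V W. bij_betw f (carrier V) (carrier W) \<and>
        (\<forall>g \<in> carrier (sym_group n). \<forall>v \<in> carrier V. f (act V g v) = act W g (f v)))"

definition direct_decomp :: "'v rep \<Rightarrow> nat \<Rightarrow> (nat \<Rightarrow> 'v set) \<Rightarrow> bool" where
  "direct_decomp V l U \<longleftrightarrow>
     (\<forall>j<l. U j \<subseteq> carrier V) \<and>
     (\<forall>v \<in> carrier V. \<exists>!u. u \<in> (\<Pi>\<^sub>E j\<in>{..<l}. U j) \<and> v = (\<Oplus>\<^bsub>V\<^esub>j\<in>{..<l}. u j))"

text \<open>
  The number of summands isomorphic to \<open>V\<close> in a decomposition of \<open>W\<close> into irreducible
  subrepresentations. For a finite-dimensional representation \<open>W\<close> such a decomposition exists and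
  the number does not depend on it.
\<close>

definition rep_multiplicity :: "nat \<Rightarrow> 'v rep \<Rightarrow> 'w rep \<Rightarrow> nat" where
  "rep_multiplicity n V W = (THE m. \<exists>l U.
     (\<forall>j<l. subrep n (U j) W \<and> irreducible_rep n (W\<lparr>carrier := U j\<rparr>)) \<and>
     direct_decomp W l U \<and>
     m = card {j. j < l \<and> rep_iso n (W\<lparr>carrier := U j\<rparr>) V})"


section \<open>Irreducible representations labelled by partitions\<close>

definition partition_of :: "nat \<Rightarrow> nat list \<Rightarrow> bool" where
  "partition_of k a \<longleftrightarrow> sorted_wrt (\<ge>) a \<and> (\<forall>x \<in> set a. x > 0) \<and> sum_list a = k"

definition convolution ::
  "nat \<Rightarrow> ((nat \<Rightarrow> nat) \<Rightarrow> complex) \<Rightarrow> ((nat \<Rightarrow> nat) \<Rightarrow> complex) \<Rightarrow> (nat \<Rightarrow> nat) \<Rightarrow> complex" where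
  "convolution n x y = (\<lambda>s. \<Sum>t \<in> carrier (sym_group n). \<Sum>u \<in> carrier (sym_group n).
     if t \<circ> u = s then x t * y u else 0)"

definition group_algebra :: "nat \<Rightarrow> ((nat \<Rightarrow> nat) \<Rightarrow> complex) rep" where
  "group_algebra n =
     \<lparr>carrier = {x. \<forall>s. s \<notin> carrier (sym_group n) \<longrightarrow> x s = 0},
      monoid.mult = convolution n, one = (\<lambda>s. if s = id then 1 else 0),
      zero = (\<lambda>s. 0), add = (\<lambda>x y s. x s + y s), smult = (\<lambda>c x s. c * x s),
      act = (\<lambda>g. convolution n (\<lambda>s. if s = g then 1 else 0))\<rparr>"

text \<open>
  The boxes of the Young diagram \<open>\<mu>\<close> are numbered \<open>1, 2, \<dots>\<close> from left to right along the rows, from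
  the first row to the last. Rows are counted from 0, columns from 1.
\<close>

definition row_of :: "nat list \<Rightarrow> nat \<Rightarrow> nat" where
  "row_of \<mu> m = (LEAST i. m \<le> sum_list (take (Suc i) \<mu>))"

definition col_of :: "nat list \<Rightarrow> nat \<Rightarrow> nat" where
  "col_of \<mu> m = m - sum_list (take (row_of \<mu> m) \<mu>)"

definition row_group :: "nat \<Rightarrow> nat list \<Rightarrow> (nat \<Rightarrow> nat) set" where
  "row_group n \<mu> = {g \<in> carrier (sym_group n). \<forall>m\<in>{1..n}. row_of \<mu> (g m) = row_of \<mu> m}"

definition col_group :: "nat \<Rightarrow> nat list \<Rightarrow> (nat \<Rightarrow> nat) set" where
  "col_group n \<mu> = {g \<in> carrier (sym_group n). \<forall>m\<in>{1..n}. col_of \<mu> (g m) = col_of \<mu> m}"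

definition young_symmetrizer :: "nat \<Rightarrow> nat list \<Rightarrow> (nat \<Rightarrow> nat) \<Rightarrow> complex" where
  "young_symmetrizer n \<mu> =
     (\<lambda>s. if s \<in> row_group n \<mu> then 1 else 0) \<otimes>\<^bsub>group_algebra n\<^esub>
     (\<lambda>s. if s \<in> col_group n \<mu> then of_int (sign s) else 0)"

text \<open>
  The irreducible representation of a partition \<open>\<mu>\<close> of \<open>n\<close> is the left ideal generated by its Young
  symmetrizer. With the row sums on the left and the signed column sums on the right, the
  partition \<open>[n]\<close> gives the trivial representation.
\<close>

definition specht :: "nat \<Rightarrow> nat list \<Rightarrow> ((nat \<Rightarrow> nat) \<Rightarrow> complex) rep" where
  "specht n \<mu> = (group_algebra n)
     \<lparr>carrier := (\<lambda>x. x \<otimes>\<^bsub>group_algebra n\<^esub> young_symmetrizer n \<mu>) ` carrier (group_algebra n)\<rparr>"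

text \<open>For a partition \<open>a\<close> this is meaningful only when \<open>n - sum_list a \<ge> hd a\<close>, hence for all large \<open>n\<close>.\<close>

definition padded_specht :: "nat list \<Rightarrow> nat \<Rightarrow> ((nat \<Rightarrow> nat) \<Rightarrow> complex) rep" where
  "padded_specht a n = specht n ((n - sum_list a) # a)"


section \<open>Singular cohomology with complex coefficients\<close>

text \<open>
  Scalar multiples of a coset are formed as \<open>B + c K\<close> because \<open>c K\<close> is not a coset of \<open>B\<close> when
  \<open>c = 0\<close>; pullbacks of cohomology classes are formed in the same way.
\<close>

definition quotient_space :: "(complex, 'v) module \<Rightarrow> 'v set \<Rightarrow> (complex, 'v set) module" where
  "quotient_space V B =
     \<lparr>carrier = a_rcosets\<^bsub>V\<^esub> B, monoid.mult = undefined, one = undefined,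
      zero = B, add = (<+>\<^bsub>V\<^esub>), smult = (\<lambda>c K. B <+>\<^bsub>V\<^esub> (\<lambda>v. c \<odot>\<^bsub>V\<^esub> v) ` K)\<rparr>"

definition cochain_space :: "nat \<Rightarrow> 'a topology \<Rightarrow> (complex, 'a chain \<Rightarrow> complex) module" where
  "cochain_space p X =
     \<lparr>carrier = hom (chain_group p X) (add_monoid (class_ring :: complex ring))
                  \<inter> extensional (carrier (chain_group p X)),
      monoid.mult = undefined, one = undefined,
      zero = (\<lambda>c \<in> carrier (chain_group p X). 0),
      add = (\<lambda>\<phi> \<psi>. \<lambda>c \<in> carrier (chain_group p X). \<phi> c + \<psi> c),
      smult = (\<lambda>z \<phi>. \<lambda>c \<in> carrier (chain_group p X). z * \<phi> c)\<rparr>"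

definition coboundary ::
  "nat \<Rightarrow> 'a topology \<Rightarrow> ('a chain \<Rightarrow> complex) \<Rightarrow> 'a chain \<Rightarrow> complex" where
  "coboundary p X \<phi> = (\<lambda>c \<in> carrier (chain_group (Suc p) X). \<phi> (chain_boundary (Suc p) c))"

definition cocycles :: "nat \<Rightarrow> 'a topology \<Rightarrow> ('a chain \<Rightarrow> complex) set" where
  "cocycles p X = {\<phi> \<in> carrier (cochain_space p X).
     coboundary p X \<phi> = \<zero>\<^bsub>cochain_space (Suc p) X\<^esub>}"

definition coboundaries :: "nat \<Rightarrow> 'a topology \<Rightarrow> ('a chain \<Rightarrow> complex) set" where
  "coboundaries p X = (case p of 0 \<Rightarrow> {\<zero>\<^bsub>cochain_space 0 X\<^esub>}
     | Suc q \<Rightarrow> coboundary q X ` carrier (cochain_space q X))"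

definition cohomology :: "nat \<Rightarrow> 'a topology \<Rightarrow> (complex, ('a chain \<Rightarrow> complex) set) module" where
  "cohomology p X =
     quotient_space ((cochain_space p X)\<lparr>carrier := cocycles p X\<rparr>) (coboundaries p X)"

definition cochain_pullback ::
  "nat \<Rightarrow> 'a topology \<Rightarrow> ('a \<Rightarrow> 'b) \<Rightarrow> ('b chain \<Rightarrow> complex) \<Rightarrow> 'a chain \<Rightarrow> complex" where
  "cochain_pullback p X f \<phi> = (\<lambda>c \<in> carrier (chain_group p X). \<phi> (chain_map p f c))"

definition cohomology_pullback ::
  "nat \<Rightarrow> 'a topology \<Rightarrow> ('a \<Rightarrow> 'b) \<Rightarrow> ('b chain \<Rightarrow> complex) set \<Rightarrow> ('a chain \<Rightarrow> complex) set" where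
  "cohomology_pullback p X f K =
     coboundaries p X <+>\<^bsub>cochain_space p X\<^esub> cochain_pullback p X f ` K"


section \<open>Configuration spaces and stable multiplicities\<close>

definition PConf :: "nat \<Rightarrow> (nat \<Rightarrow> complex) topology" where
  "PConf n = subtopology (product_topology (\<lambda>_. euclidean) {1..n})
     {x. \<forall>i\<in>{1..n}. \<forall>j\<in>{1..n}. i \<noteq> j \<longrightarrow> x i \<noteq> x j}"

text \<open>
  A permutation \<open>g\<close> acts on points by \<open>(g x)\<^sub>i = x\<^sub>j\<close> with \<open>j = g\<^sup>-\<^sup>1 i\<close>, and on cohomology on the left
  by pullback along the action of \<open>g\<^sup>-\<^sup>1\<close>, which is the map \<open>x \<mapsto> x \<circ> g\<close>.
\<close>

definition PConf_cohomology ::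
  "nat \<Rightarrow> nat \<Rightarrow> (((nat \<Rightarrow> complex) chain \<Rightarrow> complex) set) rep" where
  "PConf_cohomology i n = module.extend (cohomology i (PConf n))
     (rep.fields (\<lambda>g. cohomology_pullback i (PConf n) (\<lambda>x. \<lambda>j \<in> {1..n}. x (g j))))"

definition stable_multiplicity :: "nat \<Rightarrow> nat list \<Rightarrow> nat" where
  "stable_multiplicity i a =
     (THE d. \<forall>\<^sub>F n in sequentially.
        rep_multiplicity n (padded_specht a n) (PConf_cohomology i n) = d)"

end

theory Submission
  imports Defs
begin

text \<open>
  For a partition \<open>\<mu>\<close> with \<open>r + 1\<close> rows the Specht module contains a nonzero vector on which the
  column group acts by the sign; in particular so does the symmetric group of the set \<open>A\<close> of the
  \<open>r + 1\<close> labels in the first column. It therefore suffices that the alternating sum over the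
  permutations of \<open>A\<close> annihilates \<open>H\<^sub>i(PConf\<^sub>n)\<close> whenever \<open>card A \<ge> i + 2\<close>; since \<open>\<complex>\<close> is divisible, complex
  cohomology classes are determined by their values on integral cycles.

  Forgetting a point \<open>a\<close> has a section that puts \<open>a\<close> far away, and \<open>H\<^sub>i(PConf\<^sub>n)\<close> is generated by the image
  of this section and by classes supported near the collisions \<open>x\<^sub>a = x\<^sub>j\<close> that vanish when \<open>a\<close> is
  forgotten. Take \<open>a \<in> A\<close>. A class near a collision with \<open>j \<in> A\<close> is invariant under the transposition
  of \<open>a\<close> and \<open>j\<close>, by a half turn of the pair. A class near a collision with \<open>j \<notin> A\<close> is controlled, through
  a Mayer-Vietoris sequence of the punctured disc around \<open>x\<^sub>j\<close>, by \<open>H\<^sub>i\<^sub>-\<^sub>1\<close> of the configurations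
  without \<open>a\<close>, where induction applies to \<open>A - {a}\<close>. Treating a second point \<open>b \<in> A\<close> of the image of the section in
  the same way leaves the classes with both \<open>a\<close> and \<open>b\<close> far away, and these two points can again be
  exchanged by a half turn.

  The same generation statement shows that the homology is finitely generated. Hence the cohomology is
  finite-dimensional and, by Maschke's theorem, has a decomposition as in the definition of the multiplicity.
\<close>

section \<open>Homology at the level of singular chains\<close>

text \<open>The bound \<open>i + 2 \<le> card A\<close> is shaped by the induction: passing to a
  tube costs one degree and one point of \<open>A\<close>, so the bound survives, and in degree 0
  two points of \<open>A\<close> are left for a half turn. The same count explains why tube classes
  must vanish when the point is forgotten. The homology of a bundle of punctured discs over the
  configurations without \<open>a\<close> has a part from degree i - 1 of the base, to which
  induction applies, and a part from degree i of the base, for which \<open>A - {a}\<close> may be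
  one point too small. The vanishing condition removes the second part.

  Homology is handled as cycles modulo \<open>shom\<close>. The antisymmetriser then acts on chains
  and commutes strictly with boundaries and inclusions, and Mayer-Vietoris arguments become explicit
  corrections of chains.

  The multiplicity and its stable value are definite descriptions. No comparison of different
  decompositions is required: the count is 0 in each of them, so it is enough to supply one.\<close>

abbreviation scycle :: "nat \<Rightarrow> 'a topology \<Rightarrow> 'a chain \<Rightarrow> bool" where
  "scycle p X \<equiv> singular_relcycle p X {}"

abbreviation shom :: "nat \<Rightarrow> 'a topology \<Rightarrow> 'a chain \<Rightarrow> 'a chain \<Rightarrow> bool" where
  "shom p X \<equiv> homologous_rel p X {}"

lemma scycle_chain: "scycle p X c \<Longrightarrow> singular_chain p X c"
  by (simp add: singular_cycle)

lemma shom_boundary: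
  assumes "singular_chain (Suc p) X d"
  shows "shom p X (chain_boundary (Suc p) d) 0"
  unfolding homologous_rel_def singular_boundary using assms by (intro exI[of _ d]) simp

lemma shomE:
  assumes "shom p X a b"
  obtains d where "singular_chain (Suc p) X d" "chain_boundary (Suc p) d = a - b"
  using assms by (auto simp: homologous_rel_def singular_boundary)

lemma frag_cmul_diff_right: "frag_cmul k (a - b) = frag_cmul k a - frag_cmul k b"
  by (rule poly_mapping_eqI) (simp add: lookup_minus algebra_simps)

lemma shom_cmul: "shom p X a b \<Longrightarrow> shom p X (frag_cmul k a) (frag_cmul k b)"
  unfolding homologous_rel_def using singular_relboundary_cmul[of p X "{}" "a - b" k]
  by (simp add: frag_cmul_diff_right)

lemma shom_sum:
  assumes "\<And>i. i \<in> I \<Longrightarrow> shom p X (f i) (g i)"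
  shows "shom p X (sum f I) (sum g I)"
  using assms
  by (induction I rule: infinite_finite_induct) (auto intro: homologous_rel_add)

lemma shom_mono: "shom p (subtopology X S) a b \<Longrightarrow> S \<subseteq> T \<Longrightarrow> shom p (subtopology X T) a b"
  unfolding homologous_rel_def by (rule singular_boundary_mono)

lemma shom_mono_top: "shom p (subtopology X S) a b \<Longrightarrow> shom p X a b"
  using shom_mono[of p X S a b UNIV] by simp

lemma scycle_mono_top: "scycle p (subtopology X S) a \<Longrightarrow> scycle p X a"
  using singular_cycle_mono[of p X S a UNIV] by simp

lemma shom_scycle: "shom p X a b \<Longrightarrow> scycle p X b \<Longrightarrow> scycle p X a"
  using homologous_rel_singular_relcycle by blast

lemma scycle_chain_map: "scycle p X c \<Longrightarrow> continuous_map X Y f \<Longrightarrow> scycle p Y (chain_map p f c)"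
  by (rule singular_relcycle_chain_map[where S = "{}" and X = X]) simp_all

lemma shom_chain_map:
  "shom p X a b \<Longrightarrow> continuous_map X Y f \<Longrightarrow> shom p Y (chain_map p f a) (chain_map p f b)"
  unfolding homologous_rel_def
  using singular_relboundary_chain_map[of p X "{}" "a - b" Y f "{}"] by (simp add: chain_map_diff)

lemma shom_homotopic:
  assumes "homotopic_with (\<lambda>_. True) X Y f g" "scycle p X c"
  shows "shom p Y (chain_map p f c) (chain_map p g c)"
  by (rule homotopic_imp_homologous_rel_chain_maps[OF _ assms(2)])
     (rule homotopic_with_mono[OF assms(1)], simp)

lemma shom_homotopic_id:
  assumes "homotopic_with (\<lambda>_. True) X Y f id" "scycle p X c"
  shows "shom p Y (chain_map p f c) c"
  using shom_homotopic[OF assms] chain_map_ident[OF scycle_chain[OF assms(2)]] by simp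

lemma chain_boundary_chain_map_Suc:
  "singular_chain (Suc p) X c \<Longrightarrow>
    chain_boundary (Suc p) (chain_map (Suc p) g c) = chain_map p g (chain_boundary (Suc p) c)"
  by (drule chain_boundary_chain_map) simp

section \<open>Splitting chains along open covers and disjoint unions\<close>

text \<open>Excision, with the closed complement of \<open>U\<close> as the excised set: it lies in
  \<open>V\<close> because \<open>U\<close> and \<open>V\<close> cover the space, and removing it
  from the space leaves exactly \<open>U\<close>.\<close>

lemma chain_subdivision_split:
  assumes "openin X U" "openin X V" "topspace X \<subseteq> U \<union> V" "singular_chain p X c"
  obtains n u v where "singular_chain p (subtopology X U) u" "singular_chain p (subtopology X V) v"
    "(singular_subdivision p ^^ n) c = u + v"
proof -
  have "closedin X (topspace X - U)" using assms(1) by blast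
  moreover have "topspace X - U \<subseteq> V" using assms(3) by blast
  ultimately have "X closure_of (topspace X - U) \<subseteq> (X interior_of V)"
    using assms(2) by (simp add: closure_of_closedin interior_of_openin)
  moreover have "V \<subseteq> topspace X" using assms(2) openin_subset by blast
  moreover have "singular_chain p (subtopology X (topspace X)) c" using assms(4) by simp
  moreover have "topspace X - (topspace X - U) = U" using assms(1) openin_subset by blast
  ultimately show thesis using excised_chain_exists[of X _ V "topspace X"] that by metis
qed

lemma iterated_subdivision_shom:
  assumes "scycle p X c"
  shows "shom p X ((singular_subdivision p ^^ n) c) c"
proof (induction n)
  case (Suc n)
  then show ?case
    using homologous_rel_singular_subdivision[OF shom_scycle[OF Suc assms]] homologous_rel_trans
    by fastforce
qed auto

lemma cycle_split:
  assumes "openin X U" "openin X V" "topspace X \<subseteq> U \<union> V" "scycle p X c"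
  obtains u v where "singular_chain p (subtopology X U) u" "singular_chain p (subtopology X V) v"
    "shom p X c (u + v)"
  using chain_subdivision_split[OF assms(1-3) scycle_chain[OF assms(4)]]
    iterated_subdivision_shom[OF assms(4)] by (metis homologous_rel_sym)

text \<open>The homology is asserted inside \<open>U\<close>, although \<open>e\<close> may leave
  \<open>U\<close>. The homotopy \<open>h\<close> between iterated subdivision and the identity
  respects subspaces, so \<open>h p\<close> of the boundary of \<open>e\<close> is a chain in
  \<open>U\<close>; taking boundaries in the homotopy formula cancels the term with
  \<open>h (Suc p) e\<close>, which need not lie there.\<close>

lemma boundary_split:
  assumes "openin X U" "openin X V" "topspace X \<subseteq> U \<union> V"
    and "singular_chain (Suc p) X e" "singular_chain p (subtopology X U) (chain_boundary (Suc p) e)"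
  obtains u v where "singular_chain (Suc p) (subtopology X U) u"
    "singular_chain (Suc p) (subtopology X V) v"
    "shom p (subtopology X U) (chain_boundary (Suc p) e)
       (chain_boundary (Suc p) u + chain_boundary (Suc p) v)"
proof -
  obtain n u v where uv: "singular_chain (Suc p) (subtopology X U) u"
      "singular_chain (Suc p) (subtopology X V) v" "(singular_subdivision (Suc p) ^^ n) e = u + v"
    by (rule chain_subdivision_split[OF assms(1-4)])
  show thesis
  proof (rule chain_homotopic_iterated_singular_subdivision[where n = n and 'a = 'a])
    fix h assume h: "\<And>p X c. singular_chain p X c \<Longrightarrow> singular_chain (Suc p) X (h p c)"
      "\<And>p X c. singular_chain p X c \<Longrightarrow>
         chain_boundary (Suc p) (h p c) + h (p - Suc 0) (chain_boundary p c)
                     = (singular_subdivision p ^^ n) c - (c :: 'a chain)"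
    let ?b = "chain_boundary (Suc p) e"
    have "chain_boundary (Suc p) (chain_boundary (Suc (Suc p)) (h (Suc p) e) + h p ?b)
        = chain_boundary (Suc p) (u + v - e)"
      using h(2)[OF assms(4)] by (simp only: uv(3) diff_Suc_Suc minus_nat.diff_0)
    moreover have "chain_boundary (Suc p) (chain_boundary (Suc (Suc p)) (h (Suc p) e)) = 0"
      using chain_boundary_boundary_alt[OF h(1)[OF assms(4)]] .
    ultimately have "chain_boundary (Suc p) (h p ?b)
        = (chain_boundary (Suc p) u + chain_boundary (Suc p) v) - ?b"
      by (simp add: chain_boundary_add chain_boundary_diff)
    then have "shom p (subtopology X U) (chain_boundary (Suc p) u + chain_boundary (Suc p) v) ?b"
      unfolding homologous_rel_def singular_boundary using h(1)[OF assms(5)] by blast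
    with uv that show thesis by (metis homologous_rel_sym)
  qed
qed

lemma chain_Int:
  assumes "singular_chain p (subtopology X U) c" "singular_chain p (subtopology X V) c"
  shows "singular_chain p (subtopology X (U \<inter> V)) c"
  using assms by (auto simp: singular_chain_subtopology)

text \<open>A standard simplex is connected, so each singular simplex of \<open>c\<close> lies
  entirely in \<open>P\<close> or entirely in \<open>M\<close>.\<close>

lemma chain_split_disjoint:
  assumes "openin X P" "openin X M" "P \<inter> M = {}" "singular_chain p (subtopology X (P \<union> M)) c"
  obtains x y where "singular_chain p (subtopology X P) x" "singular_chain p (subtopology X M) y"
    "c = x + y"
proof -
  have "Poly_Mapping.keys c
      \<subseteq> singular_simplex_set p (subtopology X P) \<union> singular_simplex_set p (subtopology X M)"
  proof
    fix f assume f: "f \<in> Poly_Mapping.keys c"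
    then have f': "singular_simplex p X f" "f ` standard_simplex p \<subseteq> P \<union> M"
      using assms(4) unfolding singular_chain_def subset_iff by (auto simp: singular_simplex_subtopology)
    then have "connectedin X (f ` standard_simplex p)"
      using connectedin_continuous_map_image[of "subtopology (powertop_real UNIV) (standard_simplex p)" X f]
        connectedin_standard_simplex[of p]
      by (auto simp: singular_simplex_def connectedin_subtopology)
    then have "f ` standard_simplex p \<subseteq> P \<or> f ` standard_simplex p \<subseteq> M"
      using f'(2) assms(1-3) connectedin_subset_separated_union
      by (metis separatedin_open_sets disjnt_def)
    with f'(1) show "f \<in> singular_simplex_set p (subtopology X P) \<union> singular_simplex_set p (subtopology X M)"
      by (auto simp: singular_simplex_subtopology)
  qed
  from frag_split[OF this] show thesis using that unfolding singular_chain_def by metis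
qed

text \<open>The boundaries of the two components are opposite chains, one carried by
  \<open>P\<close> and the other by \<open>M\<close>; both are carried by the empty intersection and
  vanish.\<close>

lemma cycle_split_disjoint:
  assumes "openin X P" "openin X M" "P \<inter> M = {}" "scycle p (subtopology X (P \<union> M)) c"
  obtains x y where "scycle p (subtopology X P) x" "scycle p (subtopology X M) y" "c = x + y"
proof -
  obtain x y where xy: "singular_chain p (subtopology X P) x" "singular_chain p (subtopology X M) y"
    "c = x + y"
    using chain_split_disjoint[OF assms(1-3)] assms(4) by (metis scycle_chain)
  have "chain_boundary p x = - chain_boundary p y"
    using assms(4) xy(3) by (simp add: singular_cycle chain_boundary_add eq_neg_iff_add_eq_0)
  then have "singular_chain (p - Suc 0) (subtopology X (P \<inter> M)) (chain_boundary p x)"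
    using chain_Int singular_chain_boundary[OF xy(1)] singular_chain_boundary[OF xy(2)]
    by (metis singular_chain_minus)
  then have "chain_boundary p x = 0"
    using assms(3) by (simp add: singular_chain_empty)
  with \<open>chain_boundary p x = - chain_boundary p y\<close> xy that show thesis
    by (simp add: singular_cycle)
qed

section \<open>Finite generation of homology\<close>

text \<open>Stated with actual cycles as generators and integral coefficients: the values of a
  cocycle on \<open>S\<close> then determine its values on all cycles, which is how the cohomology
  becomes finite-dimensional.\<close>

definition fin_gen_homology :: "nat \<Rightarrow> 'a topology \<Rightarrow> bool" where
  "fin_gen_homology p X \<longleftrightarrow> (\<exists>S. finite S \<and> (\<forall>s\<in>S. scycle p X s) \<and>
     (\<forall>c. scycle p X c \<longrightarrow> (\<exists>n. shom p X c (\<Sum>s\<in>S. frag_cmul (n s) s))))"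

lemma fin_gen_homologyE:
  assumes "fin_gen_homology p X"
  obtains S where "finite S" "\<forall>s\<in>S. scycle p X s"
    "\<forall>c. scycle p X c \<longrightarrow> (\<exists>n. shom p X c (\<Sum>s\<in>S. frag_cmul (n s) s))"
  using assms unfolding fin_gen_homology_def by (elim exE conjE)

lemma shom_sym: "shom p X a b \<Longrightarrow> shom p X b a"
  by (simp add: homologous_rel_sym)

lemma shom_trans: "shom p X a b \<Longrightarrow> shom p X b c \<Longrightarrow> shom p X a c"
  by (rule homologous_rel_trans)

text \<open>The generators arise as families over disjoint unions, in which the same cycle may occur
  several times; the coefficients over each fibre of \<open>s\<close> are added.\<close>

lemma fin_gen_homologyI:
  assumes "finite I" "\<And>i. i \<in> I \<Longrightarrow> scycle p X (s i)"
    and "\<And>c. scycle p X c \<Longrightarrow> \<exists>n. shom p X c (\<Sum>i\<in>I. frag_cmul (n i) (s i))"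
  shows "fin_gen_homology p X"
proof -
  have "\<exists>m. shom p X c (\<Sum>x\<in>s ` I. frag_cmul (m x) x)" if c: "scycle p X c" for c
  proof -
    obtain n where n: "shom p X c (\<Sum>i\<in>I. frag_cmul (n i) (s i))" using assms(3) c by blast
    have const: "(\<Sum>i\<in>J. frag_cmul (n i) (s i)) = frag_cmul (\<Sum>i\<in>J. n i) x" if "\<forall>i\<in>J. s i = x" for J x
      using that by (induction J rule: infinite_finite_induct) (auto simp: frag_cmul_distrib)
    have "(\<Sum>i\<in>I. frag_cmul (n i) (s i)) = (\<Sum>x\<in>s ` I. \<Sum>i\<in>{i \<in> I. s i = x}. frag_cmul (n i) (s i))"
      by (rule sum.image_gen[OF assms(1)])
    also have "\<dots> = (\<Sum>x\<in>s ` I. frag_cmul (\<Sum>i\<in>{i \<in> I. s i = x}. n i) x)"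
      by (intro sum.cong refl const) auto
    finally show ?thesis using n by (intro exI[of _ "\<lambda>x. \<Sum>i\<in>{i \<in> I. s i = x}. n i"]) simp
  qed
  moreover have "finite (s ` I)" "\<forall>x\<in>s ` I. scycle p X x" using assms(1,2) by auto
  ultimately show ?thesis unfolding fin_gen_homology_def
    by (intro exI[of _ "s ` I"] conjI allI impI) simp_all
qed

lemma scycle_sum_cmul:
  "(\<And>i. i \<in> I \<Longrightarrow> scycle p X (s i)) \<Longrightarrow> scycle p X (\<Sum>i\<in>I. frag_cmul (n i) (s i))"
  by (intro singular_relcycle_sum singular_relcycle_cmul)

lemma chain_map_sum_cmul:
  "chain_map p f (\<Sum>i\<in>I. frag_cmul (n i) (s i)) = (\<Sum>i\<in>I. frag_cmul (n i) (chain_map p f (s i)))"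
  by (induction I rule: infinite_finite_induct) (simp_all add: chain_map_add)

lemma chain_boundary_sum_cmul:
  "chain_boundary p (\<Sum>i\<in>I. frag_cmul (n i) (s i)) = (\<Sum>i\<in>I. frag_cmul (n i) (chain_boundary p (s i)))"
  by (induction I rule: infinite_finite_induct) (simp_all add: chain_boundary_add chain_boundary_cmul)

section \<open>Mayer-Vietoris for a bundle of punctured discs\<close>

text \<open>
  The model is a bundle over \<open>Y\<close> with fibre a punctured disc, covered by two slit discs \<open>U\<close> and \<open>W\<close>
  that meet in two half discs \<open>P\<close> and \<open>M\<close>.
\<close>

locale tube =
  fixes Z :: "'a topology" and Y :: "'b topology" and U W P M :: "'a set"
    and p :: "'a \<Rightarrow> 'b" and sU sW sP sM :: "'b \<Rightarrow> 'a"
  assumes open_U: "openin Z U" and open_W: "openin Z W" and open_P: "openin Z P" and open_M: "openin Z M"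
    and cover: "topspace Z \<subseteq> U \<union> W" and Int: "U \<inter> W = P \<union> M" and disj: "P \<inter> M = {}"
    and cont_p: "continuous_map Z Y p"
    and cont_sU: "continuous_map Y (subtopology Z U) sU"
    and cont_sW: "continuous_map Y (subtopology Z W) sW"
    and cont_sP: "continuous_map Y (subtopology Z P) sP"
    and cont_sM: "continuous_map Y (subtopology Z M) sM"
    and ret_U: "homotopic_with (\<lambda>_. True) (subtopology Z U) (subtopology Z U) (sU \<circ> p) id"
    and ret_W: "homotopic_with (\<lambda>_. True) (subtopology Z W) (subtopology Z W) (sW \<circ> p) id"
    and ret_P: "homotopic_with (\<lambda>_. True) (subtopology Z P) (subtopology Z P) (sP \<circ> p) id"
    and ret_M: "homotopic_with (\<lambda>_. True) (subtopology Z M) (subtopology Z M) (sM \<circ> p) id"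
    and p_sP: "\<And>y. y \<in> topspace Y \<Longrightarrow> p (sP y) = y"
    and p_sM: "\<And>y. y \<in> topspace Y \<Longrightarrow> p (sM y) = y"
begin

lemma ret_hom:
  assumes "homotopic_with (\<lambda>_. True) (subtopology Z R) (subtopology Z R) (s \<circ> p) id"
    and "scycle q (subtopology Z R) c"
  shows "shom q (subtopology Z R) (chain_map q s (chain_map q p c)) c"
  using shom_homotopic_id[OF assms] by (simp add: chain_map_compose)

lemma cont_p_sub: "continuous_map (subtopology Z R) Y p"
  using cont_p by (rule continuous_map_from_subtopology)

lemma PM_sub: "P \<subseteq> U" "P \<subseteq> W" "M \<subseteq> U" "M \<subseteq> W"
  using Int by auto

text \<open>Since \<open>p \<circ> s'\<close> is the identity, the retraction
  \<open>s \<circ> p\<close> of \<open>R\<close> carries the image of \<open>s'\<close> to that of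
  \<open>s\<close>. Thus \<open>sP\<close> and \<open>sM\<close> can be compared inside either slit
  disc, through \<open>sU\<close> or \<open>sW\<close>.\<close>

lemma section_hom:
  assumes "scycle q Y y"
    and "homotopic_with (\<lambda>_. True) (subtopology Z R) (subtopology Z R) (s \<circ> p) id"
    and "continuous_map Y (subtopology Z R') s'" "R' \<subseteq> R" "\<And>y. y \<in> topspace Y \<Longrightarrow> p (s' y) = y"
  shows "shom q (subtopology Z R) (chain_map q s' y) (chain_map q s y)"
proof -
  have "scycle q (subtopology Z R') (chain_map q s' y)" by (rule scycle_chain_map[OF assms(1,3)])
  then have "scycle q (subtopology Z R) (chain_map q s' y)" by (rule singular_cycle_mono[OF _ assms(4)])
  note this[THEN ret_hom[OF assms(2)]]
  moreover have "chain_map q p (chain_map q s' y) = y"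
    using chain_map_id_gen[OF scycle_chain[OF assms(1)], of "p \<circ> s'"] assms(5)
    by (simp add: chain_map_compose)
  ultimately show ?thesis by (simp add: homologous_rel_sym)
qed

text \<open>Each slit disc has the homology of \<open>Y\<close>, and its own section may be replaced
  by \<open>sP\<close> because \<open>P\<close> lies in both. A cycle in \<open>U\<close> plus a
  cycle in \<open>W\<close> is therefore determined, up to homology, by its projection.\<close>

lemma split_cycles_hom:
  assumes a: "scycle q (subtopology Z U) a" and b: "scycle q (subtopology Z W) b"
  shows "shom q Z (a + b) (chain_map q sP (chain_map q p (a + b)))"
proof -
  have pa: "scycle q Y (chain_map q p a)" and pb: "scycle q Y (chain_map q p b)"
    using scycle_chain_map[OF a cont_p_sub] scycle_chain_map[OF b cont_p_sub] .
  have "shom q (subtopology Z U) (chain_map q sP (chain_map q p a)) (chain_map q sU (chain_map q p a))"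
    by (rule section_hom[OF pa ret_U cont_sP PM_sub(1) p_sP])
  from homologous_rel_trans[OF ret_hom[OF ret_U a] this] have 1: "shom q Z (chain_map q sP (chain_map q p a)) a"
    by (rule shom_mono_top)
  have "shom q (subtopology Z W) (chain_map q sP (chain_map q p b)) (chain_map q sW (chain_map q p b))"
    by (rule section_hom[OF pb ret_W cont_sP PM_sub(2) p_sP])
  from homologous_rel_trans[OF ret_hom[OF ret_W b] this] have 2: "shom q Z (chain_map q sP (chain_map q p b)) b"
    by (rule shom_mono_top)
  from homologous_rel_add[OF 1 2] show ?thesis
    by (simp add: chain_map_add homologous_rel_sym)
qed

lemma split_cycles_null:
  assumes "scycle q (subtopology Z U) a" "scycle q (subtopology Z W) b"
    and "shom q Y (chain_map q p (a + b)) 0"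
  shows "shom q Z (a + b) 0"
proof -
  have "shom q Z (chain_map q sP (chain_map q p (a + b))) (chain_map q sP 0)"
    by (rule shom_chain_map[OF assms(3) continuous_map_into_fulltopology[OF cont_sP]])
  from homologous_rel_trans[OF this split_cycles_hom[OF assms(1,2)]] show ?thesis by simp
qed

text \<open>Here \<open>x\<close> and \<open>y\<close> are the two components of the Mayer-Vietoris boundary of \<open>w\<close>.\<close>

lemma cycle_decomp:
  assumes "scycle (Suc q) Z w"
  obtains u v x y where "singular_chain (Suc q) (subtopology Z U) u"
    "singular_chain (Suc q) (subtopology Z W) v" "shom (Suc q) Z w (u + v)"
    "scycle q (subtopology Z P) x" "scycle q (subtopology Z M) y"
    "chain_boundary (Suc q) u = x + y" "chain_boundary (Suc q) v = - (x + y)"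
proof -
  obtain u v where uv: "singular_chain (Suc q) (subtopology Z U) u"
    "singular_chain (Suc q) (subtopology Z W) v" "shom (Suc q) Z w (u + v)"
    by (rule cycle_split[OF open_U open_W cover assms])
  have "scycle (Suc q) Z (u + v)" by (rule shom_scycle[OF shom_sym[OF uv(3)] assms])
  then have eq: "chain_boundary (Suc q) v = - chain_boundary (Suc q) u"
    by (simp add: singular_cycle chain_boundary_add eq_neg_iff_add_eq_0 add.commute)
  have "singular_chain q (subtopology Z (U \<inter> W)) (chain_boundary (Suc q) u)"
    using singular_chain_boundary_alt[OF uv(1)] singular_chain_boundary_alt[OF uv(2)]
    unfolding eq singular_chain_minus by (rule chain_Int)
  then have "scycle q (subtopology Z (P \<union> M)) (chain_boundary (Suc q) u)"
    using chain_boundary_boundary_alt[OF uv(1)] by (simp add: singular_cycle Int)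
  then obtain x y where
    "scycle q (subtopology Z P) x" "scycle q (subtopology Z M) y" "chain_boundary (Suc q) u = x + y"
    by (rule cycle_split_disjoint[OF open_P open_M disj])
  with uv eq that show thesis by simp
qed

text \<open>The weighted sum \<open>D\<close> respects all four pieces and covers the sum
  \<open>E\<close> on \<open>Y\<close>. After applying \<open>D\<close>, both components of the
  Mayer-Vietoris boundary of \<open>w\<close> bound by the hypothesis in degree \<open>q\<close>.
  Correcting by these fillings turns the images of the two halves of \<open>w\<close> into separate
  cycles in \<open>U\<close> and \<open>W\<close>, and their sum bounds because its projection
  does.\<close>

lemma kernel_killed:
  fixes e :: "'g \<Rightarrow> int" and \<alpha> :: "'g \<Rightarrow> 'a \<Rightarrow> 'a" and \<beta> :: "'g \<Rightarrow> 'b \<Rightarrow> 'b"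
  assumes cont_\<alpha>: "\<And>g. g \<in> G \<Longrightarrow> continuous_map Z Z (\<alpha> g)"
    and cont_\<beta>: "\<And>g. g \<in> G \<Longrightarrow> continuous_map Y Y (\<beta> g)"
    and inv: "\<And>g R x. g \<in> G \<Longrightarrow> R \<in> {U, W, P, M} \<Longrightarrow> x \<in> topspace Z \<Longrightarrow> x \<in> R \<Longrightarrow> \<alpha> g x \<in> R"
    and equiv: "\<And>g x. g \<in> G \<Longrightarrow> x \<in> topspace Z \<Longrightarrow> p (\<alpha> g x) = \<beta> g (p x)"
    and hyp: "\<And>q z. i = Suc q \<Longrightarrow> scycle q Y z \<Longrightarrow>
                shom q Y (\<Sum>g\<in>G. frag_cmul (e g) (chain_map q (\<beta> g) z)) 0"
    and w: "scycle i Z w" "shom i Y (chain_map i p w) 0"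
  shows "shom i Z (\<Sum>g\<in>G. frag_cmul (e g) (chain_map i (\<alpha> g) w)) 0"
proof -
  define D where "D q c = (\<Sum>g\<in>G. frag_cmul (e g) (chain_map q (\<alpha> g) c))" for q c
  define E where "E q c = (\<Sum>g\<in>G. frag_cmul (e g) (chain_map q (\<beta> g) c))" for q c
  have cont_R: "continuous_map (subtopology Z R) (subtopology Z R) (\<alpha> g)"
    if "g \<in> G" "R \<in> {U, W, P, M}" for g R
    using continuous_map_from_subtopology[OF cont_\<alpha>[OF that(1)], of R] inv[OF that]
    by (auto simp: continuous_map_in_subtopology)
  have D_add: "D q (a + b) = D q a + D q b" for q a b
    by (simp add: D_def chain_map_add frag_cmul_distrib2 sum.distrib)
  have D_chain: "singular_chain q (subtopology Z R) (D q c)"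
    if "singular_chain q (subtopology Z R) c" "R \<in> {U, W, P, M}" for q R c
    unfolding D_def
    by (intro singular_chain_sum singular_chain_cmul singular_chain_chain_map[OF that(1)] cont_R that(2))
  have D_cycle: "scycle q (subtopology Z R) (D q c)"
    if "scycle q (subtopology Z R) c" "R \<in> {U, W, P, M}" for q R c
    unfolding D_def
    by (intro scycle_sum_cmul scycle_chain_map[OF that(1)] cont_R that(2))
  have D_boundary: "chain_boundary (Suc q) (D (Suc q) c) = D q (chain_boundary (Suc q) c)"
    if "singular_chain (Suc q) X c" for q c and X :: "'a topology"
    unfolding D_def chain_boundary_sum_cmul
    by (intro sum.cong refl arg_cong[where f = "frag_cmul _"] chain_boundary_chain_map_Suc[OF that])
  have D_hom: "shom q Z (D q a) (D q b)" if "shom q Z a b" for q a b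
    unfolding D_def by (intro shom_sum shom_cmul shom_chain_map[OF that] cont_\<alpha>)
  have E_hom: "shom q Y (E q a) (E q b)" if "shom q Y a b" for q a b
    unfolding E_def by (intro shom_sum shom_cmul shom_chain_map[OF that] cont_\<beta>)
  have p_D: "chain_map q p (D q c) = E q (chain_map q p c)" if c: "singular_chain q Z c" for q c
    unfolding D_def E_def chain_map_sum_cmul
  proof (intro sum.cong refl arg_cong[where f = "frag_cmul _"])
    fix g assume "g \<in> G"
    then have "chain_map q (p \<circ> \<alpha> g) c = chain_map q (\<beta> g \<circ> p) c"
      by (intro chain_map_eq[OF c]) (simp add: equiv)
    then show "chain_map q p (chain_map q (\<alpha> g) c) = chain_map q (\<beta> g) (chain_map q p c)"
      by (simp add: chain_map_compose)
  qed
  have sub_Z: "singular_chain q Z c" if "singular_chain q (subtopology Z R) c" for q R c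
    using that by (simp add: singular_chain_subtopology)
  show ?thesis
  proof (cases i)
    case 0
    \<comment> \<open>No Mayer-Vietoris boundary arises in degree 0: every 0-chain is a cycle, so
      the two halves already are cycles.\<close>
    obtain u v where uv: "singular_chain 0 (subtopology Z U) u"
      "singular_chain 0 (subtopology Z W) v" "shom 0 Z w (u + v)"
      using w(1) unfolding 0 by (rule cycle_split[OF open_U open_W cover])
    have cyc: "scycle 0 (subtopology Z U) u" "scycle 0 (subtopology Z W) v"
      using uv by (auto simp: singular_cycle chain_boundary_def)
    have "shom 0 Y (chain_map 0 p (u + v)) 0"
      by (rule shom_trans[OF shom_sym[OF shom_chain_map[OF uv(3) cont_p]] w(2)[unfolded 0]])
    from homologous_rel_trans[OF split_cycles_null[OF cyc this] uv(3)]
    have "shom 0 Z w 0" .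
    from D_hom[OF this] show ?thesis by (simp add: D_def 0)
  next
    case (Suc q)
    note w' = w[unfolded Suc]
    from cycle_decomp[OF w'(1)] obtain u v x y where uv: "singular_chain (Suc q) (subtopology Z U) u"
      "singular_chain (Suc q) (subtopology Z W) v" "shom (Suc q) Z w (u + v)"
      and xy: "scycle q (subtopology Z P) x" "scycle q (subtopology Z M) y"
      "chain_boundary (Suc q) u = x + y" "chain_boundary (Suc q) v = - (x + y)" .
    \<comment> \<open>\<open>E\<close> of the projected cycle bounds in \<open>Y\<close>, and the
      piece \<open>R\<close> retracts to the image of its section, which carries the filling back to
      \<open>R\<close>.\<close>
    have null: "\<exists>d. singular_chain (Suc q) (subtopology Z R) d \<and> chain_boundary (Suc q) d = D q c"
      if c: "scycle q (subtopology Z R) c" and R: "R \<in> {U, W, P, M}"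
        and ret: "homotopic_with (\<lambda>_. True) (subtopology Z R) (subtopology Z R) (s \<circ> p) id"
        and s: "continuous_map Y (subtopology Z R) s" for R s c
    proof -
      have "shom q Y (E q (chain_map q p c)) 0"
        unfolding E_def by (rule hyp[OF Suc scycle_chain_map[OF c cont_p_sub]])
      then have "shom q Y (chain_map q p (D q c)) 0"
        using p_D[OF sub_Z[OF scycle_chain[OF c]]] by simp
      from shom_chain_map[OF this s]
      have "shom q (subtopology Z R) (chain_map q s (chain_map q p (D q c))) 0" by simp
      from shom_trans[OF shom_sym[OF ret_hom[OF ret D_cycle[OF c R]]] this]
      have "shom q (subtopology Z R) (D q c) 0" .
      then show ?thesis by (simp add: homologous_rel_def singular_boundary)
    qed
    obtain x' where x': "singular_chain (Suc q) (subtopology Z P) x'" "chain_boundary (Suc q) x' = D q x"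
      using null[OF xy(1) _ ret_P cont_sP] by auto
    obtain y' where y': "singular_chain (Suc q) (subtopology Z M) y'" "chain_boundary (Suc q) y' = D q y"
      using null[OF xy(2) _ ret_M cont_sM] by auto
    \<comment> \<open>The same chain \<open>x' + y'\<close> is used with opposite signs, so the sum
      of \<open>a\<close> and \<open>b\<close> is unaffected by the correction.\<close>
    define a where "a = D (Suc q) u - (x' + y')"
    define b where "b = D (Suc q) v + (x' + y')"
    have "chain_boundary (Suc q) a = 0"
      using D_boundary[OF uv(1)] xy(3) x'(2) y'(2)
      by (simp add: a_def chain_boundary_diff chain_boundary_add D_add)
    moreover have "singular_chain (Suc q) (subtopology Z U) a"
      unfolding a_def using D_chain[OF uv(1)] singular_chain_mono[OF x'(1) PM_sub(1)]
        singular_chain_mono[OF y'(1) PM_sub(3)] by (simp add: singular_chain_add singular_chain_diff)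
    ultimately have a: "scycle (Suc q) (subtopology Z U) a" by (simp add: singular_cycle)
    have "D q (- (x + y)) = - (D q x + D q y)"
    proof -
      have "D q (- (x + y)) + D q (x + y) = D q 0" by (simp only: D_add[symmetric] add.left_inverse)
      also have "D q 0 = 0" by (simp add: D_def)
      finally show ?thesis by (simp only: D_add eq_neg_iff_add_eq_0)
    qed
    then have "chain_boundary (Suc q) b = 0"
      using D_boundary[OF uv(2)] xy(4) x'(2) y'(2)
      by (simp add: b_def chain_boundary_add)
    moreover have "singular_chain (Suc q) (subtopology Z W) b"
      unfolding b_def using D_chain[OF uv(2)] singular_chain_mono[OF x'(1) PM_sub(2)]
        singular_chain_mono[OF y'(1) PM_sub(4)] by (simp add: singular_chain_add)
    ultimately have b: "scycle (Suc q) (subtopology Z W) b" by (simp add: singular_cycle)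
    have ab: "a + b = D (Suc q) (u + v)" by (simp add: a_def b_def D_add)
    have "shom (Suc q) Y (chain_map (Suc q) p (u + v)) 0"
      by (rule shom_trans[OF shom_sym[OF shom_chain_map[OF uv(3) cont_p]] w'(2)])
    from E_hom[OF this] have "shom (Suc q) Y (E (Suc q) (chain_map (Suc q) p (u + v))) 0"
      by (simp add: E_def)
    then have "shom (Suc q) Y (chain_map (Suc q) p (a + b)) 0"
      unfolding ab by (simp only: p_D[OF singular_chain_add[OF sub_Z[OF uv(1)] sub_Z[OF uv(2)]]])
    from split_cycles_null[OF a b this] have "shom (Suc q) Z (D (Suc q) (u + v)) 0" unfolding ab .
    from homologous_rel_trans[OF this D_hom[OF uv(3)]] show ?thesis by (simp add: D_def Suc)
  qed
qed

text \<open>Generators are the images under \<open>sP\<close> of generators in degree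
  \<open>i\<close> and, for each generator \<open>s\<close> one degree lower, the class
  \<open>u' s - v' s\<close> that sweeps \<open>s\<close> once around the puncture:
  \<open>u' s\<close> and \<open>v' s\<close> join the copies of \<open>s\<close> in
  \<open>P\<close> and \<open>M\<close> through the two slit discs.\<close>

lemma fin_gen_total:
  assumes "fin_gen_homology i Y" "\<And>q. i = Suc q \<Longrightarrow> fin_gen_homology q Y"
  shows "fin_gen_homology i Z"
proof -
  obtain T where T0: "finite T" "\<forall>t\<in>T. scycle i Y t"
    "\<forall>c. scycle i Y c \<longrightarrow> (\<exists>n. shom i Y c (\<Sum>t\<in>T. frag_cmul (n t) t))"
    by (rule fin_gen_homologyE[OF assms(1)])
  note T = T0(1) T0(2)[rule_format] T0(3)[rule_format]
  have cont_sPZ: "continuous_map Y Z sP" by (rule continuous_map_into_fulltopology[OF cont_sP])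
  have split: "\<exists>n. shom i Z (a + b) (\<Sum>t\<in>T. frag_cmul (n t) (chain_map i sP t))"
    if "scycle i (subtopology Z U) a" "scycle i (subtopology Z W) b" for a b
  proof -
    have ab: "scycle i Z (a + b)" by (rule singular_relcycle_add[OF that[THEN scycle_mono_top]])
    have cyc: "scycle i Y (chain_map i p (a + b))" by (rule scycle_chain_map[OF ab cont_p])
    obtain n where n: "shom i Y (chain_map i p (a + b)) (\<Sum>t\<in>T. frag_cmul (n t) t)"
      by (rule exE[OF T(3)[OF cyc]])
    have "shom i Z (chain_map i sP (chain_map i p (a + b))) (chain_map i sP (\<Sum>t\<in>T. frag_cmul (n t) t))"
      by (rule shom_chain_map[OF n cont_sPZ])
    from shom_trans[OF split_cycles_hom[OF that] this]
    show ?thesis unfolding chain_map_sum_cmul by (rule exI[of _ n])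
  qed
  show ?thesis
  proof (cases i)
    case 0
    show ?thesis
    proof (rule fin_gen_homologyI[OF T(1), of _ _ "chain_map i sP"])
      show "scycle i Z (chain_map i sP t)" if "t \<in> T" for t
        by (rule scycle_chain_map[OF T(2)[OF that] cont_sPZ])
      fix w assume w: "scycle i Z w"
      obtain u v where uv: "singular_chain i (subtopology Z U) u"
        "singular_chain i (subtopology Z W) v" "shom i Z w (u + v)"
        using w by (rule cycle_split[OF open_U open_W cover])
      have "scycle i (subtopology Z U) u" "scycle i (subtopology Z W) v"
        using uv 0 by (auto simp: singular_cycle chain_boundary_def)
      from split[OF this] obtain n where "shom i Z (u + v) (\<Sum>t\<in>T. frag_cmul (n t) (chain_map i sP t))" ..
      from shom_trans[OF uv(3) this]
      show "\<exists>n. shom i Z w (\<Sum>t\<in>T. frag_cmul (n t) (chain_map i sP t))" by (rule exI[of _ n])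
    qed
  next
    case (Suc q)
    obtain S where S0: "finite S" "\<forall>s\<in>S. scycle q Y s"
      "\<forall>c. scycle q Y c \<longrightarrow> (\<exists>n. shom q Y c (\<Sum>s\<in>S. frag_cmul (n s) s))"
      by (rule fin_gen_homologyE[OF assms(2)[OF Suc]])
    note S = S0(1) S0(2)[rule_format] S0(3)[rule_format]
    have conn: "\<exists>d. singular_chain (Suc q) (subtopology Z R) d \<and>
        chain_boundary (Suc q) d = chain_map q sP s - chain_map q sM s"
      if s: "s \<in> S" and R: "P \<subseteq> R" "M \<subseteq> R"
        and ret: "homotopic_with (\<lambda>_. True) (subtopology Z R) (subtopology Z R) (sR \<circ> p) id" for s R sR
    proof -
      have "shom q (subtopology Z R) (chain_map q sR s) (chain_map q sM s)"
        using section_hom[OF S(2)[OF s] ret cont_sM R(2) p_sM] by (simp add: homologous_rel_sym)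
      from homologous_rel_trans[OF this section_hom[OF S(2)[OF s] ret cont_sP R(1) p_sP]]
      have "shom q (subtopology Z R) (chain_map q sP s) (chain_map q sM s)" .
      then show ?thesis by (simp add: homologous_rel_def singular_boundary)
    qed
    have "\<forall>s\<in>S. \<exists>d. singular_chain (Suc q) (subtopology Z U) d \<and>
        chain_boundary (Suc q) d = chain_map q sP s - chain_map q sM s"
      using conn[OF _ PM_sub(1,3) ret_U] by (rule ballI)
    from bchoice[OF this] obtain u' where u'': "\<forall>s\<in>S. singular_chain (Suc q) (subtopology Z U) (u' s) \<and>
        chain_boundary (Suc q) (u' s) = chain_map q sP s - chain_map q sM s" ..
    note u' = u''[rule_format, THEN conjunct1] u''[rule_format, THEN conjunct2]
    have "\<forall>s\<in>S. \<exists>d. singular_chain (Suc q) (subtopology Z W) d \<and>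
        chain_boundary (Suc q) d = chain_map q sP s - chain_map q sM s"
      using conn[OF _ PM_sub(2,4) ret_W] by (rule ballI)
    from bchoice[OF this] obtain v' where v'': "\<forall>s\<in>S. singular_chain (Suc q) (subtopology Z W) (v' s) \<and>
        chain_boundary (Suc q) (v' s) = chain_map q sP s - chain_map q sM s" ..
    note v' = v''[rule_format, THEN conjunct1] v''[rule_format, THEN conjunct2]
    let ?f = "case_sum (chain_map i sP) (\<lambda>s. u' s - v' s)"
    have sub_Z: "singular_chain q Z c" if "singular_chain q (subtopology Z R) c" for q R c
      using that by (simp add: singular_chain_subtopology)
    show ?thesis
    proof (rule fin_gen_homologyI[of "T <+> S" _ _ ?f])
      show "finite (T <+> S)" using S T by simp
      show "scycle i Z (?f j)" if "j \<in> T <+> S" for j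
      proof (cases j)
        case (Inl t)
        then have "t \<in> T" using that by auto
        then show ?thesis using scycle_chain_map[OF T(2) cont_sPZ] by (simp add: Inl)
      next
        case (Inr s)
        then have s: "s \<in> S" using that by auto
        show ?thesis
          using u'(2)[OF s] v'(2)[OF s] sub_Z[OF u'(1)[OF s]] sub_Z[OF v'(1)[OF s]]
          by (simp add: Inr Suc singular_cycle singular_chain_diff chain_boundary_diff)
      qed
      fix w assume w: "scycle i Z w"
      from cycle_decomp[OF w[unfolded Suc]] obtain u v x y where
        uv: "singular_chain (Suc q) (subtopology Z U) u"
        "singular_chain (Suc q) (subtopology Z W) v" "shom (Suc q) Z w (u + v)"
        and xy: "scycle q (subtopology Z P) x" "scycle q (subtopology Z M) y"
        "chain_boundary (Suc q) u = x + y" "chain_boundary (Suc q) v = - (x + y)" .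
      obtain n where n: "shom q Y (chain_map q p x) (\<Sum>s\<in>S. frag_cmul (n s) s)"
        using S(3)[OF scycle_chain_map[OF xy(1) cont_p_sub]] ..
      \<comment> \<open>The projection of \<open>u\<close> is a filling of the projected sum
        \<open>x + y\<close>, so the two projections are opposite classes in \<open>Y\<close>: the
        coefficients found for \<open>x\<close> serve for \<open>y\<close> with the opposite
        sign.\<close>
      have "shom q Y (chain_boundary (Suc q) (chain_map (Suc q) p u)) 0"
        by (rule shom_boundary[OF singular_chain_chain_map[OF uv(1) cont_p_sub]])
      then have "shom q Y (chain_map q p x + chain_map q p y) 0"
        by (simp only: chain_boundary_chain_map_Suc[OF uv(1)] xy(3) chain_map_add)
      from homologous_rel_diff[OF this n]
      have n': "shom q Y (chain_map q p y) (- (\<Sum>s\<in>S. frag_cmul (n s) s))" by simp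
      have "shom q (subtopology Z P) x (\<Sum>s\<in>S. frag_cmul (n s) (chain_map q sP s))"
        using homologous_rel_trans[OF shom_chain_map[OF n cont_sP] ret_hom[OF ret_P xy(1), THEN homologous_rel_sym[THEN iffD1]]]
        by (simp add: chain_map_sum_cmul)
      then obtain x' where x': "singular_chain (Suc q) (subtopology Z P) x'"
        "chain_boundary (Suc q) x' = x - (\<Sum>s\<in>S. frag_cmul (n s) (chain_map q sP s))"
        by (rule shomE)
      have "shom q (subtopology Z M) y (- (\<Sum>s\<in>S. frag_cmul (n s) (chain_map q sM s)))"
        using homologous_rel_trans[OF shom_chain_map[OF n' cont_sM] ret_hom[OF ret_M xy(2), THEN homologous_rel_sym[THEN iffD1]]]
        by (simp add: chain_map_sum_cmul chain_map_minus)
      then obtain y' where y': "singular_chain (Suc q) (subtopology Z M) y'"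
        "chain_boundary (Suc q) y' = y + (\<Sum>s\<in>S. frag_cmul (n s) (chain_map q sM s))"
        by (rule shomE) simp
      \<comment> \<open>Subtracting the sweeping classes with coefficients \<open>n\<close> leaves a
        Mayer-Vietoris boundary that \<open>x'\<close> and \<open>y'\<close> fill, so
        \<open>a\<close> and \<open>b\<close> are cycles and \<open>split\<close> applies to
        them.\<close>
      define a where "a = u - (\<Sum>s\<in>S. frag_cmul (n s) (u' s)) - (x' + y')"
      define b where "b = v + (\<Sum>s\<in>S. frag_cmul (n s) (v' s)) + (x' + y')"
      have bd: "(\<Sum>s\<in>S. frag_cmul (n s) (chain_boundary (Suc q) (f s)))
          = (\<Sum>s\<in>S. frag_cmul (n s) (chain_map q sP s)) - (\<Sum>s\<in>S. frag_cmul (n s) (chain_map q sM s))"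
        if "\<And>s. s \<in> S \<Longrightarrow> chain_boundary (Suc q) (f s) = chain_map q sP s - chain_map q sM s" for f
        using that by (simp add: frag_cmul_diff_right sum_subtractf)
      have "chain_boundary (Suc q) a = 0"
        unfolding a_def using bd[of u', OF u'(2)] xy(3) x'(2) y'(2)
        by (simp add: chain_boundary_diff chain_boundary_add chain_boundary_sum_cmul)
      moreover have "singular_chain (Suc q) (subtopology Z U) a"
        unfolding a_def using uv(1) singular_chain_mono[OF x'(1) PM_sub(1)]
          singular_chain_mono[OF y'(1) PM_sub(3)] u'(1)
        by (intro singular_chain_diff singular_chain_add singular_chain_sum singular_chain_cmul) auto
      ultimately have a: "scycle i (subtopology Z U) a" by (simp add: singular_cycle Suc)
      have "chain_boundary (Suc q) b = 0"
        unfolding b_def using bd[of v', OF v'(2)] xy(4) x'(2) y'(2)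
        by (simp add: chain_boundary_add chain_boundary_sum_cmul)
      moreover have "singular_chain (Suc q) (subtopology Z W) b"
        unfolding b_def using uv(2) singular_chain_mono[OF x'(1) PM_sub(2)]
          singular_chain_mono[OF y'(1) PM_sub(4)] v'(1)
        by (intro singular_chain_add singular_chain_sum singular_chain_cmul) auto
      ultimately have b: "scycle i (subtopology Z W) b" by (simp add: singular_cycle Suc)
      have uv_ab: "u + v = (a + b) + (\<Sum>s\<in>S. frag_cmul (n s) (u' s - v' s))"
        by (simp add: a_def b_def frag_cmul_diff_right sum_subtractf)
      from split[OF a b] obtain m where
        "shom i Z (a + b) (\<Sum>t\<in>T. frag_cmul (m t) (chain_map i sP t))" ..
      from homologous_rel_add[OF this homologous_rel_refl[of _ _ _ "\<Sum>s\<in>S. frag_cmul (n s) (u' s - v' s)"]]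
      have "shom i Z (u + v) (\<Sum>j\<in>T <+> S. frag_cmul (case_sum m n j) (?f j))"
        unfolding uv_ab using S(1) T(1) by (simp add: sum.Plus)
      from homologous_rel_trans[OF this uv(3)[folded Suc]]
      show "\<exists>n. shom i Z w (\<Sum>j\<in>T <+> S. frag_cmul (n j) (?f j))"
        by (rule exI[of _ "case_sum m n"])
    qed
  qed
qed

end

section \<open>Spaces of finite families of complex numbers\<close>

definition CC :: "nat set \<Rightarrow> (nat \<Rightarrow> complex) topology" where
  "CC N = product_topology (\<lambda>_. euclidean) N"

text \<open>The labels form an arbitrary set rather than an initial segment, so that forgetting any
  point stays within the same family of spaces.\<close>

definition PC :: "nat set \<Rightarrow> (nat \<Rightarrow> complex) topology" where
  "PC N = subtopology (CC N) {x. inj_on x N}"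

lemma topspace_CC [simp]: "topspace (CC N) = extensional N"
  by (simp add: CC_def PiE_def)

lemma topspace_PC [simp]: "topspace (PC N) = {x \<in> extensional N. inj_on x N}"
  by (auto simp: PC_def)

lemma continuous_map_CC_iff:
  "continuous_map X (subtopology (CC N) S) f \<longleftrightarrow>
     (\<forall>x\<in>topspace X. f x \<in> extensional N \<and> f x \<in> S) \<and>
     (\<forall>k\<in>N. continuous_map X euclidean (\<lambda>x. f x k))"
  by (auto simp: CC_def continuous_map_in_subtopology continuous_map_componentwise)

lemma continuous_map_CC_coord:
  "k \<in> N \<Longrightarrow> continuous_map (subtopology (CC N) S) euclidean (\<lambda>x. x k)"
  unfolding CC_def
  by (rule continuous_map_from_subtopology) (rule continuous_map_product_projection)

section \<open>Continuity of real and complex functions on a topological space\<close>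

lemma continuous_map_euclidean_iff:
  "continuous_map X euclidean f \<longleftrightarrow> (\<forall>x\<in>topspace X. (f \<longlongrightarrow> f x) (atin X x))"
  by (simp add: continuous_map_atin)

lemma continuous_map_mult: "continuous_map X euclidean f \<Longrightarrow> continuous_map X euclidean g \<Longrightarrow>
    continuous_map X euclidean (\<lambda>x. f x * g x :: 'b :: real_normed_algebra)"
  unfolding continuous_map_euclidean_iff by (blast intro: tendsto_mult)

lemma continuous_map_divide: "continuous_map X euclidean f \<Longrightarrow> continuous_map X euclidean g \<Longrightarrow>
    (\<And>x. x \<in> topspace X \<Longrightarrow> g x \<noteq> 0) \<Longrightarrow>
    continuous_map X euclidean (\<lambda>x. f x / g x :: 'b :: real_normed_field)"
  unfolding continuous_map_euclidean_iff by (blast intro: tendsto_divide)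

lemma continuous_map_of_real: "continuous_map X euclidean f \<Longrightarrow>
    continuous_map X euclidean (\<lambda>x. of_real (f x) :: 'b :: real_normed_algebra_1)"
  unfolding continuous_map_euclidean_iff by (blast intro: tendsto_of_real)

lemma continuous_map_cis: "continuous_map X euclidean f \<Longrightarrow> continuous_map X euclidean (\<lambda>x. cis (f x))"
  unfolding continuous_map_euclidean_iff by (blast intro: tendsto_cis)

lemma continuous_map_sum_any: "(\<And>i. i \<in> I \<Longrightarrow> continuous_map X euclidean (f i)) \<Longrightarrow>
    continuous_map X euclidean (\<lambda>x. \<Sum>i\<in>I. f i x :: 'b :: real_normed_vector)"
  unfolding continuous_map_euclidean_iff by (intro ballI tendsto_sum) blast

lemma continuous_map_const_euclidean: "continuous_map X euclidean (\<lambda>x. c)"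
  by simp

lemma continuous_map_fst_euclidean: "continuous_map (prod_topology (top_of_set S) X) euclidean (\<lambda>z. fst z)"
  by (rule continuous_map_into_fulltopology) (rule continuous_map_fst)

lemma continuous_map_snd_compose: "continuous_map X euclidean f \<Longrightarrow>
    continuous_map (prod_topology T X) euclidean (\<lambda>z. f (snd z))"
  using continuous_map_compose[OF continuous_map_snd, of X euclidean f T] by (simp add: o_def)

lemmas euclidean_map_intros = continuous_map_add continuous_map_diff continuous_map_mult continuous_map_norm continuous_map_of_real continuous_map_cis continuous_map_sum_any continuous_map_const_euclidean continuous_map_fst_euclidean

lemma openin_less:
  assumes "continuous_map X euclidean f" "continuous_map X euclidean g"
  shows "openin X {x \<in> topspace X. f x < (g x :: real)}"
  using openin_continuous_map_preimage[OF continuous_map_diff[OF assms(2,1)], of "{0<..}"] by simp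

section \<open>Homotopies between families of points\<close>

lemma homotopic_CC:
  assumes "\<And>x. x \<in> topspace X \<Longrightarrow> h 0 x = f x" "\<And>x. x \<in> topspace X \<Longrightarrow> h 1 x = g x"
    and "\<And>t x. 0 \<le> t \<Longrightarrow> t \<le> 1 \<Longrightarrow> x \<in> topspace X \<Longrightarrow> h t x \<in> extensional N"
    and "\<And>t x. 0 \<le> t \<Longrightarrow> t \<le> 1 \<Longrightarrow> x \<in> topspace X \<Longrightarrow> h t x \<in> S"
    and "\<And>k. k \<in> N \<Longrightarrow>
      continuous_map (prod_topology (top_of_set {0..1::real}) X) euclidean (\<lambda>z. h (fst z) (snd z) k)"
  shows "homotopic_with (\<lambda>_. True) X (subtopology (CC N) S) f g"
proof -
  have "homotopic_with (\<lambda>_. True) X (subtopology (CC N) S) (h 0) (h 1)"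
    unfolding homotopic_with_def
  proof (intro exI[of _ "\<lambda>z. h (fst z) (snd z)"] conjI)
    show "continuous_map (prod_topology (top_of_set {0..1}) X) (subtopology (CC N) S) (\<lambda>z. h (fst z) (snd z))"
      using assms(3-5) by (auto simp: continuous_map_CC_iff)
  qed auto
  then show ?thesis by (rule homotopic_with_eq) (use assms(1,2) in auto)
qed

lemma homotopic_line:
  assumes "continuous_map X (subtopology (CC N) S) f" "continuous_map X (subtopology (CC N) S) g"
    and "\<And>t x. 0 \<le> t \<Longrightarrow> t \<le> 1 \<Longrightarrow> x \<in> topspace X \<Longrightarrow>
      (\<lambda>k\<in>N. of_real (1 - t) * f x k + of_real t * g x k) \<in> S"
  shows "homotopic_with (\<lambda>_. True) X (subtopology (CC N) S) f g"
proof (rule homotopic_CC[where h = "\<lambda>t x. \<lambda>k\<in>N. of_real (1 - t) * f x k + of_real t * g x k"])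
  note fg = assms(1,2)[unfolded continuous_map_CC_iff]
  fix x assume "x \<in> topspace X"
  then have "f x \<in> extensional N" "g x \<in> extensional N" using fg by auto
  then show "(\<lambda>k\<in>N. of_real (1 - 0) * f x k + of_real 0 * g x k) = f x"
    "(\<lambda>k\<in>N. of_real (1 - 1) * f x k + of_real 1 * g x k) = g x"
    by (auto simp: extensional_def restrict_def)
next
  note fg = assms(1,2)[unfolded continuous_map_CC_iff]
  fix k assume k: "k \<in> N"
  have "continuous_map (prod_topology (top_of_set {0..1}) X) euclidean (\<lambda>z. f (snd z) k)"
    "continuous_map (prod_topology (top_of_set {0..1}) X) euclidean (\<lambda>z. g (snd z) k)"
    using fg k by (auto intro: continuous_map_snd_compose)
  then show "continuous_map (prod_topology (top_of_set {0..1}) X) euclidean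
     (\<lambda>z. (\<lambda>k\<in>N. of_real (1 - fst z) * f (snd z) k + of_real (fst z) * g (snd z) k) k)"
    using k by (simp del: of_real_diff) (intro euclidean_map_intros)
qed (use assms(3) in auto)

text \<open>The points \<open>a\<close> and \<open>b\<close> turn about their midpoint through the
  angle \<open>pi * t\<close>, and all others rest. The assumption \<open>free\<close> keeps the
  resting points off the circle that has the pair as a diameter.\<close>

lemma homotopic_swap:
  assumes f: "continuous_map X (PC N) f" and ab: "a \<in> N" "b \<in> N" "a \<noteq> b"
    and free: "\<And>x l \<zeta>. x \<in> topspace X \<Longrightarrow> l \<in> N \<Longrightarrow> l \<noteq> a \<Longrightarrow> l \<noteq> b \<Longrightarrow> norm \<zeta> = 1 \<Longrightarrow>
      (f x a + f x b) / 2 + \<zeta> * ((f x a - f x b) / 2) \<noteq> f x l"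
  shows "homotopic_with (\<lambda>_. True) X (PC N) f (\<lambda>x. \<lambda>j\<in>N. f x (Transposition.transpose a b j))"
proof -
  define h where "h t x = (\<lambda>k\<in>N. if k = a then (f x a + f x b) / 2 + cis (pi * t) * ((f x a - f x b) / 2)
      else if k = b then (f x a + f x b) / 2 - cis (pi * t) * ((f x a - f x b) / 2) else f x k)" for t x
  note f' = f[unfolded PC_def continuous_map_CC_iff]
  show ?thesis
    unfolding PC_def
  proof (rule homotopic_CC[where h = h])
    fix x assume x: "x \<in> topspace X"
    then have ext: "f x \<in> extensional N" and inj: "inj_on (f x) N" using f' by auto
    show "h 0 x = f x"
      using ext ab by (auto simp: h_def extensional_def restrict_def fun_eq_iff field_simps)
    show "h 1 x = (\<lambda>j\<in>N. f x (Transposition.transpose a b j))"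
      using ab by (auto simp: h_def restrict_def fun_eq_iff field_simps Transposition.transpose_def)
    fix t :: real
    show "h t x \<in> extensional N" by (simp add: h_def)
    define d where "d = cis (pi * t) * ((f x a - f x b) / 2)"
    have "d \<noteq> 0" using inj ab by (auto simp: d_def inj_on_def)
    have d1: "(f x a + f x b) / 2 + d \<noteq> f x l" if "l \<in> N" "l \<noteq> a" "l \<noteq> b" for l
      using free[OF x that, of "cis (pi * t)"] by (simp add: d_def)
    \<comment> \<open>The point \<open>b\<close> sits opposite \<open>a\<close> on the circle, which
      amounts to \<open>free\<close> for \<open>- cis (pi * t)\<close>.\<close>
    have d2: "(f x a + f x b) / 2 - d \<noteq> f x l" if "l \<in> N" "l \<noteq> a" "l \<noteq> b" for l
      using free[OF x that, of "- cis (pi * t)"] by (simp add: d_def)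
    have hk: "h t x k = (if k = a then (f x a + f x b) / 2 + d
      else if k = b then (f x a + f x b) / 2 - d else f x k)" if "k \<in> N" for k
      using that by (simp add: h_def d_def)
    have "(f x a + f x b) / 2 + d \<noteq> (f x a + f x b) / 2 - d" 
      using \<open>d \<noteq> 0\<close> add_left_cancel[of "(f x a + f x b) / 2" d "- d"] by simp
    then have "h t x k \<noteq> h t x l" if "k \<in> N" "l \<in> N" "k \<noteq> l" for k l
      using that d1[of l] d2[of l] d1[of k] d2[of k] inj_onD[OF inj, of k l] by (auto simp: hk)
    then show "h t x \<in> {x. inj_on x N}" by (auto simp: inj_on_def)
  next
    fix k assume k: "k \<in> N"
    have c: "continuous_map (prod_topology (top_of_set {0..1}) X) euclidean (\<lambda>z. f (snd z) l)" if "l \<in> N" for l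
      using f' that by (auto intro: continuous_map_snd_compose)
    note ci = c[OF ab(1)] c[OF ab(2)] c[OF k]
    consider "k = a" | "k = b" | "k \<noteq> a" "k \<noteq> b" by blast
    then show "continuous_map (prod_topology (top_of_set {0..1::real}) X) euclidean (\<lambda>z. h (fst z) (snd z) k)"
    proof cases
      case 1
      then show ?thesis using k unfolding h_def
        by simp (intro continuous_map_add continuous_map_mult continuous_map_cis continuous_map_divide continuous_map_diff continuous_map_const_euclidean continuous_map_fst_euclidean ci; simp)
    next
      case 2
      then show ?thesis using k ab unfolding h_def
        by simp (intro continuous_map_add continuous_map_mult continuous_map_cis continuous_map_divide continuous_map_diff continuous_map_const_euclidean continuous_map_fst_euclidean ci; simp)
    next
      case 3
      then show ?thesis using k ci unfolding h_def by simp
    qed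
  qed
qed

section \<open>Adding a point\<close>

text \<open>
  The factor 3 makes the distance from the new point to any \<open>x q\<close> exceed all distances between the
  other points.
\<close>

definition far :: "nat set \<Rightarrow> (nat \<Rightarrow> complex) \<Rightarrow> real" where
  "far M x = 1 + 3 * (\<Sum>k\<in>M. norm (x k))"

definition add_far :: "nat \<Rightarrow> nat set \<Rightarrow> (nat \<Rightarrow> complex) \<Rightarrow> nat \<Rightarrow> complex" where
  "add_far a M x = x(a := of_real (far M x))"

definition forget_to :: "nat set \<Rightarrow> (nat \<Rightarrow> complex) \<Rightarrow> nat \<Rightarrow> complex" where
  "forget_to M x = restrict x M"

lemma norm_less_far:
  assumes "finite M" "k \<in> M"
  shows "3 * norm (x k) < far M x"
  using member_le_sum[OF assms(2), of "\<lambda>k. norm (x k)"] assms(1) by (simp add: far_def)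

text \<open>Meant for \<open>b\<close> and \<open>q\<close>: the far point has to be farther from
  \<open>x q\<close> than \<open>x b\<close> is.\<close>

lemma norm_less_far2:
  assumes "finite M" "k \<in> M" "l \<in> M" "k \<noteq> l"
  shows "3 * (norm (x k) + norm (x l)) < far M x"
proof -
  have "(\<Sum>j\<in>{k, l}. norm (x j)) \<le> (\<Sum>k\<in>M. norm (x k))"
    using assms by (intro sum_mono2) auto
  then show ?thesis using assms(4) by (simp add: far_def)
qed

lemma far_ge_1: "far M x \<ge> 1"
  by (simp add: far_def sum_nonneg)

lemma far_cong: "(\<And>k. k \<in> M \<Longrightarrow> x k = y k) \<Longrightarrow> far M x = far M y"
  by (simp add: far_def)

lemma continuous_map_far: "(\<And>k. k \<in> M \<Longrightarrow> continuous_map X euclidean (\<lambda>x. f x k)) \<Longrightarrow>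
    continuous_map X euclidean (\<lambda>x. far M (f x))"
  unfolding far_def by (intro euclidean_map_intros)

lemma add_far_extensional: "x \<in> extensional M \<Longrightarrow> add_far a M x \<in> extensional (insert a M)"
  by (auto simp: add_far_def extensional_def)

lemma inj_on_add_far:
  assumes "finite M" "a \<notin> M" "inj_on x M"
  shows "inj_on (add_far a M x) (insert a M)"
proof -
  have "x k \<noteq> of_real (far M x)" if "k \<in> M" for k
  proof
    assume "x k = of_real (far M x)"
    then have "norm (x k) = far M x" using far_ge_1[of M x] by simp
    with norm_less_far[OF assms(1) that, of x] far_ge_1[of M x] show False by simp
  qed
  with assms(2,3) show ?thesis by (force simp: add_far_def inj_on_def)
qed

lemma continuous_add_far:
  assumes "a \<notin> M" "\<And>x. x \<in> extensional M \<Longrightarrow> x \<in> S \<Longrightarrow> add_far a M x \<in> S'"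
  shows "continuous_map (subtopology (CC M) S) (subtopology (CC (insert a M)) S') (add_far a M)"
  unfolding continuous_map_CC_iff
proof (intro conjI ballI)
  fix k assume "k \<in> insert a M"
  then show "continuous_map (subtopology (CC M) S) euclidean (\<lambda>x. add_far a M x k)"
    by (cases "k = a") (auto simp: add_far_def intro!: continuous_map_of_real continuous_map_far continuous_map_CC_coord)
qed (use assms(2) add_far_extensional in auto)

lemma continuous_add_far_PC:
  "finite M \<Longrightarrow> a \<notin> M \<Longrightarrow> continuous_map (PC M) (PC (insert a M)) (add_far a M)"
  unfolding PC_def by (rule continuous_add_far) (auto simp: inj_on_add_far simp del: inj_on_insert)

lemma continuous_forget_to:
  assumes "M \<subseteq> N" "\<And>x. x \<in> S \<Longrightarrow> forget_to M x \<in> S'"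
  shows "continuous_map (subtopology (CC N) S) (subtopology (CC M) S') (forget_to M)"
  unfolding continuous_map_CC_iff
proof (intro conjI ballI)
  fix k assume "k \<in> M"
  then show "continuous_map (subtopology (CC N) S) euclidean (\<lambda>x. forget_to M x k)"
    using assms(1) by (auto simp: forget_to_def intro!: continuous_map_CC_coord)
qed (use assms in \<open>auto simp: forget_to_def\<close>)

lemma inj_on_forget_to: "inj_on (forget_to M x) M \<longleftrightarrow> inj_on x M"
  by (auto simp: forget_to_def inj_on_def)

section \<open>Generation of the homology by far points and collisions\<close>

text \<open>The points \<open>x b\<close> of the open disc about \<open>x q\<close> that reaches to
  the nearest other point of \<open>M\<close>. The collision \<open>x b = x q\<close> is allowed
  here; \<open>tubeZ\<close> removes it and is the bundle of punctured discs over
  \<open>PC M\<close>.\<close>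

definition near :: "nat set \<Rightarrow> nat \<Rightarrow> nat \<Rightarrow> (nat \<Rightarrow> complex) set" where
  "near M b q = {x. \<forall>l\<in>M - {q}. norm (x b - x q) < norm (x l - x q)}"

definition tubeZ :: "nat set \<Rightarrow> nat \<Rightarrow> nat \<Rightarrow> (nat \<Rightarrow> complex) topology" where
  "tubeZ M b q = subtopology (CC (insert b M)) ({x. inj_on x (insert b M)} \<inter> near M b q)"

lemma openin_Ball:
  assumes "finite F" "\<And>l. l \<in> F \<Longrightarrow> openin X {x \<in> topspace X. P l x}"
  shows "openin X {x \<in> topspace X. \<forall>l\<in>F. P l x}"
  using assms
proof (induction F)
  case (insert l F)
  have "{x \<in> topspace X. \<forall>l\<in>insert l F. P l x} = {x \<in> topspace X. P l x} \<inter> {x \<in> topspace X. \<forall>l\<in>F. P l x}"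
    by auto
  with insert show ?case by (simp add: openin_Int)
qed simp

lemma openin_near:
  assumes "finite M" "q \<in> M"
  shows "openin (subtopology (CC (insert b M)) S) (topspace (subtopology (CC (insert b M)) S) \<inter> near M b q)"
    (is "openin ?X _")
proof -
  have "openin ?X {x \<in> topspace ?X. \<forall>l\<in>M - {q}. norm (x b - x q) < norm (x l - x q)}"
    using assms
    by (intro openin_Ball openin_less continuous_map_norm continuous_map_diff continuous_map_CC_coord) auto
  moreover have "{x \<in> topspace ?X. \<forall>l\<in>M - {q}. norm (x b - x q) < norm (x l - x q)}
      = topspace ?X \<inter> near M b q"
    by (auto simp: near_def)
  ultimately show ?thesis by simp
qed

lemma openin_neq:
  assumes "a \<in> N" "k \<in> N"
  shows "openin (subtopology (CC N) S) (topspace (subtopology (CC N) S) \<inter> {x. x a \<noteq> x k})"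
    (is "openin ?X _")
proof -
  have "openin ?X {x \<in> topspace ?X. 0 < norm (x a - x k)}"
    using assms by (intro openin_less euclidean_map_intros continuous_map_CC_coord)
  moreover have "{x \<in> topspace ?X. 0 < norm (x a - x k)} = topspace ?X \<inter> {x. x a \<noteq> x k}" by auto
  ultimately show ?thesis by simp
qed

text \<open>Interpolates between no condition on \<open>x a\<close>, for \<open>J = {}\<close>, and
  full configurations, for \<open>J = M\<close>; an induction excludes the collisions of
  \<open>a\<close> one at a time.\<close>

definition partial_conf :: "nat set \<Rightarrow> nat \<Rightarrow> nat set \<Rightarrow> (nat \<Rightarrow> complex) set" where
  "partial_conf M a J = {x. inj_on x M \<and> (\<forall>j\<in>J. x a \<noteq> x j)}"

lemma partial_conf_full: "a \<notin> M \<Longrightarrow> partial_conf M a M = {x. inj_on x (insert a M)}"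
  by (auto simp: partial_conf_def)

text \<open>A point nearer to \<open>x q\<close> than every other point of \<open>M\<close> avoids
  those points anyway. Whichever collisions have been excluded so far, removing the one with
  \<open>q\<close> from its disc leaves the same tube.\<close>

lemma near_partial_conf:
  "q \<in> M \<Longrightarrow> a \<notin> M \<Longrightarrow> J \<subseteq> M \<Longrightarrow>
    partial_conf M a J \<inter> {x. x a \<noteq> x q} \<inter> near M a q = {x. inj_on x (insert a M)} \<inter> near M a q"
  unfolding partial_conf_full[symmetric] by (force simp: partial_conf_def near_def)

lemma PC_eq_partial_conf: "a \<notin> M \<Longrightarrow> PC (insert a M) = subtopology (CC (insert a M)) (partial_conf M a M)"
  by (simp add: PC_def partial_conf_full)

text \<open>Induction on the set \<open>J\<close> of excluded collisions. When the one with
  \<open>k\<close> is excluded too, the known homology in \<open>E J\<close> is realised by a chain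
  \<open>e\<close> that may cross the locus \<open>x a = x k\<close>. Splitting \<open>e\<close>
  into a part off this locus and a part \<open>v\<close> in the disc about \<open>x k\<close> leaves
  the boundary of \<open>v\<close> as the error term, a cycle in the tube. Forgetting
  \<open>a\<close> is defined on the whole disc, so it maps \<open>v\<close> to a filling of the
  forgotten error term.\<close>

lemma generation:
  assumes M: "finite M" "a \<notin> M" and x: "scycle i (PC (insert a M)) x"
  obtains w where "\<forall>j\<in>M. scycle i (tubeZ M a j) (w j)"
    "\<forall>j\<in>M. shom i (PC M) (chain_map i (forget_to M) (w j)) 0"
    "shom i (PC (insert a M)) x
       (chain_map i (add_far a M) (chain_map i (forget_to M) x) + (\<Sum>j\<in>M. w j))"
proof -
  let ?T = "CC (insert a M)"
  define E where "E J = subtopology ?T (partial_conf M a J)" for J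
  let ?r = "\<lambda>x. chain_map i (add_far a M) (chain_map i (forget_to M) x)"
  have PC_E: "PC (insert a M) = E M" using M(2) by (simp add: E_def PC_eq_partial_conf)
  have cont_forget: "continuous_map (E J) (PC M) (forget_to M)" for J
    unfolding E_def PC_def
    by (rule continuous_forget_to) (auto simp: partial_conf_def inj_on_forget_to)
  have E_anti: "singular_chain q (E J') c" if "singular_chain q (E J) c" "J' \<subseteq> J" for q J J' c
    using singular_chain_mono[of q ?T "partial_conf M a J" c "partial_conf M a J'"] that
    by (auto simp: E_def partial_conf_def)
  have cont_r: "continuous_map (E J) (E M) (add_far a M \<circ> forget_to M)" for J
    unfolding PC_E[symmetric]
    by (rule continuous_map_compose[OF cont_forget continuous_add_far_PC[OF M]])
  have tube_E: "singular_chain q (E M) c" if "singular_chain q (tubeZ M a j) c" for q j c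
    using that singular_chain_mono[of q ?T "{x. inj_on x (insert a M)} \<inter> near M a j" c "{x. inj_on x (insert a M)}"]
      M(2) by (simp add: tubeZ_def E_def partial_conf_full)
  have "\<exists>w. (\<forall>j\<in>J. scycle i (tubeZ M a j) (w j)) \<and>
      (\<forall>j\<in>J. shom i (PC M) (chain_map i (forget_to M) (w j)) 0) \<and>
      shom i (E J) x (?r x + (\<Sum>j\<in>J. w j))"
    if "finite J" "J \<subseteq> M" "scycle i (E J) x" for J x
    using that
  proof (induction J arbitrary: x)
    case empty
    \<comment> \<open>With no condition on \<open>x a\<close>, this point can be moved in a straight
      line to its far position.\<close>
    have "continuous_map (E {}) (E {}) (add_far a M \<circ> forget_to M)"
      using cont_r[of "{}"] unfolding E_def
      by (auto simp: continuous_map_in_subtopology partial_conf_def)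
    moreover have "continuous_map (E {}) (E {}) id" by simp
    ultimately have "homotopic_with (\<lambda>_. True) (E {}) (E {}) (add_far a M \<circ> forget_to M) id"
      unfolding E_def
    proof (rule homotopic_line)
      fix t and x :: "nat \<Rightarrow> complex"
      assume x: "x \<in> topspace (subtopology ?T (partial_conf M a {}))"
      have "(\<lambda>k\<in>insert a M. of_real (1 - t) * (add_far a M \<circ> forget_to M) x k + of_real t * id x k) k = x k"
        if "k \<in> M" for k
        using that M(2) by (auto simp: add_far_def forget_to_def algebra_simps)
      then show "(\<lambda>k\<in>insert a M. of_real (1 - t) * (add_far a M \<circ> forget_to M) x k + of_real t * id x k)
          \<in> partial_conf M a {}"
        using x by (auto simp: partial_conf_def inj_on_def)
    qed
    from shom_sym[OF shom_homotopic_id[OF this empty(2)]] show ?case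
      by (simp add: chain_map_compose)
  next
    case (insert k J)
    then have k: "k \<in> M" "J \<subseteq> M" by auto
    let ?X = "E J" and ?U = "topspace (E J) \<inter> {x. x a \<noteq> x k}" and ?V = "topspace (E J) \<inter> near M a k"
    have sub_U: "subtopology ?X ?U = E (insert k J)"
    proof -
      have "partial_conf M a J \<inter> {x. x a \<noteq> x k} = partial_conf M a (insert k J)"
        by (auto simp: partial_conf_def)
      then show ?thesis by (simp add: subtopology_restrict) (simp add: E_def subtopology_subtopology)
    qed
    have sub_UV: "subtopology ?X (?U \<inter> ?V) = tubeZ M a k"
    proof -
      have "?U \<inter> ?V = topspace (E J) \<inter> ({x. x a \<noteq> x k} \<inter> near M a k)" by auto
      then have "subtopology ?X (?U \<inter> ?V) = subtopology ?T (partial_conf M a J \<inter> ({x. x a \<noteq> x k} \<inter> near M a k))"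
        by (simp only: subtopology_restrict) (simp only: E_def subtopology_subtopology)
      then show ?thesis
        using near_partial_conf[OF k(1) M(2) k(2)] by (simp add: tubeZ_def Int_assoc)
    qed
    have sub_V: "subtopology ?X ?V = subtopology ?T (partial_conf M a J \<inter> near M a k)"
      by (simp only: subtopology_restrict) (simp only: E_def subtopology_subtopology)
    have open_U: "openin ?X ?U" unfolding E_def using k by (intro openin_neq) auto
    have open_V: "openin ?X ?V" unfolding E_def using k M(1) by (intro openin_near)
    \<comment> \<open>On the collision locus the distance from \<open>x a\<close> to
      \<open>x k\<close> is 0, so \<open>a\<close> lies in the disc.\<close>
    have cover: "topspace ?X \<subseteq> ?U \<union> ?V"
    proof
      fix x assume x: "x \<in> topspace ?X"
      then have "inj_on x M" by (auto simp: E_def partial_conf_def)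
      then have "x \<in> near M a k" if "x a = x k" using that k(1) by (auto simp: near_def inj_on_def)
      with x show "x \<in> ?U \<union> ?V" by blast
    qed
    have cyc: "scycle i (E J) x"
      using insert.prems(2) E_anti[of i "insert k J" x J] by (auto simp: singular_cycle)
    obtain w where w: "\<forall>j\<in>J. scycle i (tubeZ M a j) (w j)"
      "\<forall>j\<in>J. shom i (PC M) (chain_map i (forget_to M) (w j)) 0"
      "shom i (E J) x (?r x + (\<Sum>j\<in>J. w j))"
      using insert.IH[OF k(2) cyc] by (elim exE conjE)
    from w(3) obtain e where e: "singular_chain (Suc i) (E J) e"
      "chain_boundary (Suc i) e = x - (?r x + (\<Sum>j\<in>J. w j))"
      by (rule shomE)
    let ?b = "chain_boundary (Suc i) e"
    have "singular_chain i (E (insert k J)) (w j)" if "j \<in> J" for j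
      by (rule E_anti[OF tube_E[OF scycle_chain[OF w(1)[rule_format, OF that]]] insert.prems(1)])
    moreover have "singular_chain i (E (insert k J)) (?r x)"
      using E_anti[OF singular_chain_chain_map[OF scycle_chain[OF cyc] cont_r] insert.prems(1)]
      by (simp add: chain_map_compose)
    ultimately have b_U: "singular_chain i (subtopology ?X ?U) ?b"
      unfolding e(2) sub_U
      by (intro singular_chain_diff singular_chain_add singular_chain_sum scycle_chain[OF insert.prems(2)])
    obtain u v where u: "singular_chain (Suc i) (subtopology ?X ?U) u"
      and v: "singular_chain (Suc i) (subtopology ?X ?V) v"
      and uv: "shom i (subtopology ?X ?U) ?b (chain_boundary (Suc i) u + chain_boundary (Suc i) v)"
      by (rule boundary_split[OF open_U open_V cover e(1) b_U])
    define w' where "w' = w(k := chain_boundary (Suc i) v)"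
    obtain d where d: "singular_chain (Suc i) (subtopology ?X ?U) d"
      "chain_boundary (Suc i) d = ?b - (chain_boundary (Suc i) u + chain_boundary (Suc i) v)"
      using uv by (rule shomE)
    \<comment> \<open>The boundary of \<open>v\<close> avoids the collision with \<open>k\<close> as
      well: it differs from \<open>?b\<close>, which does so, by boundaries of chains in
      \<open>?U\<close>. Hence it lies in the tube.\<close>
    have "chain_boundary (Suc i) v = ?b - chain_boundary (Suc i) u - chain_boundary (Suc i) d"
      using d(2) by simp
    then have "singular_chain i (subtopology ?X ?U) (chain_boundary (Suc i) v)"
      by (simp only: singular_chain_diff b_U singular_chain_boundary_alt[OF u] singular_chain_boundary_alt[OF d(1)])
    from chain_Int[OF this singular_chain_boundary_alt[OF v]]
    have "singular_chain i (tubeZ M a k) (chain_boundary (Suc i) v)" unfolding sub_UV .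
    then have wk: "scycle i (tubeZ M a k) (w' k)"
      using chain_boundary_boundary_alt[OF v] unfolding w'_def
      by (cases i) (simp_all add: singular_cycle chain_boundary_def)
    have "continuous_map (subtopology ?X ?V) (PC M) (forget_to M)"
      unfolding sub_V PC_def
      by (rule continuous_forget_to) (auto simp: partial_conf_def inj_on_forget_to)
    from shom_boundary[OF singular_chain_chain_map[OF v this]]
    have fk: "shom i (PC M) (chain_map i (forget_to M) (w' k)) 0"
      unfolding w'_def by (simp add: chain_boundary_chain_map_Suc[OF v])
    have "shom i (subtopology ?X ?U) (chain_boundary (Suc i) u + chain_boundary (Suc i) v)
        (0 + chain_boundary (Suc i) v)"
      by (rule homologous_rel_add[OF shom_boundary[OF u] homologous_rel_refl])
    from shom_trans[OF uv this] have "shom i (E (insert k J)) ?b (chain_boundary (Suc i) v)"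
      unfolding sub_U by simp
    from homologous_rel_add[OF this homologous_rel_refl[of _ _ _ "?r x + (\<Sum>j\<in>J. w j)"]]
    have "shom i (E (insert k J)) x (chain_boundary (Suc i) v + (?r x + (\<Sum>j\<in>J. w j)))"
      unfolding e(2) by simp
    moreover have "chain_boundary (Suc i) v + (?r x + (\<Sum>j\<in>J. w j)) = ?r x + (\<Sum>j\<in>insert k J. w' j)"
    proof -
      have "(\<Sum>j\<in>J. w j) = (\<Sum>j\<in>J. w' j)"
        using insert.hyps(2) by (intro sum.cong) (auto simp: w'_def)
      then show ?thesis using insert.hyps by (simp add: w'_def)
    qed
    ultimately have "shom i (E (insert k J)) x (?r x + (\<Sum>j\<in>insert k J. w' j))" by simp
    moreover have "\<forall>j\<in>insert k J. scycle i (tubeZ M a j) (w' j)"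
      using w(1) wk insert.hyps(2) by (simp add: w'_def)
    moreover have "\<forall>j\<in>insert k J. shom i (PC M) (chain_map i (forget_to M) (w' j)) 0"
      using w(2) fk insert.hyps(2) by (simp add: w'_def)
    ultimately show ?case by blast
  qed
  from this[OF M(1) order_refl x[unfolded PC_E]] show thesis
    using that unfolding PC_E by (elim exE conjE)
qed

section \<open>The neighbourhood of a collision\<close>

text \<open>A radius below all distances from \<open>y q\<close> to the other points, built from
  these distances by field operations so that its continuity is immediate. The summand 2 makes the
  bound strict and keeps the denominator positive when \<open>q\<close> is the only point.\<close>

definition gap :: "nat set \<Rightarrow> nat \<Rightarrow> (nat \<Rightarrow> complex) \<Rightarrow> real" where
  "gap M q y = 1 / (2 + (\<Sum>l\<in>M - {q}. 1 / norm (y l - y q)))"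

definition beside :: "nat set \<Rightarrow> nat \<Rightarrow> nat \<Rightarrow> complex \<Rightarrow> (nat \<Rightarrow> complex) \<Rightarrow> nat \<Rightarrow> complex" where
  "beside M b q c y = y(b := y q + of_real (gap M q y) * c)"

lemma gap_pos: "gap M q y > 0"
  unfolding gap_def by (intro divide_pos_pos add_pos_nonneg sum_nonneg) auto

lemma gap_less:
  assumes "finite M" "l \<in> M - {q}" "y l \<noteq> y q"
  shows "gap M q y < norm (y l - y q)"
proof -
  have "1 / norm (y l - y q) \<le> (\<Sum>l\<in>M - {q}. 1 / norm (y l - y q))"
    using assms by (intro member_le_sum) auto
  then have "1 / norm (y l - y q) < 2 + (\<Sum>l\<in>M - {q}. 1 / norm (y l - y q))" by simp
  then have "1 / (2 + (\<Sum>l\<in>M - {q}. 1 / norm (y l - y q))) < 1 / (1 / norm (y l - y q))"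
    using assms(3) by (intro divide_strict_left_mono mult_pos_pos add_pos_nonneg sum_nonneg) auto
  then show ?thesis by (simp add: gap_def)
qed

definition sector :: "nat set \<Rightarrow> nat \<Rightarrow> nat \<Rightarrow> complex set \<Rightarrow> (nat \<Rightarrow> complex) set" where
  "sector M b q R = {x \<in> topspace (tubeZ M b q). x b - x q \<in> R}"

lemma topspace_tubeZ:
  "topspace (tubeZ M b q) = {x \<in> extensional (insert b M). inj_on x (insert b M)} \<inter> near M b q"
  by (auto simp: tubeZ_def)

lemma subtopology_sector:
  "subtopology (tubeZ M b q) (sector M b q R) =
    subtopology (CC (insert b M)) ({x. inj_on x (insert b M)} \<inter> near M b q \<inter> {x. x b - x q \<in> R})"
proof -
  have "sector M b q R = topspace (tubeZ M b q) \<inter> {x. x b - x q \<in> R}" by (auto simp: sector_def)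
  then show ?thesis by (simp only: subtopology_restrict) (simp only: tubeZ_def subtopology_subtopology)
qed

lemma inj_insert_near:
  assumes "b \<notin> M" "q \<in> M" "inj_on x M" "x b \<noteq> x q" "x \<in> near M b q"
  shows "inj_on x (insert b M)"
proof -
  have "x b \<noteq> x l" if "l \<in> M" for l
    using that assms(4,5) by (cases "l = q") (auto simp: near_def)
  then show ?thesis using assms(1,3) by auto
qed

lemma continuous_beside:
  assumes M: "finite M" "b \<notin> M" "q \<in> M" and c: "norm c = 1"
    and R: "\<And>r. r > 0 \<Longrightarrow> of_real r * c \<in> R"
  shows "continuous_map (PC M) (subtopology (tubeZ M b q) (sector M b q R)) (beside M b q c)"
  unfolding PC_def subtopology_sector continuous_map_CC_iff
proof (intro conjI ballI)
  fix y assume y: "y \<in> topspace (subtopology (CC M) {x. inj_on x M})"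
  then have inj: "inj_on y M" and ext: "y \<in> extensional M" by auto
  show "beside M b q c y \<in> extensional (insert b M)" using ext by (auto simp: beside_def extensional_def)
  have bq: "b \<noteq> q" using M by auto
  then have diff: "beside M b q c y b - beside M b q c y q = of_real (gap M q y) * c"
    by (simp add: beside_def)
  have "norm (of_real (gap M q y) * c) = gap M q y" using c gap_pos[of M q y] by (simp add: norm_mult)
  then have near: "beside M b q c y \<in> near M b q"
    unfolding near_def mem_Collect_eq diff using gap_less[OF M(1), of _ q y] inj M
    by (auto simp: beside_def inj_on_def)
  moreover have "of_real (gap M q y) * c \<noteq> 0" using c gap_pos[of M q y] by auto
  moreover have "inj_on (beside M b q c y) M" using inj M(2) by (auto simp: beside_def inj_on_def)
  ultimately have "inj_on (beside M b q c y) (insert b M)"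
    using diff by (intro inj_insert_near[OF M(2,3)]) auto
  then show "beside M b q c y \<in> {x. inj_on x (insert b M)} \<inter> near M b q \<inter> {x. x b - x q \<in> R}"
    using near diff R[OF gap_pos] by simp
next
  fix k assume k: "k \<in> insert b M"
  let ?X = "subtopology (CC M) {x. inj_on x M}"
  have coord: "continuous_map ?X euclidean (\<lambda>x. x l)" if "l \<in> M" for l
    using that by (rule continuous_map_CC_coord)
  have "continuous_map ?X euclidean (\<lambda>y. gap M q y)"
    unfolding gap_def
  proof (intro continuous_map_divide continuous_map_add continuous_map_const_euclidean continuous_map_sum_any continuous_map_norm continuous_map_diff coord)
    fix y assume "y \<in> topspace ?X"
    have "(\<Sum>l\<in>M - {q}. 1 / norm (y l - y q)) \<ge> 0" by (intro sum_nonneg) auto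
    then show "2 + (\<Sum>l\<in>M - {q}. 1 / norm (y l - y q)) \<noteq> 0" by simp
  next
    fix l y assume "l \<in> M - {q}" "y \<in> topspace ?X"
    then show "norm (y l - y q) \<noteq> 0" using M(3) by (auto simp: inj_on_def)
  qed (use M in auto)
  then have "continuous_map ?X euclidean (\<lambda>y. y q + of_real (gap M q y) * c)"
    by (intro continuous_map_add continuous_map_mult continuous_map_of_real continuous_map_const_euclidean coord M(3))
  then show "continuous_map ?X euclidean (\<lambda>x. beside M b q c x k)"
    using k coord by (cases "k = b") (auto simp: beside_def)
qed

text \<open>Only \<open>b\<close> moves, on a segment that starts on the ray through
  \<open>c\<close>. The segment stays in the disc about \<open>x q\<close> because balls are convex,
  in \<open>R\<close> by \<open>star\<close>, and off \<open>x q\<close> because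
  \<open>0 \<notin> R\<close>.\<close>

lemma sector_retract:
  assumes M: "finite M" "b \<notin> M" "q \<in> M" and c: "norm c = 1"
    and R: "\<And>r. r > 0 \<Longrightarrow> of_real r * c \<in> R" "0 \<notin> R"
    and star: "\<And>z r t. z \<in> R \<Longrightarrow> r > 0 \<Longrightarrow> 0 \<le> t \<Longrightarrow> t \<le> 1 \<Longrightarrow>
      of_real (1 - t) * (of_real r * c) + of_real t * z \<in> R"
  shows "homotopic_with (\<lambda>_. True) (subtopology (tubeZ M b q) (sector M b q R))
      (subtopology (tubeZ M b q) (sector M b q R)) (beside M b q c \<circ> forget_to M) id"
proof -
  let ?S = "{x. inj_on x (insert b M)} \<inter> near M b q \<inter> {x. x b - x q \<in> R}"
  have cont_f: "continuous_map (subtopology (tubeZ M b q) (sector M b q R)) (PC M) (forget_to M)"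
    unfolding PC_def subtopology_sector
    by (rule continuous_forget_to) (use M in \<open>auto simp: inj_on_forget_to\<close>)
  have c1: "continuous_map (subtopology (CC (insert b M)) ?S) (subtopology (CC (insert b M)) ?S)
      (beside M b q c \<circ> forget_to M)"
    unfolding subtopology_sector[symmetric]
    using continuous_map_compose[OF cont_f continuous_beside[OF M c R(1)]] by simp
  show ?thesis
    unfolding subtopology_sector
  proof (rule homotopic_line[OF c1])
    fix t :: real and x assume t: "0 \<le> t" "t \<le> 1" and x: "x \<in> topspace (subtopology (CC (insert b M)) ?S)"
    let ?y = "beside M b q c (forget_to M x)"
    let ?h = "\<lambda>k\<in>insert b M. of_real (1 - t) * (beside M b q c \<circ> forget_to M) x k + of_real t * id x k"
    have y: "?y \<in> ?S"
      using c1 x unfolding continuous_map_CC_iff by fastforce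
    have yk: "?y k = x k" if "k \<in> M" for k
      using that M by (auto simp: beside_def forget_to_def)
    have hk: "?h k = x k" if "k \<in> M" for k
      using that by (simp add: yk algebra_simps)
    have hb: "?h b - ?h q = of_real (1 - t) * (?y b - ?y q) + of_real t * (x b - x q)"
      using M by (simp add: hk yk algebra_simps)
    have yb: "?y b - ?y q = of_real (gap M q (forget_to M x)) * c"
      using M by (auto simp: beside_def)
    have "?h b - ?h q \<in> R"
      unfolding hb yb using x t by (intro star gap_pos) auto
    moreover have "?h \<in> near M b q"
      unfolding near_def
    proof (intro CollectI ballI)
      fix l assume l: "l \<in> M - {q}"
      have "norm (?y b - ?y q) < norm (?y l - ?y q)" using y l by (simp add: near_def)
      then have "norm (?y b - ?y q) < norm (x l - x q)" using l M by (simp add: yk)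
      moreover have "norm (x b - x q) < norm (x l - x q)" using x l by (simp add: near_def)
      ultimately have "?y b - ?y q \<in> ball 0 (norm (x l - x q))" "x b - x q \<in> ball 0 (norm (x l - x q))"
        by simp_all
      from convexD_alt[OF convex_ball this t] have "norm (?h b - ?h q) < norm (x l - x q)"
        unfolding hb by (simp add: scaleR_conv_of_real)
      then show "norm (?h b - ?h q) < norm (?h l - ?h q)" using l M(3) by (simp only: hk Diff_iff)
    qed
    moreover have "inj_on ?h M"
    proof -
      have "inj_on ?h M \<longleftrightarrow> inj_on x M" by (rule inj_on_cong) (rule hk)
      then show ?thesis using x by auto
    qed
    moreover have "?h b \<noteq> ?h q" 
    proof
      assume "?h b = ?h q"
      then have "?h b - ?h q = 0" by (simp only: diff_self)
      with \<open>?h b - ?h q \<in> R\<close> R(2) show False by (simp only:)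
    qed
    ultimately have "inj_on ?h (insert b M)" by (intro inj_insert_near[OF M(2,3)])
    with \<open>?h b - ?h q \<in> R\<close> \<open>?h \<in> near M b q\<close> show "?h \<in> ?S" by blast
  qed simp
qed

lemma openin_sector:
  assumes "q \<in> M" "open R"
  shows "openin (tubeZ M b q) (sector M b q R)"
  unfolding sector_def tubeZ_def using assms
  by (intro openin_continuous_map_preimage[where Y = euclidean] continuous_map_diff continuous_map_CC_coord) auto

text \<open>In the coordinate \<open>x b - x q\<close>, the sets \<open>U\<close> and
  \<open>W\<close> are the plane slit along the closed lower and upper half of the imaginary axis,
  each star-shaped about the ray opposite to its slit; they overlap in the open right and left half
  planes.\<close>

lemma tube_collision:
  assumes M: "finite M" "b \<notin> M" "q \<in> M"
  shows "tube (tubeZ M b q) (PC M)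
    (sector M b q {z. Re z \<noteq> 0 \<or> Im z > 0}) (sector M b q {z. Re z \<noteq> 0 \<or> Im z < 0})
    (sector M b q {z. Re z > 0}) (sector M b q {z. Re z < 0}) (forget_to M)
    (beside M b q \<i>) (beside M b q (- \<i>)) (beside M b q 1) (beside M b q (- 1))"
proof
  have bq: "b \<noteq> q" using M by auto
  have o1: "open {z. Re z \<noteq> 0 \<or> Im z > 0}" "open {z. Re z \<noteq> 0 \<or> Im z < 0}"
    by (intro open_Collect_disj open_Collect_neq open_Collect_less continuous_intros)+
  have o2: "open {z. Re z > 0}" "open {z. Re z < 0}"
    by (intro open_Collect_less continuous_intros)+
  show "openin (tubeZ M b q) (sector M b q {z. Re z \<noteq> 0 \<or> Im z > 0})"
    "openin (tubeZ M b q) (sector M b q {z. Re z \<noteq> 0 \<or> Im z < 0})"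
    "openin (tubeZ M b q) (sector M b q {z. Re z > 0})"
    "openin (tubeZ M b q) (sector M b q {z. Re z < 0})"
    by (intro openin_sector M(3) o1 o2)+
  show "topspace (tubeZ M b q) \<subseteq> sector M b q {z. Re z \<noteq> 0 \<or> Im z > 0} \<union> sector M b q {z. Re z \<noteq> 0 \<or> Im z < 0}"
  proof
    fix x assume x: "x \<in> topspace (tubeZ M b q)"
    then have "x b - x q \<noteq> 0" using M by (auto simp: topspace_tubeZ)
    then show "x \<in> sector M b q {z. Re z \<noteq> 0 \<or> Im z > 0} \<union> sector M b q {z. Re z \<noteq> 0 \<or> Im z < 0}"
      using x by (auto simp: sector_def complex_eq_iff)
  qed
  show "sector M b q {z. Re z \<noteq> 0 \<or> Im z > 0} \<inter> sector M b q {z. Re z \<noteq> 0 \<or> Im z < 0} =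
      sector M b q {z. Re z > 0} \<union> sector M b q {z. Re z < 0}"
    by (auto simp: sector_def)
  show "sector M b q {z. Re z > 0} \<inter> sector M b q {z. Re z < 0} = {}"
    by (auto simp: sector_def)
  show "continuous_map (tubeZ M b q) (PC M) (forget_to M)"
    unfolding tubeZ_def PC_def by (rule continuous_forget_to) (use M in \<open>auto simp: inj_on_forget_to\<close>)
  show "continuous_map (PC M) (subtopology (tubeZ M b q) (sector M b q {z. Re z \<noteq> 0 \<or> Im z > 0})) (beside M b q \<i>)"
    "continuous_map (PC M) (subtopology (tubeZ M b q) (sector M b q {z. Re z \<noteq> 0 \<or> Im z < 0})) (beside M b q (- \<i>))"
    "continuous_map (PC M) (subtopology (tubeZ M b q) (sector M b q {z. Re z > 0})) (beside M b q 1)"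
    "continuous_map (PC M) (subtopology (tubeZ M b q) (sector M b q {z. Re z < 0})) (beside M b q (- 1))"
    by (rule continuous_beside[OF M]; simp)+
  have pos: "(1 - t) * r + t * s > 0" if "r > 0" "0 \<le> t" "t \<le> 1" "s > 0" for r s t :: real
    using that by (cases "t = 1") (auto intro: add_pos_nonneg)
  let ?U = "\<lambda>R. subtopology (tubeZ M b q) (sector M b q R)"
  show "homotopic_with (\<lambda>_. True) (?U {z. Re z \<noteq> 0 \<or> Im z > 0}) (?U {z. Re z \<noteq> 0 \<or> Im z > 0})
      (beside M b q \<i> \<circ> forget_to M) id"
  proof (rule sector_retract[OF M])
    fix z :: complex and r t :: real assume "z \<in> {z. Re z \<noteq> 0 \<or> Im z > 0}" "r > 0" "0 \<le> t" "t \<le> 1"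
    then show "of_real (1 - t) * (of_real r * \<i>) + of_real t * z \<in> {z. Re z \<noteq> 0 \<or> Im z > 0}"
      using pos[of r t "Im z"] by (cases "t = 0"; cases "Re z = 0") auto
  qed auto
  show "homotopic_with (\<lambda>_. True) (?U {z. Re z \<noteq> 0 \<or> Im z < 0}) (?U {z. Re z \<noteq> 0 \<or> Im z < 0})
      (beside M b q (- \<i>) \<circ> forget_to M) id"
  proof (rule sector_retract[OF M])
    fix z :: complex and r t :: real assume "z \<in> {z. Re z \<noteq> 0 \<or> Im z < 0}" "r > 0" "0 \<le> t" "t \<le> 1"
    then show "of_real (1 - t) * (of_real r * - \<i>) + of_real t * z \<in> {z. Re z \<noteq> 0 \<or> Im z < 0}"
      using pos[of r t "- Im z"] by (cases "t = 0"; cases "Re z = 0") auto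
  qed auto
  show "homotopic_with (\<lambda>_. True) (?U {z. Re z > 0}) (?U {z. Re z > 0}) (beside M b q 1 \<circ> forget_to M) id"
  proof (rule sector_retract[OF M])
    fix z :: complex and r t :: real assume "z \<in> {z. Re z > 0}" "r > 0" "0 \<le> t" "t \<le> 1"
    then show "of_real (1 - t) * (of_real r * 1) + of_real t * z \<in> {z. Re z > 0}"
      using pos[of r t "Re z"] by auto
  qed auto
  show "homotopic_with (\<lambda>_. True) (?U {z. Re z < 0}) (?U {z. Re z < 0}) (beside M b q (- 1) \<circ> forget_to M) id"
  proof (rule sector_retract[OF M])
    fix z :: complex and r t :: real assume "z \<in> {z. Re z < 0}" "r > 0" "0 \<le> t" "t \<le> 1"
    then show "of_real (1 - t) * (of_real r * - 1) + of_real t * z \<in> {z. Re z < 0}"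
      using pos[of r t "- Re z"] by auto
  qed auto
  show "forget_to M (beside M b q 1 y) = y" "forget_to M (beside M b q (- 1) y) = y"
    if "y \<in> topspace (PC M)" for y
    using that M by (auto simp: forget_to_def beside_def extensional_def restrict_def fun_eq_iff)
qed

section \<open>The action of permutations\<close>

definition permute_conf :: "nat set \<Rightarrow> (nat \<Rightarrow> nat) \<Rightarrow> (nat \<Rightarrow> complex) \<Rightarrow> nat \<Rightarrow> complex" where
  "permute_conf N g x = (\<lambda>j\<in>N. x (g j))"

text \<open>The antisymmetriser of the symmetric group of \<open>A\<close>, not normalised because
  the coefficients are integral.\<close>

definition alternate :: "nat \<Rightarrow> nat set \<Rightarrow> nat set \<Rightarrow> (nat \<Rightarrow> complex) chain \<Rightarrow> (nat \<Rightarrow> complex) chain" where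
  "alternate p N A c =
     (\<Sum>g | g permutes A. frag_cmul (sign g) (chain_map p (permute_conf N g) c))"

lemma permute_conf_inj:
  assumes "g permutes N" "inj_on x N"
  shows "inj_on (permute_conf N g x) N"
proof -
  have "inj_on (x \<circ> g) N"
    using assms by (intro comp_inj_on) (auto simp: permutes_image permutes_inj_on)
  then show ?thesis by (auto simp: permute_conf_def inj_on_def)
qed

lemma continuous_permute_conf:
  assumes "g permutes N" "\<And>x. x \<in> S \<Longrightarrow> x \<in> extensional N \<Longrightarrow> permute_conf N g x \<in> S'"
  shows "continuous_map (subtopology (CC N) S) (subtopology (CC N) S') (permute_conf N g)"
  unfolding continuous_map_CC_iff
proof (intro conjI ballI)
  fix k assume "k \<in> N"
  then show "continuous_map (subtopology (CC N) S) euclidean (\<lambda>x. permute_conf N g x k)"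
    using permutes_in_image[OF assms(1)] by (auto simp: permute_conf_def intro!: continuous_map_CC_coord)
qed (use assms in \<open>auto simp: permute_conf_def\<close>)

lemma continuous_permute_PC: "g permutes N \<Longrightarrow> continuous_map (PC N) (PC N) (permute_conf N g)"
  unfolding PC_def by (rule continuous_permute_conf) (auto intro: permute_conf_inj)

lemma permute_conf_comp: "h permutes N \<Longrightarrow> permute_conf N (g \<circ> h) x = permute_conf N h (permute_conf N g x)"
  using permutes_in_image by (fastforce simp: permute_conf_def restrict_def)

lemma permute_conf_id: "x \<in> extensional N \<Longrightarrow> permute_conf N id x = x"
  by (auto simp: permute_conf_def extensional_def restrict_def fun_eq_iff)

lemma alternate_add: "alternate p N A (c + d) = alternate p N A c + alternate p N A d"
  by (simp add: alternate_def chain_map_add frag_cmul_distrib2 sum.distrib)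

lemma alternate_sum: "alternate p N A (\<Sum>i\<in>I. f i) = (\<Sum>i\<in>I. alternate p N A (f i))"
proof (induction I rule: infinite_finite_induct)
  case (insert i I)
  then show ?case by (simp add: alternate_add)
qed (simp_all add: alternate_def)

lemma alternate_shom:
  assumes "shom p (PC N) c d" "A \<subseteq> N"
  shows "shom p (PC N) (alternate p N A c) (alternate p N A d)"
  unfolding alternate_def
  by (intro shom_sum shom_cmul shom_chain_map[OF assms(1)] continuous_permute_PC)
     (use assms(2) permutes_subset in auto)

text \<open>The antisymmetriser of a group factors through that of a subgroup. The cosets are
  represented by the transpositions of \<open>a\<close>; summing over inverses puts the subgroup
  factor innermost, since \<open>permute_conf\<close> reverses composites.\<close>

lemma alternate_insert:
  assumes "finite A" "a \<notin> A" "insert a A \<subseteq> N"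
    and "shom p (PC N) (alternate p N A c) 0"
  shows "shom p (PC N) (alternate p N (insert a A) c) 0"
proof -
  let ?f = "\<lambda>g. frag_cmul (sign g) (chain_map p (permute_conf N g) c)"
  have perm: "\<tau> permutes N" if "\<tau> permutes insert a A" for \<tau>
    using that assms(3) permutes_subset by blast
  have "alternate p N (insert a A) c = (\<Sum>g | g permutes insert a A. ?f (inv' g))"
    unfolding alternate_def by (rule sum_permutations_inverse)
  also have "\<dots> = (\<Sum>b\<in>insert a A. \<Sum>q | q permutes A. ?f (inv' (Transposition.transpose a b \<circ> q)))"
    by (rule sum_over_permutations_insert[OF assms(1,2)])
  also have "\<dots> = (\<Sum>b\<in>insert a A. frag_cmul (sign (Transposition.transpose a b))
      (chain_map p (permute_conf N (Transposition.transpose a b)) (\<Sum>q | q permutes A. ?f (inv' q))))"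
  proof (intro sum.cong refl)
    fix b assume b: "b \<in> insert a A"
    let ?\<tau> = "Transposition.transpose a b"
    have \<tau>: "?\<tau> permutes insert a A" using b by (intro permutes_swap_id) auto
    have "?f (inv' (?\<tau> \<circ> q)) = frag_cmul (sign ?\<tau>) (chain_map p (permute_conf N ?\<tau>) (?f (inv' q)))"
      if q: "q permutes A" for q
    proof -
      have q': "q permutes insert a A" using q permutes_subset by blast
      have fin: "finite (insert a A)" using assms(1) by simp
      have "permutation q" "permutation ?\<tau>"
        using q' \<tau> fin permutation_permutes by blast+
      then have "sign (inv' (?\<tau> \<circ> q)) = sign ?\<tau> * sign (inv' q)"
        by (simp add: sign_inverse sign_compose permutation_compose)
      moreover have "inv' (?\<tau> \<circ> q) = inv' q \<circ> ?\<tau>"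
        using o_inv_distrib[OF permutes_bij[OF \<tau>] permutes_bij[OF q]] by simp
      moreover have "permute_conf N (inv' q \<circ> ?\<tau>) = permute_conf N ?\<tau> \<circ> permute_conf N (inv' q)"
        using permute_conf_comp[OF perm[OF \<tau>]] by (auto simp: fun_eq_iff)
      ultimately show ?thesis by (simp add: chain_map_compose)
    qed
    then have "(\<Sum>q | q permutes A. ?f (inv' (?\<tau> \<circ> q)))
        = (\<Sum>q | q permutes A. frag_cmul (sign ?\<tau>) (chain_map p (permute_conf N ?\<tau>) (?f (inv' q))))"
      by (intro sum.cong) auto
    also have "\<dots> = frag_cmul (sign ?\<tau>) (chain_map p (permute_conf N ?\<tau>) (\<Sum>q | q permutes A. ?f (inv' q)))"
      using assms(1) by (simp add: frag_cmul_sum chain_map_sum finite_permutations o_def)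
    finally show "(\<Sum>q | q permutes A. ?f (inv' (?\<tau> \<circ> q)))
        = frag_cmul (sign ?\<tau>) (chain_map p (permute_conf N ?\<tau>) (\<Sum>q | q permutes A. ?f (inv' q)))" .
  qed
  also have "(\<Sum>q | q permutes A. ?f (inv' q)) = alternate p N A c"
    unfolding alternate_def by (rule sum_permutations_inverse[symmetric])
  finally have eq: "alternate p N (insert a A) c = (\<Sum>b\<in>insert a A. frag_cmul (sign (Transposition.transpose a b))
      (chain_map p (permute_conf N (Transposition.transpose a b)) (alternate p N A c)))" .
  have "shom p (PC N) (frag_cmul (sign (Transposition.transpose a b))
      (chain_map p (permute_conf N (Transposition.transpose a b)) (alternate p N A c))) 0"
    if "b \<in> insert a A" for b
  proof -
    have "Transposition.transpose a b permutes N"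
      using that assms(3) by (intro permutes_swap_id) auto
    from shom_cmul[OF shom_chain_map[OF assms(4) continuous_permute_PC[OF this]]]
    show ?thesis by simp
  qed
  from shom_sum[of "insert a A", OF this] show ?thesis unfolding eq by simp
qed

text \<open>Reduces vanishing to a convenient subset: a pair exchanged by a half turn, or
  \<open>A\<close> without one point.\<close>

lemma alternate_superset:
  assumes "finite B" "A \<subseteq> B" "B \<subseteq> N" "shom p (PC N) (alternate p N A c) 0"
  shows "shom p (PC N) (alternate p N B c) 0"
proof -
  have "finite A" using assms(1,2) finite_subset by blast
  have "shom p (PC N) (alternate p N (F \<union> A) c) 0"
    if "finite F" "F \<inter> A = {}" "F \<union> A \<subseteq> N" for F
    using that
  proof (induction F)
    case empty
    then show ?case using assms(4) by simp
  next
    case (insert x F)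
    then have "shom p (PC N) (alternate p N (insert x (F \<union> A)) c) 0"
      using \<open>finite A\<close> by (intro alternate_insert) auto
    then show ?case by simp
  qed
  from this[of "B - A"] assms(1-3) show ?thesis by (simp add: Un_absorb2 Diff_Int_distrib2)
qed

lemma alternate_pair:
  assumes "a \<noteq> b" "singular_chain p (PC N) c"
    and "shom p (PC N) c (chain_map p (permute_conf N (Transposition.transpose a b)) c)"
  shows "shom p (PC N) (alternate p N {a, b} c) 0"
proof -
  have "{g. g permutes {a, b}} = {id, Transposition.transpose a b}"
    by (auto simp: permutes_doubleton_iff)
  moreover have "chain_map p (permute_conf N id) c = c"
    by (rule chain_map_id_gen[OF assms(2)]) (simp add: permute_conf_id)
  moreover have "id \<noteq> Transposition.transpose a b"
    using assms(1) by (metis id_apply transpose_apply_first)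
  ultimately have "alternate p N {a, b} c = c - chain_map p (permute_conf N (Transposition.transpose a b)) c"
    using assms(1) by (simp add: alternate_def sign_swap_id)
  then show ?thesis using assms(3) by (simp add: homologous_rel_def)
qed

lemma permute_forget_to:
  assumes "M \<subseteq> N" "g permutes M"
  shows "forget_to M (permute_conf N g x) = permute_conf M g (forget_to M x)"
  using assms permutes_in_image[OF assms(2)] by (auto simp: forget_to_def permute_conf_def fun_eq_iff)

section \<open>Alternating cycles bound\<close>

lemma tube_sub_PC:
  assumes "singular_chain p (tubeZ M b q) c"
  shows "singular_chain p (PC (insert b M)) c"
  using singular_chain_mono[OF assms[unfolded tubeZ_def], of "{x. inj_on x (insert b M)}"]
  by (simp add: PC_def)

lemma scycle_tube_PC: "scycle p (tubeZ M b q) c \<Longrightarrow> scycle p (PC (insert b M)) c"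
  using tube_sub_PC by (auto simp: singular_cycle)

lemma continuous_tube_PC: "continuous_map (tubeZ M b q) (PC (insert b M)) id"
  by (auto simp: tubeZ_def PC_def continuous_map_CC_iff intro: continuous_map_CC_coord)

text \<open>The circle with diameter from \<open>x b\<close> to \<open>x q\<close> stays within
  distance \<open>norm (x b - x q)\<close> of \<open>x q\<close>, where the tube admits no further
  point. So \<open>b\<close> and \<open>q\<close> can be exchanged by a half turn.\<close>

lemma tube_swap:
  assumes M: "b \<notin> M" "q \<in> M" and w: "scycle p (tubeZ M b q) w"
  shows "shom p (PC (insert b M)) (alternate p (insert b M) {b, q} w) 0"
proof -
  let ?N = "insert b M"
  have bq: "b \<noteq> q" using M by auto
  have "homotopic_with (\<lambda>_. True) (tubeZ M b q) (PC ?N) id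
      (\<lambda>x. \<lambda>j\<in>?N. id x (Transposition.transpose b q j))"
  proof (rule homotopic_swap[OF continuous_tube_PC])
    fix x l and \<zeta> :: complex
    assume x: "x \<in> topspace (tubeZ M b q)" and l: "l \<in> ?N" "l \<noteq> b" "l \<noteq> q" and \<zeta>: "norm \<zeta> = 1"
    have near: "norm (x b - x q) < norm (x l - x q)" using x l by (auto simp: topspace_tubeZ near_def)
    show "(id x b + id x q) / 2 + \<zeta> * ((id x b - id x q) / 2) \<noteq> id x l"
    proof
      assume "(id x b + id x q) / 2 + \<zeta> * ((id x b - id x q) / 2) = id x l"
      then have "x l - x q = (x b - x q) / 2 + \<zeta> * ((x b - x q) / 2)" by (simp add: field_simps)
      then have "norm (x l - x q) \<le> norm ((x b - x q) / 2) + norm (\<zeta> * ((x b - x q) / 2))"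
        using norm_triangle_ineq by metis
      also have "\<dots> = norm (x b - x q)" using \<zeta> by (simp add: norm_mult norm_divide)
      finally show False using near by simp
    qed
  qed (use M bq in auto)
  from shom_homotopic[OF this w]
  have "shom p (PC ?N) (chain_map p id w) (chain_map p (permute_conf ?N (Transposition.transpose b q)) w)"
    by (simp add: permute_conf_def[abs_def])
  then have "shom p (PC ?N) w (chain_map p (permute_conf ?N (Transposition.transpose b q)) w)"
    using chain_map_ident[OF scycle_chain[OF w]] by simp
  then show ?thesis by (rule alternate_pair[OF bq scycle_chain[OF scycle_tube_PC[OF w]]])
qed

text \<open>Both far positions lie on the positive real axis, beyond the norms of all other points.
  The circle having them as a diameter does not reach to the left of the nearer one, so the half
  turn meets no other point.\<close>

lemma far_swap:
  assumes M: "finite M" "a \<notin> M" "b \<notin> M" "a \<noteq> b" and y: "scycle p (PC M) y"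
  defines "N \<equiv> insert a (insert b M)"
  shows "shom p (PC N) (alternate p N {a, b} (chain_map p (add_far a (insert b M)) (chain_map p (add_far b M) y))) 0"
proof -
  let ?f = "add_far a (insert b M) \<circ> add_far b M"
  have cont: "continuous_map (PC M) (PC N) ?f"
    unfolding N_def
    using continuous_map_compose[OF continuous_add_far_PC[of M b] continuous_add_far_PC[of "insert b M" a]] M
    by simp
  have "homotopic_with (\<lambda>_. True) (PC M) (PC N) ?f (\<lambda>x. \<lambda>j\<in>N. ?f x (Transposition.transpose a b j))"
  proof (rule homotopic_swap[OF cont])
    fix x l and \<zeta> :: complex
    assume x: "x \<in> topspace (PC M)" and l: "l \<in> N" "l \<noteq> a" "l \<noteq> b" and \<zeta>: "norm \<zeta> = 1"
    let ?R = "far M x" and ?R' = "far (insert b M) (add_far b M x)"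
    have lM: "l \<in> M" using l by (simp add: N_def)
    have fa: "?f x a = of_real ?R'" by (simp add: add_far_def)
    have fb: "?f x b = of_real ?R" using M(4) by (simp add: add_far_def)
    have fl: "?f x l = x l" using l by (simp add: add_far_def)
    have R: "1 \<le> ?R" by (rule far_ge_1)
    have "3 * norm (add_far b M x b) < ?R'" using M by (intro norm_less_far) auto
    then have R': "?R < ?R'" using R by (simp add: add_far_def)
    have "norm (x l) < ?R" using norm_less_far[OF M(1) lM, of x] norm_ge_zero[of "x l"] R by linarith
    moreover have "Re (x l) \<le> norm (x l)" by (rule complex_Re_le_cmod)
    ultimately have 1: "Re (x l) < ?R" by simp
    have "\<bar>Re \<zeta>\<bar> \<le> 1" using abs_Re_le_cmod[of \<zeta>] \<zeta> by simp
    then have "- 1 * ((?R' - ?R) / 2) \<le> Re \<zeta> * ((?R' - ?R) / 2)"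
      using R' by (intro mult_right_mono) auto
    then have 2: "?R \<le> (?R' + ?R) / 2 + Re \<zeta> * ((?R' - ?R) / 2)" by (simp add: field_simps)
    have "Re ((?f x a + ?f x b) / 2 + \<zeta> * ((?f x a - ?f x b) / 2)) = (?R' + ?R) / 2 + Re \<zeta> * ((?R' - ?R) / 2)"
      unfolding fa fb by simp
    with 1 2 show "(?f x a + ?f x b) / 2 + \<zeta> * ((?f x a - ?f x b) / 2) \<noteq> ?f x l"
      unfolding fl by (metis linorder_not_less)
  qed (use M in \<open>auto simp: N_def\<close>)
  from shom_homotopic[OF this y]
  have "shom p (PC N) (chain_map p ?f y) (chain_map p (permute_conf N (Transposition.transpose a b) \<circ> ?f) y)"
    by (simp add: permute_conf_def[abs_def] o_def)
  moreover have "singular_chain p (PC N) (chain_map p ?f y)"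
    by (rule singular_chain_chain_map[OF scycle_chain[OF y] cont])
  ultimately have "shom p (PC N) (alternate p N {a, b} (chain_map p ?f y)) 0"
    using alternate_pair[OF M(4)] by (simp add: chain_map_compose)
  then show ?thesis by (simp add: chain_map_compose)
qed

text \<open>Permutations of \<open>A\<close> fix \<open>b\<close> and \<open>q\<close>, hence
  preserve the tube and its four sectors and cover the action on \<open>PC M\<close>. As
  \<open>w\<close> dies under \<open>forget_to M\<close>, \<open>kernel_killed\<close> asks for
  vanishing only one degree lower.\<close>

lemma tube_alternate:
  assumes M: "finite M" "b \<notin> M" "q \<in> M" and A: "A \<subseteq> M" "q \<notin> A"
    and hyp: "\<And>j z. i = Suc j \<Longrightarrow> scycle j (PC M) z \<Longrightarrow> shom j (PC M) (alternate j M A z) 0"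
    and w: "scycle i (tubeZ M b q) w" "shom i (PC M) (chain_map i (forget_to M) w) 0"
  shows "shom i (PC (insert b M)) (alternate i (insert b M) A w) 0"
proof -
  let ?N = "insert b M"
  interpret tube "tubeZ M b q" "PC M"
    "sector M b q {z. Re z \<noteq> 0 \<or> Im z > 0}" "sector M b q {z. Re z \<noteq> 0 \<or> Im z < 0}"
    "sector M b q {z. Re z > 0}" "sector M b q {z. Re z < 0}" "forget_to M"
    "beside M b q \<i>" "beside M b q (- \<i>)" "beside M b q 1" "beside M b q (- 1)"
    by (rule tube_collision[OF M])
  have fix_bq: "g b = b" "g q = q" "g permutes M" "g permutes ?N" if "g permutes A" for g
    using that A M(2) permutes_subset[OF that, of M] permutes_subset[OF that, of ?N]
    by (auto simp: permutes_def)
  have tubeP: "permute_conf ?N g x \<in> {x. inj_on x ?N} \<inter> near M b q"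
    if g: "g permutes A" and x: "x \<in> {x. inj_on x ?N} \<inter> near M b q" for g x
  proof -
    note g' = fix_bq[OF g]
    have "norm (x b - x q) < norm (x (g l) - x q)" if "l \<in> M - {q}" for l
    proof -
      have "g l \<in> M - {q}"
        using that permutes_in_image[OF g'(3)] g'(2) permutes_inj[OF g'(3)] by (metis Diff_iff injD singleton_iff)
      then show ?thesis using x by (auto simp: near_def)
    qed
    then have "permute_conf ?N g x \<in> near M b q"
      using M(3) by (simp add: near_def permute_conf_def g')
    then show ?thesis using permute_conf_inj[OF g'(4)] x by blast
  qed
  have cont: "continuous_map (tubeZ M b q) (tubeZ M b q) (permute_conf ?N g)" if "g permutes A" for g
    unfolding tubeZ_def using that by (intro continuous_permute_conf tubeP fix_bq)
  have sec: "permute_conf ?N g x \<in> sector M b q R"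
    if g: "g permutes A" and x: "x \<in> topspace (tubeZ M b q)" "x \<in> sector M b q R" for g x R
  proof -
    have "permute_conf ?N g x \<in> topspace (tubeZ M b q)"
      using continuous_map_image_subset_topspace[OF cont[OF g]] x(1) by blast
    then show ?thesis
      using x(2) M(3) by (simp add: sector_def permute_conf_def fix_bq[OF g])
  qed
  have "shom i (tubeZ M b q)
      (\<Sum>g | g permutes A. frag_cmul (sign g) (chain_map i (permute_conf ?N g) w)) 0"
  proof (rule kernel_killed[where \<beta> = "permute_conf M"])
    show "shom j (PC M) (\<Sum>g | g permutes A. frag_cmul (sign g) (chain_map j (permute_conf M g) z)) 0"
      if "i = Suc j" "scycle j (PC M) z" for j z
      using hyp[OF that] by (simp add: alternate_def)
    show "permute_conf ?N g x \<in> R"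
      if "g \<in> {g. g permutes A}" "R \<in> {sector M b q {z. Re z \<noteq> 0 \<or> Im z > 0},
        sector M b q {z. Re z \<noteq> 0 \<or> Im z < 0}, sector M b q {z. Re z > 0}, sector M b q {z. Re z < 0}}"
        "x \<in> topspace (tubeZ M b q)" "x \<in> R" for g R x
      using that sec by auto
    show "forget_to M (permute_conf ?N g x) = permute_conf M g (forget_to M x)"
      if "g \<in> {g. g permutes A}" for g x
      using that fix_bq by (intro permute_forget_to) auto
  qed (use cont fix_bq w continuous_permute_PC in auto)
  then have "shom i (subtopology (CC ?N) {x. inj_on x ?N})
      (\<Sum>g | g permutes A. frag_cmul (sign g) (chain_map i (permute_conf ?N g) w)) 0"
    unfolding tubeZ_def by (rule shom_mono) auto
  then show ?thesis by (simp add: PC_def alternate_def)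
qed

text \<open>A far point \<open>a\<close> does not disturb the disc about \<open>x q\<close>. Adding
  \<open>a\<close> and then forgetting \<open>b\<close> agrees with forgetting \<open>b\<close> and
  then adding \<open>a\<close> only up to homotopy, because the far position depends on
  \<open>x b\<close>; the two positions are joined along the real axis.\<close>

lemma tube_add_far:
  assumes M: "finite M" "a \<notin> M" "b \<notin> M" "a \<noteq> b" "q \<in> M"
    and w: "scycle p (tubeZ M b q) w" "shom p (PC M) (chain_map p (forget_to M) w) 0"
  defines "w' \<equiv> chain_map p (add_far a (insert b M)) w"
  shows "scycle p (tubeZ (insert a M) b q) w'"
    and "shom p (PC (insert a M)) (chain_map p (forget_to (insert a M)) w') 0"
proof -
  let ?N = "insert a (insert b M)" and ?f = "add_far a (insert b M)"
  have comm: "insert b (insert a M) = ?N" by (rule insert_commute)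
  have near: "?f x \<in> near (insert a M) b q" if "x \<in> near M b q" for x
    unfolding near_def
  proof (intro CollectI ballI)
    fix l assume l: "l \<in> insert a M - {q}"
    have q: "?f x q = x q" and b: "?f x b = x b" using M by (auto simp: add_far_def)
    show "norm (?f x b - ?f x q) < norm (?f x l - ?f x q)"
    proof (cases "l = a")
      case True
      have "3 * (norm (x b) + norm (x q)) < far (insert b M) x"
        using M by (intro norm_less_far2) auto
      moreover have "norm (x b - x q) \<le> norm (x b) + norm (x q)" by (rule norm_triangle_ineq4)
      moreover have "far (insert b M) x - norm (x q) \<le> norm (of_real (far (insert b M) x) - x q)"
        using norm_triangle_ineq2[of "of_real (far (insert b M) x)" "x q"] far_ge_1[of "insert b M" x] by simp
      \<comment> \<open>To be read with \<open>r\<close> and \<open>s\<close> the norms of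
        \<open>x b\<close> and \<open>x q\<close>, and \<open>f\<close> the far position; the factor
        3 in \<open>far\<close> enters here.\<close>
      moreover have "u < v" if "3 * (r + s) < f" "u \<le> r + s" "f - s \<le> v" "0 \<le> r" "0 \<le> s" for r s f u v :: real
        using that by simp
      ultimately have "norm (x b - x q) < norm (of_real (far (insert b M) x) - x q)"
        using norm_ge_zero by blast
      then show ?thesis unfolding q b True by (simp add: add_far_def)
    next
      case False
      then have "?f x l = x l" "l \<in> M - {q}" using l by (auto simp: add_far_def)
      then show ?thesis using that unfolding q b by (simp add: near_def)
    qed
  qed
  have "continuous_map (tubeZ M b q) (tubeZ (insert a M) b q) ?f"
    unfolding tubeZ_def comm
    by (rule continuous_add_far) (use M near in \<open>auto simp: inj_on_add_far simp del: inj_on_insert\<close>)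
  then show "scycle p (tubeZ (insert a M) b q) w'"
    unfolding w'_def by (rule scycle_chain_map[OF w(1)])
  have cont_f: "continuous_map (tubeZ M b q) (PC M) (forget_to M)"
    unfolding tubeZ_def PC_def by (rule continuous_forget_to) (use M in \<open>auto simp: inj_on_forget_to\<close>)
  have cont1: "continuous_map (tubeZ M b q) (PC (insert a M)) (add_far a M \<circ> forget_to M)"
    by (rule continuous_map_compose[OF cont_f continuous_add_far_PC[OF M(1,2)]])
  have "continuous_map (PC ?N) (PC (insert a M)) (forget_to (insert a M))"
    unfolding PC_def by (rule continuous_forget_to) (auto simp: inj_on_forget_to simp del: inj_on_insert intro: inj_on_subset)
  moreover have "continuous_map (tubeZ M b q) (PC ?N) ?f"
    using continuous_map_compose[OF continuous_tube_PC[of M b q] continuous_add_far_PC[of "insert b M" a]] M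
    by simp
  ultimately have cont2: "continuous_map (tubeZ M b q) (PC (insert a M)) (forget_to (insert a M) \<circ> ?f)"
    using continuous_map_compose by blast
  have "homotopic_with (\<lambda>_. True) (tubeZ M b q) (PC (insert a M))
      (forget_to (insert a M) \<circ> ?f) (add_far a M \<circ> forget_to M)"
    unfolding PC_def
  proof (rule homotopic_line[OF cont2[unfolded PC_def] cont1[unfolded PC_def]])
    fix t :: real and x assume t: "0 \<le> t" "t \<le> 1" and x: "x \<in> topspace (tubeZ M b q)"
    let ?h = "\<lambda>k\<in>insert a M. of_real (1 - t) * (forget_to (insert a M) \<circ> ?f) x k
        + of_real t * (add_far a M \<circ> forget_to M) x k"
    have far_forget: "far M (forget_to M x) = far M x" by (rule far_cong) (simp add: forget_to_def)
    have hk: "?h k = x k" if "k \<in> M" for k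
      using that M(2) by (auto simp: add_far_def forget_to_def algebra_simps)
    have ha: "?h a = of_real ((1 - t) * far (insert b M) x + t * far M x)"
      by (simp add: add_far_def forget_to_def[of "insert a M"] far_forget)
    have "?h a \<noteq> x l" if l: "l \<in> M" for l
    proof
      assume "?h a = x l"
      then have "norm (x l) = \<bar>(1 - t) * far (insert b M) x + t * far M x\<bar>" unfolding ha by (metis norm_of_real)
      moreover have "3 * norm (x l) < far M x" "3 * norm (x l) < far (insert b M) x"
        using M(1) l by (auto intro!: norm_less_far)
      then have "norm (x l) < far M x" "norm (x l) < far (insert b M) x"
        using norm_ge_zero[of "x l"] by linarith+
      then have "(1 - t) * norm (x l) + t * norm (x l) < (1 - t) * far (insert b M) x + t * far M x"
        using t by (cases "t = 0") (auto intro!: add_le_less_mono mult_left_mono mult_strict_left_mono)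
      ultimately show False by (simp add: algebra_simps)
    qed
    moreover have "inj_on ?h M"
    proof -
      have "inj_on ?h M \<longleftrightarrow> inj_on x M" by (rule inj_on_cong) (rule hk)
      then show ?thesis using x by (auto simp: topspace_tubeZ)
    qed
    moreover have "?h ` (M - {a}) \<subseteq> x ` M" using hk by (metis (no_types, lifting) Diff_subset image_cong image_mono)
    ultimately show "?h \<in> {x. inj_on x (insert a M)}" unfolding mem_Collect_eq inj_on_insert by blast
  qed
  from shom_homotopic[OF this w(1)]
  have "shom p (PC (insert a M)) (chain_map p (forget_to (insert a M)) w')
      (chain_map p (add_far a M) (chain_map p (forget_to M) w))"
    by (simp add: chain_map_compose w'_def)
  moreover have "shom p (PC (insert a M)) (chain_map p (add_far a M) (chain_map p (forget_to M) w)) 0"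
    using shom_chain_map[OF w(2) continuous_add_far_PC[OF M(1,2)]] by simp
  ultimately show "shom p (PC (insert a M)) (chain_map p (forget_to (insert a M)) w') 0"
    by (rule shom_trans)
qed

text \<open>Each summand is killed by antisymmetrising over a subset of \<open>A\<close>, which
  suffices by \<open>alternate_superset\<close>: a colliding pair, the two far points, or
  \<open>A\<close> less the forgotten point, where the lower degree applies. Both the label set and
  \<open>A\<close> lose a point on the way, so they stay arbitrary in the induction.\<close>

lemma alternate_cycle_null:
  assumes "finite N" "A \<subseteq> N" "i + 2 \<le> card A" "scycle i (PC N) x"
  shows "shom i (PC N) (alternate i N A x) 0"
  using assms
proof (induction i arbitrary: N A x rule: less_induct)
  case (less i)
  have "finite A" using less.prems(1,2) finite_subset by blast
  moreover have "A \<noteq> {}" using less.prems(3) by auto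
  ultimately obtain a where a: "a \<in> A" by blast
  have "card (A - {a}) \<noteq> 0" using less.prems(3) a \<open>finite A\<close> by simp
  then have "A - {a} \<noteq> {}" by (metis card.empty)
  then obtain b where b: "b \<in> A" "b \<noteq> a" by blast
  define M where "M = N - {a, b}"
  have M: "finite M" "a \<notin> M" "b \<notin> M" "a \<noteq> b" using less.prems(1) b by (auto simp: M_def)
  \<comment> \<open>Both orders matter: collisions of \<open>a\<close> are fibred over
    \<open>insert b M\<close>, those of \<open>b\<close> over \<open>insert a M\<close>.\<close>
  have N: "N = insert a (insert b M)" "N = insert b (insert a M)"
    using less.prems(2) a b by (auto simp: M_def)
  let ?M1 = "insert b M" and ?r = "chain_map i (add_far a (insert b M))"
  have M1: "finite ?M1" "a \<notin> ?M1" using M by auto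
  have sup: "shom i (PC N) (alternate i N A c) 0"
    if "shom i (PC N) (alternate i N B c) 0" "B \<subseteq> A" for B c
    using alternate_superset[OF \<open>finite A\<close> that(2) less.prems(2) that(1)] .
  have tubeA: "shom i (PC (insert c K)) (alternate i (insert c K) A w) 0"
    if K: "finite K" "c \<notin> K" "insert c K = N" and c: "c \<in> A" and q: "q \<in> K"
      and w: "scycle i (tubeZ K c q) w" "shom i (PC K) (chain_map i (forget_to K) w) 0" for K c q w
  proof (cases "q \<in> A")
    case True
    then show ?thesis
      using sup[of "{c, q}" w] tube_swap[OF K(2) q w(1)] c K(3) by simp
  next
    case False
    have sub: "A - {c} \<subseteq> K" "q \<notin> A - {c}" using less.prems(2) K(3) False by auto
    have "shom j (PC K) (alternate j K (A - {c}) z) 0" if j: "i = Suc j" "scycle j (PC K) z" for j z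
    proof (rule less.IH[OF _ K(1) sub(1) _ j(2)])
      show "j + 2 \<le> card (A - {c})" using less.prems(3) c \<open>finite A\<close> j(1) by simp
    qed (simp add: j(1))
    from tube_alternate[OF K(1,2) q sub this w] show ?thesis
      using sup[of "A - {c}" w] K(3) by simp
  qed
  have cyc: "scycle i (PC ?M1) (chain_map i (forget_to ?M1) x)"
    using less.prems(4) unfolding N(1) PC_def
    by (rule scycle_chain_map[OF _ continuous_forget_to]) (auto simp: inj_on_forget_to simp del: inj_on_insert intro: inj_on_subset)
  obtain w where w: "\<forall>j\<in>?M1. scycle i (tubeZ ?M1 a j) (w j)"
    "\<forall>j\<in>?M1. shom i (PC ?M1) (chain_map i (forget_to ?M1) (w j)) 0"
    "shom i (PC (insert a ?M1)) x
       (chain_map i (add_far a ?M1) (chain_map i (forget_to ?M1) x) + (\<Sum>j\<in>?M1. w j))"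
    by (rule generation[OF M1 less.prems(4)[unfolded N(1)]])
  let ?y = "chain_map i (forget_to ?M1) x"
  obtain w' where w': "\<forall>j\<in>M. scycle i (tubeZ M b j) (w' j)"
    "\<forall>j\<in>M. shom i (PC M) (chain_map i (forget_to M) (w' j)) 0"
    "shom i (PC ?M1) ?y (chain_map i (add_far b M) (chain_map i (forget_to M) ?y) + (\<Sum>j\<in>M. w' j))"
    by (rule generation[OF M(1,3) cyc])
  let ?z = "chain_map i (forget_to M) ?y"
  have z: "scycle i (PC M) ?z"
    using cyc unfolding PC_def
    by (rule scycle_chain_map[OF _ continuous_forget_to]) (auto simp: inj_on_forget_to simp del: inj_on_insert intro: inj_on_subset)
  have alt_w: "shom i (PC N) (alternate i N A (w j)) 0" if "j \<in> ?M1" for j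
    using tubeA[OF M1 N(1)[symmetric] a that w(1)[rule_format, OF that] w(2)[rule_format, OF that]]
    by (simp only: N(1))
  \<comment> \<open>Once \<open>a\<close> is placed far away, \<open>w' j\<close> becomes a class
    near the collision of \<open>b\<close> with \<open>j\<close> among all labels, so
    \<open>tubeA\<close> applies with \<open>b\<close> as the moving point.\<close>
  have alt_w': "shom i (PC N) (alternate i N A (?r (w' j))) 0" if j: "j \<in> M" for j
  proof -
    note wj = w'(1)[rule_format, OF j] w'(2)[rule_format, OF j]
    show ?thesis
      using tubeA[of "insert a M" b j "?r (w' j)"] tube_add_far[OF M j wj] M j b N(2) by simp
  qed
  have alt_z: "shom i (PC N) (alternate i N A (?r (chain_map i (add_far b M) ?z))) 0"
    using sup[of "{a, b}"] far_swap[OF M z] a b N(1) by simp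
  have "shom i (PC N) (?r ?y) (?r (chain_map i (add_far b M) ?z + (\<Sum>j\<in>M. w' j)))"
    unfolding N(1) by (rule shom_chain_map[OF w'(3) continuous_add_far_PC[OF M1]])
  then have "shom i (PC N) (?r ?y) (?r (chain_map i (add_far b M) ?z) + (\<Sum>j\<in>M. ?r (w' j)))"
    using M(1) by (simp add: chain_map_add chain_map_sum o_def)
  from homologous_rel_add[OF this homologous_rel_refl[of _ _ _ "\<Sum>j\<in>?M1. w j"]]
  have "shom i (PC N) x (?r (chain_map i (add_far b M) ?z) + (\<Sum>j\<in>M. ?r (w' j)) + (\<Sum>j\<in>?M1. w j))"
    by (rule shom_trans[OF w(3)[folded N(1)]])
  from alternate_shom[OF this less.prems(2)]
  have 1: "shom i (PC N) (alternate i N A x) (alternate i N A (?r (chain_map i (add_far b M) ?z))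
      + (\<Sum>j\<in>M. alternate i N A (?r (w' j))) + (\<Sum>j\<in>?M1. alternate i N A (w j)))"
    by (simp only: alternate_add alternate_sum)
  have 2: "shom i (PC N) (alternate i N A (?r (chain_map i (add_far b M) ?z))
      + (\<Sum>j\<in>M. alternate i N A (?r (w' j))) + (\<Sum>j\<in>?M1. alternate i N A (w j)))
      (0 + (\<Sum>j\<in>M. 0) + (\<Sum>j\<in>?M1. 0))"
    by (intro homologous_rel_add shom_sum alt_z alt_w alt_w')
  from shom_trans[OF 1 2] show ?case by simp
qed

section \<open>Finite generation for configuration spaces\<close>

lemma fin_gen_tube:
  assumes "finite M" "b \<notin> M" "q \<in> M" and "\<And>j. fin_gen_homology j (PC M)"
  shows "fin_gen_homology i (tubeZ M b q)"
proof -
  interpret tube "tubeZ M b q" "PC M"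
    "sector M b q {z. Re z \<noteq> 0 \<or> Im z > 0}" "sector M b q {z. Re z \<noteq> 0 \<or> Im z < 0}"
    "sector M b q {z. Re z > 0}" "sector M b q {z. Re z < 0}" "forget_to M"
    "beside M b q \<i>" "beside M b q (- \<i>)" "beside M b q 1" "beside M b q (- 1)"
    by (rule tube_collision[OF assms(1-3)])
  show ?thesis by (rule fin_gen_total[OF assms(4) assms(4)])
qed

lemma fin_gen_PC_empty: "fin_gen_homology i (PC {})"
proof -
  \<comment> \<open>The only extensional function on the empty set, hence the only point of
    \<open>PC {}\<close>.\<close>
  let ?a = "\<lambda>k. undefined :: complex"
  let ?c = "frag_of (restrict (\<lambda>x. ?a) (standard_simplex i))"
  have top: "topspace (PC {}) = {?a}" by auto
  show ?thesis
  proof (cases "i = 0")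
    case True
    show ?thesis
    proof (rule fin_gen_homologyI[of "{()}" _ _ "\<lambda>_. ?c"])
      show "scycle i (PC {}) ?c" for j
        unfolding singular_cycle_singleton[OF top] using singular_chain_singleton[OF top, of i ?c] True
        by (metis frag_cmul_one)
      fix c assume "scycle i (PC {}) c"
      then obtain k where "c = frag_cmul k ?c"
        using singular_chain_singleton[OF top, of i c] scycle_chain by blast
      then show "\<exists>n. shom i (PC {}) c (\<Sum>j\<in>{()}. frag_cmul (n j) ?c)"
        by (intro exI[of _ "\<lambda>_. k"]) simp
    qed simp
  next
    case False
    then show ?thesis
      using singular_boundary_eq_cycle_singleton[OF top, of i]
      by (intro fin_gen_homologyI[of "{}"]) (auto simp: homologous_rel_def)
  qed
qed

text \<open>Classes with \<open>a\<close> far away come from \<open>PC M\<close>, and the tubes over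
  \<open>PC M\<close> are finitely generated by \<open>fin_gen_tube\<close>. A tube draws on its
  base in two degrees, so the degree stays arbitrary in the induction.\<close>

lemma fin_gen_PC: "finite N \<Longrightarrow> fin_gen_homology i (PC N)"
proof (induction N arbitrary: i rule: finite_induct)
  case empty
  show ?case by (rule fin_gen_PC_empty)
next
  case (insert a M)
  let ?N = "insert a M"
  obtain T where T: "finite T" "\<forall>t\<in>T. scycle i (PC M) t"
    "\<forall>c. scycle i (PC M) c \<longrightarrow> (\<exists>n. shom i (PC M) c (\<Sum>t\<in>T. frag_cmul (n t) t))"
    by (rule fin_gen_homologyE[OF insert.IH])
  have "\<forall>j\<in>M. \<exists>S. finite S \<and> (\<forall>s\<in>S. scycle i (tubeZ M a j) s) \<and>
     (\<forall>c. scycle i (tubeZ M a j) c \<longrightarrow> (\<exists>n. shom i (tubeZ M a j) c (\<Sum>s\<in>S. frag_cmul (n s) s)))"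
    using fin_gen_tube[OF insert.hyps _ insert.IH] unfolding fin_gen_homology_def by (rule ballI)
  from bchoice[OF this] obtain S where S: "\<forall>j\<in>M. finite (S j) \<and> (\<forall>s\<in>S j. scycle i (tubeZ M a j) s) \<and>
     (\<forall>c. scycle i (tubeZ M a j) c \<longrightarrow> (\<exists>n. shom i (tubeZ M a j) c (\<Sum>s\<in>S j. frag_cmul (n s) s)))" ..
  let ?r = "chain_map i (add_far a M)"
  \<comment> \<open>A generator is either a cycle on \<open>PC M\<close>, to be moved by
    \<open>?r\<close>, or a pair of a collision and a cycle in its tube.\<close>
  let ?f = "case_sum ?r snd"
  show ?case
  proof (rule fin_gen_homologyI[of "T <+> Sigma M S" _ _ ?f])
    show "finite (T <+> Sigma M S)" using T(1) S insert.hyps(1) by auto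
    show "scycle i (PC ?N) (?f k)" if k: "k \<in> T <+> Sigma M S" for k
    proof (cases k)
      case (Inl t)
      then have "t \<in> T" using k by auto
      from scycle_chain_map[OF T(2)[rule_format, OF this] continuous_add_far_PC[OF insert.hyps]]
      show ?thesis by (simp add: Inl)
    next
      case (Inr js)
      then have "snd js \<in> S (fst js)" "fst js \<in> M" using k by auto
      then have "scycle i (tubeZ M a (fst js)) (snd js)" using S by blast
      from scycle_tube_PC[OF this] show ?thesis by (simp add: Inr)
    qed
    fix x assume x: "scycle i (PC ?N) x"
    obtain w where w: "\<forall>j\<in>M. scycle i (tubeZ M a j) (w j)"
      "\<forall>j\<in>M. shom i (PC M) (chain_map i (forget_to M) (w j)) 0"
      "shom i (PC ?N) x (?r (chain_map i (forget_to M) x) + (\<Sum>j\<in>M. w j))"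
      by (rule generation[OF insert.hyps x])
    have "scycle i (PC M) (chain_map i (forget_to M) x)"
      using x unfolding PC_def
      by (rule scycle_chain_map[OF _ continuous_forget_to]) (auto simp: inj_on_forget_to simp del: inj_on_insert intro: inj_on_subset)
    from T(3)[rule_format, OF this] obtain n where
      n: "shom i (PC M) (chain_map i (forget_to M) x) (\<Sum>t\<in>T. frag_cmul (n t) t)" ..
    have 1: "shom i (PC ?N) (?r (chain_map i (forget_to M) x)) (\<Sum>t\<in>T. frag_cmul (n t) (?r t))"
      using shom_chain_map[OF n continuous_add_far_PC[OF insert.hyps]] by (simp add: chain_map_sum_cmul)
    have "\<forall>j\<in>M. \<exists>m. shom i (tubeZ M a j) (w j) (\<Sum>s\<in>S j. frag_cmul (m s) s)"
      using S w(1) by blast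
    from bchoice[OF this] obtain m where
      m: "\<forall>j\<in>M. shom i (tubeZ M a j) (w j) (\<Sum>s\<in>S j. frag_cmul (m j s) s)" ..
    have "shom i (PC ?N) (w j) (\<Sum>s\<in>S j. frag_cmul (m j s) s)" if "j \<in> M" for j
    proof -
      have "shom i (subtopology (CC ?N) {x. inj_on x ?N}) (w j) (\<Sum>s\<in>S j. frag_cmul (m j s) s)"
        using m[rule_format, OF that] unfolding tubeZ_def by (rule shom_mono) blast
      then show ?thesis by (simp only: PC_def)
    qed
    from shom_sum[of M, OF this] have 2: "shom i (PC ?N) (\<Sum>j\<in>M. w j) (\<Sum>j\<in>M. \<Sum>s\<in>S j. frag_cmul (m j s) s)" .
    have "(\<Sum>j\<in>M. \<Sum>s\<in>S j. frag_cmul (m j s) s) = (\<Sum>js\<in>Sigma M S. frag_cmul (m (fst js) (snd js)) (snd js))"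
      using insert.hyps(1) S by (subst sum.Sigma) (auto simp: case_prod_beta)
    with homologous_rel_add[OF 1 2]
    have "shom i (PC ?N) (?r (chain_map i (forget_to M) x) + (\<Sum>j\<in>M. w j))
        (\<Sum>k\<in>T <+> Sigma M S. frag_cmul (case_sum n (\<lambda>js. m (fst js) (snd js)) k) (?f k))"
      using T(1) S insert.hyps(1) by (simp add: sum.Plus)
    from shom_trans[OF w(3) this]
    show "\<exists>n. shom i (PC ?N) x (\<Sum>k\<in>T <+> Sigma M S. frag_cmul (n k) (?f k))"
      by (rule exI[of _ "case_sum n (\<lambda>js. m (fst js) (snd js))"])
  qed
qed

section \<open>Cohomology classes are determined by their values on cycles\<close>

text \<open>Embeds integral chains in a rational vector space, where linear maps extend from
  subspaces; this carries out the argument from divisibility of \<complex>.\<close>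

definition rat_chain :: "('s \<Rightarrow>\<^sub>0 int) \<Rightarrow> 's \<Rightarrow>\<^sub>0 rat" where
  "rat_chain c = Poly_Mapping.map of_int c"

definition rat_scale :: "rat \<Rightarrow> ('s \<Rightarrow>\<^sub>0 rat) \<Rightarrow> 's \<Rightarrow>\<^sub>0 rat" where
  "rat_scale q f = Poly_Mapping.map ((*) q) f"

lemma lookup_rat_chain [simp]: "Poly_Mapping.lookup (rat_chain c) s = of_int (Poly_Mapping.lookup c s)"
  by (simp add: rat_chain_def map.rep_eq when_def)

lemma lookup_rat_scale [simp]: "Poly_Mapping.lookup (rat_scale q f) s = q * Poly_Mapping.lookup f s"
  by (simp add: rat_scale_def map.rep_eq when_def)

lemma lookup_frag_cmul [simp]: "Poly_Mapping.lookup (frag_cmul k c) s = k * Poly_Mapping.lookup c s"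
  by (simp add: frag_cmul_def)

lemma rat_chain_add: "rat_chain (a + b) = rat_chain a + rat_chain b"
  by (rule poly_mapping_eqI) (simp add: lookup_add)

lemma rat_chain_cmul: "rat_chain (frag_cmul k c) = rat_scale (of_int k) (rat_chain c)"
  by (rule poly_mapping_eqI) simp

lemma rat_chain_sum: "rat_chain (sum f I) = (\<Sum>i\<in>I. rat_chain (f i))"
proof (induction I rule: infinite_finite_induct)
  case (insert i I)
  then show ?case by (simp add: rat_chain_add)
qed (auto intro!: poly_mapping_eqI)

lemma rat_chain_inj: "rat_chain a = rat_chain b \<Longrightarrow> a = b"
  by (metis lookup_rat_chain of_int_eq_iff poly_mapping_eqI)

lemma rat_vector_space_pair:
  "vector_space_pair (rat_scale :: rat \<Rightarrow> ('s \<Rightarrow>\<^sub>0 rat) \<Rightarrow> _) (\<lambda>q (z :: complex). of_rat q * z)"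
  by unfold_locales
     (auto intro!: poly_mapping_eqI simp: lookup_add algebra_simps of_rat_add of_rat_mult)

lemma common_denominator:
  fixes r :: "'b \<Rightarrow> rat"
  assumes "finite T"
  obtains N :: int and m :: "'b \<Rightarrow> int" where "N > 0" "\<forall>b\<in>T. of_int N * r b = of_int (m b)"
proof -
  have "\<exists>N :: int. N > 0 \<and> (\<forall>b\<in>T. \<exists>m :: int. of_int N * r b = of_int m)"
    using assms
  proof (induction T)
    case (insert x T)
    then obtain N :: int where N: "N > 0" "\<forall>b\<in>T. \<exists>m :: int. of_int N * r b = of_int m" by blast
    obtain u v where uv: "quotient_of (r x) = (u, v)" by fastforce
    then have v: "v > 0" "r x = of_int u / of_int v"
      using quotient_of_denom_pos quotient_of_div by blast+
    have "of_int (N * v) * r x = (of_int (N * u) :: rat)" using v by simp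
    then have "\<exists>m :: int. of_int (N * v) * r x = of_int m" by blast
    moreover have "\<exists>m :: int. of_int (N * v) * r b = of_int m" if b: "b \<in> T" for b
    proof -
      obtain m :: int where "of_int N * r b = of_int m" using N(2) b by blast
      then have "of_int (N * v) * r b = (of_int (v * m) :: rat)" by (simp add: algebra_simps)
      then show ?thesis by blast
    qed
    ultimately have "N * v > 0 \<and> (\<forall>b\<in>insert x T. \<exists>m :: int. of_int (N * v) * r b = of_int m)"
      using N(1) v(1) by (simp del: of_int_mult)
    then show ?case by blast
  qed (auto intro: exI[of _ 1])
  then obtain N :: int where "N > 0" and N: "\<forall>b\<in>T. \<exists>m :: int. of_int N * r b = of_int m" by blast
  from bchoice[OF N] obtain m :: "'b \<Rightarrow> int" where "\<forall>b\<in>T. of_int N * r b = of_int (m b)" ..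
  with \<open>N > 0\<close> that show thesis by blast
qed

lemma additive_chain_cmul:
  fixes \<phi> :: "'a chain \<Rightarrow> complex"
  assumes add: "\<And>a b. singular_chain p X a \<Longrightarrow> singular_chain p X b \<Longrightarrow> \<phi> (a + b) = \<phi> a + \<phi> b"
    and a: "singular_chain p X a"
  shows "\<phi> (frag_cmul k a) = of_int k * \<phi> a"
proof -
  have \<phi>_0: "\<phi> 0 = 0" using add[of 0 0] by simp
  have \<phi>_nat: "\<phi> (frag_cmul (int n) a) = of_nat n * \<phi> a" for n
  proof (induction n)
    case (Suc n)
    have "frag_cmul (int (Suc n)) a = a + frag_cmul (int n) a" by (simp add: frag_cmul_distrib)
    then show ?case using Suc add[OF a singular_chain_cmul[OF a]] by (simp add: algebra_simps)
  qed (simp add: \<phi>_0)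
  show ?thesis
  proof (cases k)
    case (nonneg n)
    then show ?thesis using \<phi>_nat by simp
  next
    case (neg n)
    let ?b = "frag_cmul (int (Suc n)) a"
    have "frag_cmul k a = - ?b"
      unfolding neg by (rule poly_mapping_eqI) simp
    moreover have "\<phi> (- b) = - \<phi> b" if "singular_chain p X b" for b
      using add[of b "- b"] that by (simp add: singular_chain_minus \<phi>_0 add_eq_0_iff)
    from this[OF singular_chain_cmul[OF a]] have "\<phi> (- ?b) = - \<phi> ?b" .
    ultimately show ?thesis using \<phi>_nat[of "Suc n"] by (simp add: neg del: of_nat_Suc)
  qed
qed

lemma additive_chain_sum:
  fixes \<phi> :: "'a chain \<Rightarrow> complex" and f :: "'i \<Rightarrow> 'a chain"
  assumes add: "\<And>a b. singular_chain p X a \<Longrightarrow> singular_chain p X b \<Longrightarrow> \<phi> (a + b) = \<phi> a + \<phi> b"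
    and f: "\<And>i. i \<in> I \<Longrightarrow> singular_chain p X (f i)"
  shows "\<phi> (sum f I) = (\<Sum>i\<in>I. \<phi> (f i))"
proof -
  have \<phi>_0: "\<phi> 0 = 0" using add[of 0 0] by simp
  show ?thesis
    using f
  proof (induction I rule: infinite_finite_induct)
    case (insert i I)
    then show ?case using add[of "f i" "sum f I"] singular_chain_sum[of I p X f] by auto
  qed (simp_all add: \<phi>_0)
qed

text \<open>
  The functional on boundaries is extended to all chains along a rational basis of the boundaries
  that consists of integral boundaries.
\<close>

lemma extend_from_boundaries:
  fixes \<phi> :: "'a chain \<Rightarrow> complex"
  assumes add: "\<And>a b. singular_chain (Suc q) X a \<Longrightarrow> singular_chain (Suc q) X b \<Longrightarrow> \<phi> (a + b) = \<phi> a + \<phi> b"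
    and null: "\<And>c. scycle (Suc q) X c \<Longrightarrow> \<phi> c = 0"
  obtains \<psi> :: "'a chain \<Rightarrow> complex" where "\<And>a b. \<psi> (a + b) = \<psi> a + \<psi> b"
    "\<And>c. singular_chain (Suc q) X c \<Longrightarrow> \<phi> c = \<psi> (chain_boundary (Suc q) c)"
proof -
  let ?S = "\<lambda>q (z :: complex). of_rat q * z"
  interpret vector_space_pair "rat_scale :: rat \<Rightarrow> (((nat \<Rightarrow> real) \<Rightarrow> 'a) \<Rightarrow>\<^sub>0 rat) \<Rightarrow> _" ?S
    by (rule rat_vector_space_pair)
  let ?C = "singular_chain (Suc q) X"
  have \<phi>_cmul: "\<phi> (frag_cmul k a) = of_int k * \<phi> a" if "?C a" for k a
    by (rule additive_chain_cmul[OF add that])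
  have \<phi>_sum: "\<phi> (sum f I) = (\<Sum>i\<in>I. \<phi> (f i))" if "\<And>i. i \<in> I \<Longrightarrow> ?C (f i)"
    for f :: "(((nat \<Rightarrow> real) \<Rightarrow> 'a) \<Rightarrow>\<^sub>0 rat) \<Rightarrow> 'a chain" and I
    by (rule additive_chain_sum[OF add that])
  let ?d = "\<lambda>c. rat_chain (chain_boundary (Suc q) c)"
  let ?R = "?d ` Collect ?C"
  obtain B where B: "B \<subseteq> ?R" "vs1.independent B" "?R \<subseteq> vs1.span B"
    by (rule vs1.maximal_independent_subset)
  have "\<forall>b\<in>B. \<exists>k. ?C k \<and> ?d k = b" using B(1) by auto
  \<comment> \<open>The value on a basis element \<open>b\<close> is dictated by
    \<open>\<phi>\<close> on a chosen integral chain \<open>k b\<close> with boundary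
    \<open>b\<close>.\<close>
  from bchoice[OF this] obtain k where k: "\<forall>b\<in>B. ?C (k b) \<and> ?d (k b) = b" ..
  obtain g where g: "Vector_Spaces.linear rat_scale ?S g" "\<forall>b\<in>B. g b = \<phi> (k b)"
    using linear_independent_extend[OF B(2), of "\<lambda>b. \<phi> (k b)"] by blast
  interpret g: Vector_Spaces.linear rat_scale ?S g by (rule g(1))
  show thesis
  proof (rule that[of "\<lambda>c. g (rat_chain c)"])
    show "g (rat_chain (a + b)) = g (rat_chain a) + g (rat_chain b)" for a b
      by (simp add: rat_chain_add g.add)
    fix c assume c: "?C c"
    then have "?d c \<in> vs1.span B" using B(3) by blast
    then obtain T r where T: "finite T" "T \<subseteq> B" "?d c = (\<Sum>b\<in>T. rat_scale (r b) b)"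
      unfolding vs1.span_explicit by blast
    \<comment> \<open>A common denominator makes the relation between boundaries integral:
      \<open>frag_cmul N c\<close> and \<open>?e\<close> then differ by a cycle, on which
      \<open>\<phi>\<close> vanishes, and \<open>N\<close> can be cancelled in \<complex>.\<close>
    obtain N :: int and m where N: "N > 0" "\<forall>b\<in>T. of_int N * r b = of_int (m b)"
      by (rule common_denominator[OF T(1)])
    let ?e = "\<Sum>b\<in>T. frag_cmul (m b) (k b)"
    have kT: "?C (k b)" "?d (k b) = b" if "b \<in> T" for b using k T(2) that by auto
    have e: "?C ?e" by (intro singular_chain_sum singular_chain_cmul kT)
    have "?d (frag_cmul N c) = rat_scale (of_int N) (?d c)"
      by (simp add: chain_boundary_cmul rat_chain_cmul)
    also have "\<dots> = (\<Sum>b\<in>T. rat_scale (of_int (m b)) b)"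
      unfolding T(3) vs1.scale_sum_right using N(2) by (intro sum.cong) (simp_all add: vs1.scale_scale)
    also have "\<dots> = ?d ?e"
      unfolding chain_boundary_sum_cmul rat_chain_sum using kT(2) by (intro sum.cong) (simp_all add: rat_chain_cmul)
    finally have "chain_boundary (Suc q) (frag_cmul N c - ?e) = 0"
      using rat_chain_inj by (simp add: chain_boundary_diff) blast
    moreover have C': "?C (frag_cmul N c - ?e)" by (intro singular_chain_diff singular_chain_cmul c e)
    ultimately have "\<phi> (frag_cmul N c - ?e) = 0" by (intro null) (simp add: singular_cycle)
    moreover have "\<phi> (frag_cmul N c - ?e + ?e) = \<phi> (frag_cmul N c - ?e) + \<phi> ?e" by (rule add[OF C' e])
    ultimately have "of_int N * \<phi> c = \<phi> ?e" by (simp add: \<phi>_cmul[OF c])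
    also have "\<phi> ?e = (\<Sum>b\<in>T. \<phi> (frag_cmul (m b) (k b)))" by (intro \<phi>_sum singular_chain_cmul kT)
    also have "\<dots> = (\<Sum>b\<in>T. of_int N * (of_rat (r b) * g b))"
    proof (rule sum.cong[OF refl])
      fix b assume b: "b \<in> T"
      have "(of_int (m b) :: complex) = of_rat (of_int N * r b)" using N(2) b by simp
      then have "(of_int (m b) :: complex) = of_int N * of_rat (r b)" by (simp only: of_rat_mult of_rat_of_int_eq)
      then show "\<phi> (frag_cmul (m b) (k b)) = of_int N * (of_rat (r b) * g b)"
        using g(2) T(2) b by (auto simp: \<phi>_cmul kT)
    qed
    also have "\<dots> = of_int N * g (?d c)"
      unfolding T(3) g.sum g.scale by (simp add: sum_distrib_left)
    finally show "\<phi> c = g (rat_chain (chain_boundary (Suc q) c))" using N(1) by simp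
  qed
qed

section \<open>Cocycles and cohomology classes\<close>

lemma carrier_cochain_space:
  "\<phi> \<in> carrier (cochain_space p X) \<longleftrightarrow> \<phi> \<in> extensional (Collect (singular_chain p X)) \<and>
    (\<forall>a b. singular_chain p X a \<longrightarrow> singular_chain p X b \<longrightarrow> \<phi> (a + b) = \<phi> a + \<phi> b)"
  by (auto simp: cochain_space_def hom_def)

lemma cochain_add: "\<phi> \<oplus>\<^bsub>cochain_space p X\<^esub> \<psi> = (\<lambda>c\<in>Collect (singular_chain p X). \<phi> c + \<psi> c)"
  by (simp add: cochain_space_def)

lemma cochain_smult: "z \<odot>\<^bsub>cochain_space p X\<^esub> \<phi> = (\<lambda>c\<in>Collect (singular_chain p X). z * \<phi> c)"
  by (simp add: cochain_space_def)

lemma cochain_at_0: "\<phi> \<in> carrier (cochain_space p X) \<Longrightarrow> \<phi> 0 = 0"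
  using carrier_cochain_space[of \<phi> p X] by (metis add_0 add_left_cancel add.right_neutral singular_chain_0)

lemma cocycles_iff:
  "\<phi> \<in> cocycles p X \<longleftrightarrow> \<phi> \<in> carrier (cochain_space p X) \<and>
    (\<forall>d. singular_chain (Suc p) X d \<longrightarrow> \<phi> (chain_boundary (Suc p) d) = 0)"
  unfolding cocycles_def coboundary_def by (auto simp: cochain_space_def fun_eq_iff restrict_def)

text \<open>The substantial direction is the vanishing of Ext into \<complex> in the universal
  coefficient theorem: a cochain that vanishes on cycles factors through the boundary map, and the
  induced functional extends to all chains. In degree 0 every chain is a cycle.\<close>

lemma coboundaries_iff:
  "\<phi> \<in> coboundaries p X \<longleftrightarrow> \<phi> \<in> cocycles p X \<and> (\<forall>c. scycle p X c \<longrightarrow> \<phi> c = 0)"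
proof (cases p)
  case 0
  have zero: "\<zero>\<^bsub>cochain_space 0 X\<^esub> = (\<lambda>c\<in>Collect (singular_chain 0 X). 0)" by (simp add: cochain_space_def)
  have "scycle 0 X c \<longleftrightarrow> singular_chain 0 X c" for c by (simp add: singular_cycle chain_boundary_def)
  then show ?thesis
    unfolding 0 coboundaries_def cocycles_iff carrier_cochain_space zero
    by (auto simp: singular_chain_boundary_alt singular_chain_add intro: extensionalityI)
next
  case (Suc q)
  show ?thesis
  proof
    assume "\<phi> \<in> coboundaries p X"
    then obtain \<psi> where \<psi>: "\<psi> \<in> carrier (cochain_space q X)" "\<phi> = coboundary q X \<psi>"
      unfolding coboundaries_def Suc by auto
    have \<phi>: "\<phi> c = \<psi> (chain_boundary p c)" if "singular_chain p X c" for c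
      using that by (simp add: \<psi>(2) coboundary_def Suc)
    have "\<phi> \<in> carrier (cochain_space p X)"
      unfolding carrier_cochain_space
    proof (intro conjI allI impI)
      show "\<phi> \<in> extensional (Collect (singular_chain p X))" by (simp add: \<psi>(2) coboundary_def Suc)
      fix a b assume "singular_chain p X a" "singular_chain p X b"
      moreover from this have "singular_chain q X (chain_boundary p a)" "singular_chain q X (chain_boundary p b)"
        unfolding Suc by (auto intro: singular_chain_boundary_alt)
      ultimately show "\<phi> (a + b) = \<phi> a + \<phi> b"
        using \<psi>(1) by (simp add: \<phi> singular_chain_add chain_boundary_add carrier_cochain_space)
    qed
    moreover have "\<phi> (chain_boundary (Suc p) d) = 0" if "singular_chain (Suc p) X d" for d
      using \<phi>[OF singular_chain_boundary_alt[OF that]] chain_boundary_boundary_alt[of p X d] that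
        cochain_at_0[OF \<psi>(1)] Suc by (metis chain_boundary_boundary diff_Suc_1 One_nat_def)
    moreover have "\<phi> c = 0" if "scycle p X c" for c
      using that \<phi>[of c] cochain_at_0[OF \<psi>(1)] by (simp add: singular_cycle)
    ultimately show "\<phi> \<in> cocycles p X \<and> (\<forall>c. scycle p X c \<longrightarrow> \<phi> c = 0)"
      by (simp add: cocycles_iff)
  next
    assume \<phi>: "\<phi> \<in> cocycles p X \<and> (\<forall>c. scycle p X c \<longrightarrow> \<phi> c = 0)"
    obtain \<psi> where \<psi>: "\<And>a b. \<psi> (a + b) = \<psi> a + \<psi> b"
      "\<And>c. singular_chain (Suc q) X c \<Longrightarrow> \<phi> c = \<psi> (chain_boundary (Suc q) c)"
      by (rule extend_from_boundaries[of q X \<phi>])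
         (use \<phi> in \<open>auto simp: Suc cocycles_iff carrier_cochain_space\<close>)
    have "restrict \<psi> (Collect (singular_chain q X)) \<in> carrier (cochain_space q X)"
      by (simp add: carrier_cochain_space \<psi>(1) singular_chain_add)
    moreover have "\<phi> = coboundary q X (restrict \<psi> (Collect (singular_chain q X)))"
    proof (rule extensionalityI)
      show "\<phi> \<in> extensional (Collect (singular_chain p X))" using \<phi> by (simp add: cocycles_iff carrier_cochain_space)
      show "coboundary q X (restrict \<psi> (Collect (singular_chain q X))) \<in> extensional (Collect (singular_chain p X))"
        by (simp add: coboundary_def Suc)
    qed (simp add: coboundary_def Suc \<psi>(2) singular_chain_boundary_alt)
    ultimately show "\<phi> \<in> coboundaries p X" unfolding coboundaries_def Suc by auto
  qed
qed

text \<open>For a cocycle \<open>\<phi>\<close> this is its coset modulo coboundaries, by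
  \<open>coboundaries_iff\<close>. The description by values on cycles reduces equality of classes
  to evaluation.\<close>

definition coclass :: "nat \<Rightarrow> 'a topology \<Rightarrow> ('a chain \<Rightarrow> complex) \<Rightarrow> ('a chain \<Rightarrow> complex) set" where
  "coclass p X \<phi> = {\<psi> \<in> cocycles p X. \<forall>c. scycle p X c \<longrightarrow> \<psi> c = \<phi> c}"

lemma coboundaries_eq_coclass: "coboundaries p X = coclass p X (\<lambda>_. 0)"
  by (auto simp: coclass_def coboundaries_iff)

lemma cocycles_diff:
  assumes "\<phi> \<in> cocycles p X" "\<psi> \<in> cocycles p X"
  shows "(\<lambda>c\<in>Collect (singular_chain p X). \<phi> c - \<psi> c) \<in> cocycles p X"
  using assms by (auto simp: cocycles_iff carrier_cochain_space singular_chain_add singular_chain_boundary_alt)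

lemma cocycles_add:
  assumes "\<phi> \<in> cocycles p X" "\<psi> \<in> cocycles p X"
  shows "\<phi> \<oplus>\<^bsub>cochain_space p X\<^esub> \<psi> \<in> cocycles p X"
  using assms by (auto simp: cochain_add cocycles_iff carrier_cochain_space singular_chain_add singular_chain_boundary_alt)

lemma cocycles_smult:
  assumes "\<phi> \<in> cocycles p X"
  shows "z \<odot>\<^bsub>cochain_space p X\<^esub> \<phi> \<in> cocycles p X"
  using assms by (auto simp: cochain_smult cocycles_iff carrier_cochain_space singular_chain_add singular_chain_boundary_alt algebra_simps)

lemma cocycles_pullback:
  assumes "\<phi> \<in> cocycles p Y" "continuous_map X Y f"
  shows "cochain_pullback p X f \<phi> \<in> cocycles p X"
  using assms
  by (auto simp: cochain_pullback_def cocycles_iff carrier_cochain_space singular_chain_add chain_map_add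
      singular_chain_boundary_alt singular_chain_chain_map chain_boundary_chain_map_Suc[symmetric])

lemma coclass_add:
  assumes "\<phi> \<in> cocycles p X" "\<psi> \<in> cocycles p X"
  shows "coclass p X \<phi> <+>\<^bsub>cochain_space p X\<^esub> coclass p X \<psi> = coclass p X (\<phi> \<oplus>\<^bsub>cochain_space p X\<^esub> \<psi>)"
proof
  show "coclass p X \<phi> <+>\<^bsub>cochain_space p X\<^esub> coclass p X \<psi> \<subseteq> coclass p X (\<phi> \<oplus>\<^bsub>cochain_space p X\<^esub> \<psi>)"
    by (auto simp: set_add_def' coclass_def cocycles_add) (auto simp: cochain_add dest: scycle_chain)
  show "coclass p X (\<phi> \<oplus>\<^bsub>cochain_space p X\<^esub> \<psi>) \<subseteq> coclass p X \<phi> <+>\<^bsub>cochain_space p X\<^esub> coclass p X \<psi>"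
  proof
    fix \<xi> assume \<xi>: "\<xi> \<in> coclass p X (\<phi> \<oplus>\<^bsub>cochain_space p X\<^esub> \<psi>)"
    let ?\<theta> = "\<lambda>c\<in>Collect (singular_chain p X). \<xi> c - \<psi> c"
    have "?\<theta> \<in> coclass p X \<phi>"
      using \<xi> cocycles_diff[of \<xi> p X \<psi>] assms(2) by (auto simp: coclass_def cochain_add dest: scycle_chain)
    moreover have "\<psi> \<in> coclass p X \<psi>" using assms(2) by (simp add: coclass_def)
    moreover have "\<xi> = ?\<theta> \<oplus>\<^bsub>cochain_space p X\<^esub> \<psi>"
    proof (rule extensionalityI[where A = "Collect (singular_chain p X)"])
      show "\<xi> \<in> extensional (Collect (singular_chain p X))"
        using \<xi> by (simp add: coclass_def cocycles_iff carrier_cochain_space)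
    qed (simp_all add: cochain_add)
    ultimately show "\<xi> \<in> coclass p X \<phi> <+>\<^bsub>cochain_space p X\<^esub> coclass p X \<psi>"
      unfolding set_add_def' by blast
  qed
qed

text \<open>Serves scalar multiples and pullbacks, whose definitions add the coboundaries to the
  image of a class because this image may be smaller than a class.\<close>

lemma coboundaries_add_coclass:
  assumes "\<phi> \<in> T" "T \<subseteq> coclass p X \<phi>"
  shows "coboundaries p X <+>\<^bsub>cochain_space p X\<^esub> T = coclass p X \<phi>"
proof
  show "coboundaries p X <+>\<^bsub>cochain_space p X\<^esub> T \<subseteq> coclass p X \<phi>"
  proof
    fix \<xi> assume "\<xi> \<in> coboundaries p X <+>\<^bsub>cochain_space p X\<^esub> T"
    then obtain \<beta> \<tau> where \<beta>: "\<beta> \<in> coboundaries p X" and \<tau>: "\<tau> \<in> coclass p X \<phi>"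
      and \<xi>: "\<xi> = \<beta> \<oplus>\<^bsub>cochain_space p X\<^esub> \<tau>"
      unfolding set_add_def' using assms(2) by blast
    have "\<xi> \<in> cocycles p X" unfolding \<xi> using \<beta> \<tau> by (intro cocycles_add) (auto simp: coboundaries_iff coclass_def)
    moreover have "\<xi> c = \<phi> c" if "scycle p X c" for c
      using \<beta> \<tau> that scycle_chain[OF that] by (simp add: \<xi> cochain_add coboundaries_iff coclass_def)
    ultimately show "\<xi> \<in> coclass p X \<phi>" by (simp add: coclass_def)
  qed
  show "coclass p X \<phi> \<subseteq> coboundaries p X <+>\<^bsub>cochain_space p X\<^esub> T"
  proof
    fix \<xi> assume \<xi>: "\<xi> \<in> coclass p X \<phi>"
    have \<phi>: "\<phi> \<in> cocycles p X" using assms by (auto simp: coclass_def)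
    let ?\<theta> = "\<lambda>c\<in>Collect (singular_chain p X). \<xi> c - \<phi> c"
    have "?\<theta> \<in> coboundaries p X"
      using \<xi> cocycles_diff[of \<xi> p X \<phi>] \<phi> by (auto simp: coboundaries_iff coclass_def dest: scycle_chain)
    moreover have "\<xi> = ?\<theta> \<oplus>\<^bsub>cochain_space p X\<^esub> \<phi>"
    proof (rule extensionalityI[where A = "Collect (singular_chain p X)"])
      show "\<xi> \<in> extensional (Collect (singular_chain p X))"
        using \<xi> by (simp add: coclass_def cocycles_iff carrier_cochain_space)
    qed (simp_all add: cochain_add)
    ultimately show "\<xi> \<in> coboundaries p X <+>\<^bsub>cochain_space p X\<^esub> T"
      unfolding set_add_def' using assms(1) by blast
  qed
qed

lemma coclass_smult:
  assumes "\<phi> \<in> cocycles p X"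
  shows "coboundaries p X <+>\<^bsub>cochain_space p X\<^esub> (\<lambda>v. z \<odot>\<^bsub>cochain_space p X\<^esub> v) ` coclass p X \<phi>
    = coclass p X (z \<odot>\<^bsub>cochain_space p X\<^esub> \<phi>)"
proof (rule coboundaries_add_coclass)
  show "z \<odot>\<^bsub>cochain_space p X\<^esub> \<phi> \<in> (\<lambda>v. z \<odot>\<^bsub>cochain_space p X\<^esub> v) ` coclass p X \<phi>"
    using assms by (simp add: coclass_def)
  show "(\<lambda>v. z \<odot>\<^bsub>cochain_space p X\<^esub> v) ` coclass p X \<phi> \<subseteq> coclass p X (z \<odot>\<^bsub>cochain_space p X\<^esub> \<phi>)"
    by (auto simp: coclass_def cocycles_smult) (auto simp: cochain_smult dest: scycle_chain)
qed

lemma coclass_pullback: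
  assumes "\<phi> \<in> cocycles p Y" "continuous_map X Y f"
  shows "cohomology_pullback p X f (coclass p Y \<phi>) = coclass p X (cochain_pullback p X f \<phi>)"
  unfolding cohomology_pullback_def
proof (rule coboundaries_add_coclass)
  show "cochain_pullback p X f \<phi> \<in> cochain_pullback p X f ` coclass p Y \<phi>"
    using assms by (simp add: coclass_def)
  show "cochain_pullback p X f ` coclass p Y \<phi> \<subseteq> coclass p X (cochain_pullback p X f \<phi>)"
    using scycle_chain_map[OF _ assms(2)]
    by (auto simp: coclass_def cocycles_pullback assms(2)) (auto simp: cochain_pullback_def dest: scycle_chain)
qed

section \<open>The cohomology space through its classes\<close>

lemma carrier_cohomology: "carrier (cohomology p X) = coclass p X ` cocycles p X"
proof -
  have "coboundaries p X +>\<^bsub>(cochain_space p X)\<lparr>carrier := cocycles p X\<rparr>\<^esub> \<phi> = coclass p X \<phi>"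
    if "\<phi> \<in> cocycles p X" for \<phi>
    using coboundaries_add_coclass[of \<phi> "{\<phi>}" p X] that
    by (simp add: a_r_coset_def' set_add_def' coclass_def)
  then show ?thesis
    by (auto simp: cohomology_def quotient_space_def A_RCOSETS_def')
qed

lemma add_cohomology:
  assumes "\<phi> \<in> cocycles p X" "\<psi> \<in> cocycles p X"
  shows "coclass p X \<phi> \<oplus>\<^bsub>cohomology p X\<^esub> coclass p X \<psi> = coclass p X (\<phi> \<oplus>\<^bsub>cochain_space p X\<^esub> \<psi>)"
  using coclass_add[OF assms] by (simp add: cohomology_def quotient_space_def set_add_def')

lemma smult_cohomology:
  assumes "\<phi> \<in> cocycles p X"
  shows "z \<odot>\<^bsub>cohomology p X\<^esub> coclass p X \<phi> = coclass p X (z \<odot>\<^bsub>cochain_space p X\<^esub> \<phi>)"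
  using coclass_smult[OF assms] by (simp add: cohomology_def quotient_space_def set_add_def')

lemma zero_cohomology: "\<zero>\<^bsub>cohomology p X\<^esub> = coclass p X (\<lambda>c\<in>Collect (singular_chain p X). 0)"
  using scycle_chain by (auto simp: cohomology_def quotient_space_def coboundaries_eq_coclass coclass_def)

text \<open>Meaningful only for cycles \<open>c\<close>, where all representatives of a class agree.\<close>

definition coclass_at :: "'a chain \<Rightarrow> ('a chain \<Rightarrow> complex) set \<Rightarrow> complex" where
  "coclass_at c K = (SOME \<phi>. \<phi> \<in> K) c"

lemma coclass_at_coclass:
  assumes "\<phi> \<in> cocycles p X" "scycle p X c"
  shows "coclass_at c (coclass p X \<phi>) = \<phi> c"
proof -
  have "\<phi> \<in> coclass p X \<phi>" using assms(1) by (simp add: coclass_def)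
  then have "(SOME \<psi>. \<psi> \<in> coclass p X \<phi>) \<in> coclass p X \<phi>"
    by (rule someI[where P = "\<lambda>\<psi>. \<psi> \<in> coclass p X \<phi>"])
  then show ?thesis using assms(2) by (simp add: coclass_at_def coclass_def)
qed

section \<open>Complete reducibility\<close>

text \<open>The representation space is a subspace \<open>M\<close> of a vector space on a whole
  type, so that bases, dimension and linear projections are at hand; \<open>F\<close> bounds the
  dimension and may lie outside \<open>M\<close>.\<close>

locale perm_rep = vector_space scale
  for scale :: "complex \<Rightarrow> 'b :: ab_group_add \<Rightarrow> 'b" +
  fixes n :: nat and \<rho> :: "(nat \<Rightarrow> nat) \<Rightarrow> 'b \<Rightarrow> 'b" and M F :: "'b set"
  assumes sub_M: "subspace M" and fin_F: "finite F" and M_span: "M \<subseteq> span F"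
    and \<rho>_in: "g permutes {1..n} \<Longrightarrow> v \<in> M \<Longrightarrow> \<rho> g v \<in> M"
    and \<rho>_add: "g permutes {1..n} \<Longrightarrow> v \<in> M \<Longrightarrow> w \<in> M \<Longrightarrow> \<rho> g (v + w) = \<rho> g v + \<rho> g w"
    and \<rho>_scale: "g permutes {1..n} \<Longrightarrow> v \<in> M \<Longrightarrow> \<rho> g (scale c v) = scale c (\<rho> g v)"
    and \<rho>_id: "v \<in> M \<Longrightarrow> \<rho> id v = v"
    and \<rho>_comp: "g permutes {1..n} \<Longrightarrow> h permutes {1..n} \<Longrightarrow> v \<in> M \<Longrightarrow> \<rho> (g \<circ> h) v = \<rho> g (\<rho> h v)"
begin

definition invariant :: "'b set \<Rightarrow> bool" where
  "invariant U \<longleftrightarrow> subspace U \<and> U \<subseteq> M \<and> (\<forall>g v. g permutes {1..n} \<longrightarrow> v \<in> U \<longrightarrow> \<rho> g v \<in> U)"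

definition simple :: "'b set \<Rightarrow> bool" where
  "simple U \<longleftrightarrow> invariant U \<and> U \<noteq> {0} \<and> (\<forall>V. invariant V \<longrightarrow> V \<subseteq> U \<longrightarrow> V = {0} \<or> V = U)"

lemma \<rho>_zero: "g permutes {1..n} \<Longrightarrow> \<rho> g 0 = 0"
  using \<rho>_add[of g 0 0] subspace_0[OF sub_M] by simp

lemma \<rho>_sum:
  assumes "g permutes {1..n}" "\<And>i. i \<in> I \<Longrightarrow> f i \<in> M"
  shows "\<rho> g (sum f I) = (\<Sum>i\<in>I. \<rho> g (f i))"
  using assms(2)
proof (induction I rule: infinite_finite_induct)
  case (insert i I)
  then have "sum f I \<in> M" by (intro subspace_sum[OF sub_M]) auto
  with insert show ?case by (simp add: \<rho>_add[OF assms(1)])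
qed (simp_all add: \<rho>_zero[OF assms(1)])

text \<open>An element of \<open>V\<close> outside \<open>U\<close> enlarges a basis of
  \<open>U\<close>. All bases are finite because \<open>M\<close> lies in \<open>span F\<close>, so
  their cardinalities can be compared.\<close>

lemma dim_less:
  assumes "subspace U" "U \<subset> V" "V \<subseteq> M"
  shows "dim U < dim V"
proof -
  obtain B where B: "B \<subseteq> V" "independent B" "V \<subseteq> span B" "card B = dim V"
    by (rule basis_exists)
  obtain C where C: "C \<subseteq> U" "independent C" "U \<subseteq> span C" "card C = dim U"
    by (rule basis_exists)
  have "B \<subseteq> span F" using B(1) assms(3) M_span by blast
  from independent_span_bound[OF fin_F B(2) this] have finB: "finite B" by simp
  obtain x where x: "x \<in> V" "x \<notin> U" using assms(2) by blast
  have "span C \<subseteq> U" using C(1) assms(1) by (rule span_minimal)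
  then have "x \<notin> span C" using x(2) by blast
  then have ind: "independent (insert x C)" using C(2) by (rule independent_insertI)
  have "insert x C \<subseteq> span B" using x(1) C(1) assms(2) B(3) by blast
  from independent_span_bound[OF finB ind this] have "finite (insert x C)" "card (insert x C) \<le> card B" by auto
  moreover have "x \<notin> C" using C(1) x(2) by blast
  ultimately show ?thesis using B(4) C(4) by simp
qed

text \<open>By averaging a linear projection onto \<open>U\<close> over the group.\<close>

lemma invariant_complement:
  assumes U: "invariant U" and V: "invariant V" and "U \<subseteq> V"
  obtains W where "invariant W" "W \<subseteq> V" "U \<inter> W = {0}" "\<forall>v\<in>V. \<exists>u\<in>U. v - u \<in> W"
proof -
  interpret vector_space_pair scale scale by unfold_locales
  have sub_U: "subspace U" and UM: "U \<subseteq> M" and inv_U: "\<And>g v. g permutes {1..n} \<Longrightarrow> v \<in> U \<Longrightarrow> \<rho> g v \<in> U"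
    using U by (auto simp: invariant_def)
  have sub_V: "subspace V" and VM: "V \<subseteq> M" and inv_V: "\<And>g v. g permutes {1..n} \<Longrightarrow> v \<in> V \<Longrightarrow> \<rho> g v \<in> V"
    using V by (auto simp: invariant_def)
  have "Vector_Spaces.linear scale scale id"
    by unfold_locales auto
  \<comment> \<open>A left inverse of the identity on \<open>U\<close> with values in
    \<open>U\<close> is a linear projection of the ambient space onto \<open>U\<close>.\<close>
  from linear_exists_left_inverse_on[OF this sub_U]
  obtain \<pi> where \<pi>: "\<pi> \<in> UNIV \<rightarrow> U" "Vector_Spaces.linear scale scale \<pi>" "\<forall>v\<in>U. \<pi> v = v"
    by auto
  interpret \<pi>: Vector_Spaces.linear scale scale \<pi> by (rule \<pi>(2))
  define G where "G = {g. g permutes {1..n}}"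
  have finG: "finite G" by (simp add: G_def finite_permutations)
  have G_inv: "inv' g \<in> G" if "g \<in> G" for g using that by (simp add: G_def permutes_inv)
  have "id \<in> G" by (simp add: G_def permutes_id)
  then have card0: "(of_nat (card G) :: complex) \<noteq> 0" using finG by auto
  define P where "P v = scale (1 / of_nat (card G)) (\<Sum>g\<in>G. \<rho> g (\<pi> (\<rho> (inv' g) v)))" for v
  have \<pi>U: "\<pi> v \<in> U" for v using \<pi>(1) by auto
  have \<rho>inM: "\<rho> g v \<in> M" if "g \<in> G" "v \<in> M" for g v using that \<rho>_in by (simp add: G_def)
  have P_in: "P v \<in> U" for v
    unfolding P_def by (intro subspace_scale[OF sub_U] subspace_sum[OF sub_U] inv_U \<pi>U) (simp add: G_def)
  have P_add: "P (v + w) = P v + P w" if "v \<in> M" "w \<in> M" for v w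
  proof -
    have "\<rho> g (\<pi> (\<rho> (inv' g) (v + w))) = \<rho> g (\<pi> (\<rho> (inv' g) v)) + \<rho> g (\<pi> (\<rho> (inv' g) w))" if "g \<in> G" for g
      using \<open>v \<in> M\<close> \<open>w \<in> M\<close> G_inv[OF that] that \<pi>U UM
      by (simp add: \<rho>_add G_def \<pi>.add subset_iff)
    then show ?thesis by (simp add: P_def sum.distrib scale_right_distrib)
  qed
  have P_scale: "P (scale c v) = scale c (P v)" if "v \<in> M" for c v
  proof -
    have "\<rho> g (\<pi> (\<rho> (inv' g) (scale c v))) = scale c (\<rho> g (\<pi> (\<rho> (inv' g) v)))" if "g \<in> G" for g
      using \<open>v \<in> M\<close> G_inv[OF that] that \<pi>U UM by (simp add: \<rho>_scale G_def \<pi>.scale subset_iff)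
    then show ?thesis by (simp add: P_def scale_sum_right[symmetric] mult.commute)
  qed
  have P_id: "P u = u" if "u \<in> U" for u
  proof -
    have "\<rho> g (\<pi> (\<rho> (inv' g) u)) = u" if g: "g \<in> G" for g
    proof -
      have perm: "g permutes {1..n}" "inv' g permutes {1..n}" using g G_inv[OF g] by (auto simp: G_def)
      have "\<pi> (\<rho> (inv' g) u) = \<rho> (inv' g) u" using inv_U[OF perm(2) \<open>u \<in> U\<close>] \<pi>(3) by blast
      moreover have "\<rho> g (\<rho> (inv' g) u) = \<rho> (g \<circ> inv' g) u"
        using \<rho>_comp[OF perm] \<open>u \<in> U\<close> UM by auto
      ultimately show ?thesis
        using permutes_inv_o(1)[OF perm(1)] \<rho>_id \<open>u \<in> U\<close> UM by auto
    qed
    then have "P u = scale (1 / of_nat (card G)) (\<Sum>g\<in>G. u)" by (simp add: P_def)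
    also have "(\<Sum>g\<in>G. u) = scale (of_nat (card G)) u"
      using finG by (induction G) (auto simp: scale_left_distrib)
    finally show ?thesis using card0 by simp
  qed
  have P_equiv: "P (\<rho> h v) = \<rho> h (P v)" if h: "h permutes {1..n}" and v: "v \<in> M" for h v
  proof -
    have "(\<Sum>g\<in>G. \<rho> g (\<pi> (\<rho> (inv' g) (\<rho> h v)))) = (\<Sum>g\<in>G. \<rho> (h \<circ> g) (\<pi> (\<rho> (inv' (h \<circ> g)) (\<rho> h v))))"
      unfolding G_def by (rule setum_permutations_compose_left[OF h])
    also have "\<dots> = (\<Sum>g\<in>G. \<rho> h (\<rho> g (\<pi> (\<rho> (inv' g) v))))"
    proof (rule sum.cong[OF refl])
      fix g assume "g \<in> G"
      then have g: "g permutes {1..n}" and g': "inv' g permutes {1..n}" by (auto simp: G_def permutes_inv)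
      have hg: "inv' (h \<circ> g) permutes {1..n}" using permutes_inv[OF permutes_compose[OF g h]] .
      have "inv' (h \<circ> g) \<circ> h = inv' g"
        using o_inv_distrib[OF permutes_bij[OF h] permutes_bij[OF g]] permutes_inv_o(2)[OF h]
        by (simp add: comp_assoc)
      then have "\<rho> (inv' (h \<circ> g)) (\<rho> h v) = \<rho> (inv' g) v"
        using \<rho>_comp[OF hg h v] by simp
      then show "\<rho> (h \<circ> g) (\<pi> (\<rho> (inv' (h \<circ> g)) (\<rho> h v))) = \<rho> h (\<rho> g (\<pi> (\<rho> (inv' g) v)))"
        using \<rho>_comp[OF h g] \<pi>U UM by auto
    qed
    also have "\<dots> = \<rho> h (\<Sum>g\<in>G. \<rho> g (\<pi> (\<rho> (inv' g) v)))"
      using \<rho>inM \<pi>U UM by (intro \<rho>_sum[OF h, symmetric]) auto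
    finally show ?thesis
      using \<rho>_scale[OF h] \<rho>inM \<pi>U UM by (simp add: P_def subspace_sum[OF sub_M] subset_iff)
  qed
  have P_0: "P 0 = 0" using P_scale[of 0 0] subspace_0[OF sub_M] by simp
  show thesis
  proof (rule that)
    let ?W = "{v \<in> V. P v = 0}"
    show "invariant ?W"
      unfolding invariant_def
    proof (intro conjI allI impI)
      show "subspace ?W"
        using sub_V VM P_0 P_add P_scale by (auto simp: subspace_def subset_iff)
      show "?W \<subseteq> M" using VM by auto
      show "\<rho> g v \<in> ?W" if "g permutes {1..n}" "v \<in> ?W" for g v
        using that inv_V VM P_equiv \<rho>_zero by auto
    qed
    show "?W \<subseteq> V" by auto
    show "U \<inter> ?W = {0}" using P_id subspace_0[OF sub_U] subspace_0[OF sub_V] by auto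
    show "\<forall>v\<in>V. \<exists>u\<in>U. v - u \<in> ?W"
    proof (intro ballI bexI)
      fix v assume v: "v \<in> V"
      have "P v \<in> V" using P_in \<open>U \<subseteq> V\<close> by blast
      then have 1: "v - P v \<in> V" by (rule subspace_diff[OF sub_V v])
      have "P ((v - P v) + P v) = P (v - P v) + P (P v)"
        using 1 \<open>P v \<in> V\<close> VM by (intro P_add) auto
      then have "P (v - P v) = 0" using P_id[OF P_in] by simp
      then show "v - P v \<in> ?W" using 1 by simp
      show "P v \<in> U" by (rule P_in)
    qed
  qed
qed

text \<open>Induction on the dimension: a nonzero invariant subspace of least dimension is simple
  and has an invariant complement of smaller dimension. Families of components are
  \<open>undefined\<close> outside the index set, which makes uniqueness literal as in
  \<open>direct_decomp\<close>.\<close>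

lemma complete_reducibility:
  assumes "invariant V"
  obtains l :: nat and Ms where "\<forall>j<l. simple (Ms j)" "\<forall>j<l. Ms j \<subseteq> V"
    "\<forall>v\<in>V. \<exists>!u. u \<in> (\<Pi>\<^sub>E j\<in>{..<l}. Ms j) \<and> v = (\<Sum>j<l. u j)"
proof -
  have "\<exists>(l :: nat) Ms. (\<forall>j<l. simple (Ms j)) \<and> (\<forall>j<l. Ms j \<subseteq> V) \<and>
    (\<forall>v\<in>V. \<exists>!u. u \<in> (\<Pi>\<^sub>E j\<in>{..<l}. Ms j) \<and> v = (\<Sum>j<l. u j))"
    using assms
  proof (induction "dim V" arbitrary: V rule: less_induct)
    case less
    have sub_V: "subspace V" and VM: "V \<subseteq> M" using less.prems by (auto simp: invariant_def)
    show ?case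
    proof (cases "V = {0}")
      case True
      then show ?thesis by (intro exI[of _ 0]) simp
    next
      case False
      let ?Q = "\<lambda>U. invariant U \<and> U \<subseteq> V \<and> U \<noteq> {0}"
      have "?Q V" using less.prems False by simp
      from ex_has_least_nat[of ?Q V dim, OF this] obtain U where
        U': "?Q U \<and> (\<forall>U'. ?Q U' \<longrightarrow> dim U \<le> dim U')" ..
      note U = U'[THEN conjunct1] U'[THEN conjunct2, rule_format, OF conjI, OF _ conjI]
      have "simple U"
        unfolding simple_def
      proof (intro conjI allI impI)
        fix U' assume U': "invariant U'" "U' \<subseteq> U"
        show "U' = {0} \<or> U' = U"
        proof (rule ccontr)
          assume neg: "\<not> (U' = {0} \<or> U' = U)"
          then have "dim U' < dim U"
            using U' U(1) by (intro dim_less) (auto simp: invariant_def)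
          moreover have "dim U \<le> dim U'" using U(2) U' U(1) neg by blast
          ultimately show False by simp
        qed
      qed (use U in auto)
      have "invariant U" "U \<subseteq> V" using U(1) by auto
      then obtain W where W: "invariant W" "W \<subseteq> V" "U \<inter> W = {0}" "\<forall>v\<in>V. \<exists>u\<in>U. v - u \<in> W"
        by (rule invariant_complement[OF _ less.prems])
      have sub_U: "subspace U" and sub_W: "subspace W" using U(1) W(1) by (auto simp: invariant_def)
      have "W \<noteq> V" using W(3) U(1) by auto
      then have "dim W < dim V" using W(1,2) VM by (intro dim_less) (auto simp: invariant_def)
      obtain l :: nat and Ms where
        Ms: "\<forall>j<l. simple (Ms j)" "\<forall>j<l. Ms j \<subseteq> W"
        "\<forall>v\<in>W. \<exists>!u. u \<in> (\<Pi>\<^sub>E j\<in>{..<l}. Ms j) \<and> v = (\<Sum>j<l. u j)"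
        using less.hyps[OF \<open>dim W < dim V\<close> W(1)] by (elim exE conjE)
      define Ns where "Ns = Ms(l := U)"
      have Ns: "Ns l = U" "\<And>j. j < l \<Longrightarrow> Ns j = Ms j" by (auto simp: Ns_def)
      have "\<exists>!u. u \<in> (\<Pi>\<^sub>E j\<in>{..<Suc l}. Ns j) \<and> v = (\<Sum>j<Suc l. u j)" if v: "v \<in> V" for v
      proof -
        obtain x where x: "x \<in> U" "v - x \<in> W" using W(4) v by blast
        from Ms(3)[rule_format, OF x(2)] obtain f where
          f: "f \<in> (\<Pi>\<^sub>E j\<in>{..<l}. Ms j)" "v - x = (\<Sum>j<l. f j)"
          and f_unique': "\<forall>f'. f' \<in> (\<Pi>\<^sub>E j\<in>{..<l}. Ms j) \<and> v - x = (\<Sum>j<l. f' j) \<longrightarrow> f' = f"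
          by (elim ex1E conjE)
        note f_unique = f_unique'[rule_format, OF conjI]
        show ?thesis
        proof (rule ex1I[of _ "f(l := x)"])
          have "(\<Sum>j<l. (f(l := x)) j) = (\<Sum>j<l. f j)" by (intro sum.cong) auto
          then show "f(l := x) \<in> (\<Pi>\<^sub>E j\<in>{..<Suc l}. Ns j) \<and> v = (\<Sum>j<Suc l. (f(l := x)) j)"
            using f x(1) Ns by (auto simp: PiE_iff extensional_def less_Suc_eq algebra_simps)
          fix g assume g: "g \<in> (\<Pi>\<^sub>E j\<in>{..<Suc l}. Ns j) \<and> v = (\<Sum>j<Suc l. g j)"
          then have gN: "g j \<in> Ns j" if "j < Suc l" for j using that by (auto simp: PiE_iff)
          have gj: "g j \<in> Ms j" if "j < l" for j using gN[of j] Ns(2)[OF that] that by simp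
          have gl: "g l \<in> U" using gN[of l] Ns(1) by simp
          let ?s = "\<Sum>j<l. g j"
          have s: "?s \<in> W" using gj Ms(2) by (intro subspace_sum[OF sub_W]) auto
          have eq: "v = ?s + g l" using g by simp
          \<comment> \<open>The two candidates for the component in \<open>U\<close> differ by an
            element of \<open>W\<close>, so they agree.\<close>
          have "x - g l = ?s - (v - x)" unfolding eq by simp
          moreover have "x - g l \<in> U" using x(1) gl by (rule subspace_diff[OF sub_U])
          moreover have "?s - (v - x) \<in> W" using s x(2) by (rule subspace_diff[OF sub_W])
          ultimately have "x - g l \<in> U \<inter> W" by (simp only: Int_iff)
          then have xg: "g l = x" using W(3) by simp
          have "restrict g {..<l} = f"
          proof (rule f_unique)
            show "restrict g {..<l} \<in> (\<Pi>\<^sub>E j\<in>{..<l}. Ms j)" using gj by auto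
            show "v - x = (\<Sum>j<l. restrict g {..<l} j)" using eq xg by simp
          qed
          moreover have "g j = undefined" if "\<not> j < Suc l" for j
            using g that by (auto simp: PiE_iff extensional_def)
          moreover have "f j = undefined" if "\<not> j < l" for j
            using f(1) that by (auto simp: PiE_iff extensional_def)
          ultimately have *: "restrict g {..<l} = f" "\<And>j. \<not> j < Suc l \<Longrightarrow> g j = undefined"
            "\<And>j. \<not> j < l \<Longrightarrow> f j = undefined" by blast+
          show "g = f(l := x)"
          proof
            fix j
            consider "j < l" | "j = l" | "\<not> j < Suc l" by linarith
            then show "g j = (f(l := x)) j"
            proof cases
              case 1
              then show ?thesis using fun_cong[OF *(1), of j] by simp
            qed (use xg * in auto)
          qed
        qed
      qed
      moreover have "simple (Ns j) \<and> Ns j \<subseteq> V" if "j < Suc l" for j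
      proof (cases "j = l")
        case False
        then have "j < l" using that by simp
        then show ?thesis using Ms(1,2) W(2) by (auto simp: Ns(2))
      qed (simp add: Ns(1) \<open>simple U\<close> \<open>U \<subseteq> V\<close>)
      ultimately show ?thesis by (intro exI[of _ "Suc l"] exI[of _ Ns]) simp
    qed
  qed
  then show thesis using that by (elim exE conjE)
qed

end

section \<open>Transport to representations given by records\<close>

text \<open>The map \<open>f\<close> gives linear coordinates in a vector space on a type. Of the
  vector space structure of \<open>W\<close> only closure and compatibility with \<open>f\<close>
  are assumed; the module axioms follow from injectivity.\<close>

locale coord_rep =
  fixes scale :: "complex \<Rightarrow> 'b :: ab_group_add \<Rightarrow> 'b" and n :: nat and W :: "'v rep"
    and f :: "'v \<Rightarrow> 'b" and F :: "'b set"
  assumes vs: "vector_space scale"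
    and zero_in: "\<zero>\<^bsub>W\<^esub> \<in> carrier W"
    and add_in: "x \<in> carrier W \<Longrightarrow> y \<in> carrier W \<Longrightarrow> x \<oplus>\<^bsub>W\<^esub> y \<in> carrier W"
    and smult_in: "x \<in> carrier W \<Longrightarrow> c \<odot>\<^bsub>W\<^esub> x \<in> carrier W"
    and act_in: "g permutes {1..n} \<Longrightarrow> x \<in> carrier W \<Longrightarrow> act W g x \<in> carrier W"
    and f_inj: "inj_on f (carrier W)"
    and f_zero: "f \<zero>\<^bsub>W\<^esub> = 0"
    and f_add: "x \<in> carrier W \<Longrightarrow> y \<in> carrier W \<Longrightarrow> f (x \<oplus>\<^bsub>W\<^esub> y) = f x + f y"
    and f_smult: "x \<in> carrier W \<Longrightarrow> f (c \<odot>\<^bsub>W\<^esub> x) = scale c (f x)"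
    and act_add: "g permutes {1..n} \<Longrightarrow> x \<in> carrier W \<Longrightarrow> y \<in> carrier W \<Longrightarrow>
      act W g (x \<oplus>\<^bsub>W\<^esub> y) = act W g x \<oplus>\<^bsub>W\<^esub> act W g y"
    and act_smult: "g permutes {1..n} \<Longrightarrow> x \<in> carrier W \<Longrightarrow> act W g (c \<odot>\<^bsub>W\<^esub> x) = c \<odot>\<^bsub>W\<^esub> act W g x"
    and act_id: "x \<in> carrier W \<Longrightarrow> act W id x = x"
    and act_comp: "g permutes {1..n} \<Longrightarrow> h permutes {1..n} \<Longrightarrow> x \<in> carrier W \<Longrightarrow>
      act W (g \<circ> h) x = act W g (act W h x)"
    and fin_F: "finite F" and f_span: "f ` carrier W \<subseteq> Modules.module.span scale F"
begin

interpretation V: vector_space scale by (rule vs)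

lemma f_eqD: "f x = f y \<Longrightarrow> x \<in> carrier W \<Longrightarrow> y \<in> carrier W \<Longrightarrow> x = y"
  using f_inj by (auto simp: inj_on_def)

lemma vectorspace_sub:
  assumes "U \<subseteq> carrier W" "\<zero>\<^bsub>W\<^esub> \<in> U" "\<And>x y. x \<in> U \<Longrightarrow> y \<in> U \<Longrightarrow> x \<oplus>\<^bsub>W\<^esub> y \<in> U"
    and "\<And>c x. x \<in> U \<Longrightarrow> c \<odot>\<^bsub>W\<^esub> x \<in> U"
  shows "vectorspace class_ring (W\<lparr>carrier := U\<rparr>)"
proof -
  have in_W: "x \<in> U \<Longrightarrow> x \<in> carrier W" for x using assms(1) by blast
  note cl = in_W add_in smult_in assms(2-4)
  have "abelian_group (W\<lparr>carrier := U\<rparr>)"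
  proof (rule abelian_groupI)
    fix x assume x: "x \<in> carrier (W\<lparr>carrier := U\<rparr>)"
    have "(- 1) \<odot>\<^bsub>W\<^esub> x \<oplus>\<^bsub>W\<^esub> x = \<zero>\<^bsub>W\<^esub>"
      using x by (intro f_eqD) (simp_all add: cl f_add f_smult f_zero V.scale_minus_left)
    then show "\<exists>y\<in>carrier (W\<lparr>carrier := U\<rparr>). y \<oplus>\<^bsub>W\<lparr>carrier := U\<rparr>\<^esub> x = \<zero>\<^bsub>W\<lparr>carrier := U\<rparr>\<^esub>"
      using x assms(4) by auto
  qed (auto simp: cl f_add f_zero intro!: f_eqD simp: algebra_simps)
  moreover have "cring (class_ring :: complex ring)" by (rule class_cring.is_cring)
  ultimately have "Module.module class_ring (W\<lparr>carrier := U\<rparr>)"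
    by (intro moduleI) (auto simp: cl f_add f_smult V.scale_left_distrib V.scale_right_distrib intro!: f_eqD)
  then show ?thesis by (simp add: vectorspace_def class_field.field_axioms)
qed

lemma vectorspace_W: "vectorspace class_ring W"
  using vectorspace_sub[of "carrier W"] zero_in add_in smult_in by simp

lemma is_rep_sub:
  assumes "U \<subseteq> carrier W" "\<zero>\<^bsub>W\<^esub> \<in> U" "\<And>x y. x \<in> U \<Longrightarrow> y \<in> U \<Longrightarrow> x \<oplus>\<^bsub>W\<^esub> y \<in> U"
    and "\<And>c x. x \<in> U \<Longrightarrow> c \<odot>\<^bsub>W\<^esub> x \<in> U" and "\<And>g x. g permutes {1..n} \<Longrightarrow> x \<in> U \<Longrightarrow> act W g x \<in> U"
  shows "is_rep n (W\<lparr>carrier := U\<rparr>)"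
proof -
  have "vectorspace class_ring (W\<lparr>carrier := U\<rparr>)" by (rule vectorspace_sub[OF assms(1-4)])
  moreover have in_W: "x \<in> U \<Longrightarrow> x \<in> carrier W" for x using assms(1) by blast
  ultimately show ?thesis
    unfolding is_rep_def module_hom_def
    using assms(5) act_add act_smult act_id act_comp by (auto simp: sym_group_carrier)
qed

text \<open>Stated relative to a carrier \<open>V\<close>, so that it covers the subrepresentations
  of \<open>W\<close> as well as those of a summand, which irreducibility is about.\<close>

lemma subrep_iff:
  assumes "\<zero>\<^bsub>W\<^esub> \<in> V" "V \<subseteq> carrier W" "\<And>x y. x \<in> V \<Longrightarrow> y \<in> V \<Longrightarrow> x \<oplus>\<^bsub>W\<^esub> y \<in> V"
    and "\<And>c x. x \<in> V \<Longrightarrow> c \<odot>\<^bsub>W\<^esub> x \<in> V"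
  shows "subrep n U (W\<lparr>carrier := V\<rparr>) \<longleftrightarrow> U \<subseteq> V \<and> \<zero>\<^bsub>W\<^esub> \<in> U \<and>
    (\<forall>x\<in>U. \<forall>y\<in>U. x \<oplus>\<^bsub>W\<^esub> y \<in> U) \<and> (\<forall>c. \<forall>x\<in>U. c \<odot>\<^bsub>W\<^esub> x \<in> U) \<and>
    (\<forall>g x. g permutes {1..n} \<longrightarrow> x \<in> U \<longrightarrow> act W g x \<in> U)"
proof -
  have vs: "vectorspace class_ring (W\<lparr>carrier := V\<rparr>)" by (rule vectorspace_sub[OF assms(2,1,3,4)])
  then have "Module.module class_ring (W\<lparr>carrier := V\<rparr>)" by (simp add: vectorspace_def)
  moreover have "(\<forall>g\<in>carrier (sym_group n). act W g ` U \<subseteq> U) \<longleftrightarrow>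
      (\<forall>g x. g permutes {1..n} \<longrightarrow> x \<in> U \<longrightarrow> act W g x \<in> U)"
    by (simp add: Ball_def sym_group_carrier image_subset_iff)
  ultimately show ?thesis
    using vs unfolding subrep_def VectorSpace.subspace_def submodule_def by auto
qed

lemma f_finsum:
  assumes "finite I" "\<And>i. i \<in> I \<Longrightarrow> u i \<in> carrier W"
  shows "f (\<Oplus>\<^bsub>W\<^esub>i\<in>I. u i) = (\<Sum>i\<in>I. f (u i))"
proof -
  interpret vectorspace class_ring W by (rule vectorspace_W)
  show ?thesis
    using assms
  proof (induction I)
    case (insert i I)
    then have "(\<Oplus>\<^bsub>W\<^esub>i\<in>insert i I. u i) = u i \<oplus>\<^bsub>W\<^esub> (\<Oplus>\<^bsub>W\<^esub>i\<in>I. u i)"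
      by (intro finsum_insert) auto
    with insert show ?case by (simp add: f_add finsum_closed Pi_def)
  qed (simp add: f_zero)
qed

definition \<rho> :: "(nat \<Rightarrow> nat) \<Rightarrow> 'b \<Rightarrow> 'b" where
  "\<rho> g v = f (act W g (the_inv_into (carrier W) f v))"

lemma \<rho>_f: "x \<in> carrier W \<Longrightarrow> \<rho> g (f x) = f (act W g x)"
  by (simp add: \<rho>_def the_inv_into_f_f f_inj)

lemma perm_rep_image: "perm_rep scale n \<rho> (f ` carrier W) F"
proof (unfold_locales)
  show "V.subspace (f ` carrier W)"
    unfolding V.subspace_def
  proof (intro conjI ballI allI)
    show "0 \<in> f ` carrier W" using zero_in f_zero by (metis imageI)
    show "x + y \<in> f ` carrier W" if "x \<in> f ` carrier W" "y \<in> f ` carrier W" for x y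
      using that add_in f_add by (metis (no_types, lifting) imageE imageI)
    show "scale c x \<in> f ` carrier W" if "x \<in> f ` carrier W" for c x
      using that smult_in f_smult by (metis (no_types, lifting) imageE imageI)
  qed
qed (use fin_F f_span in \<open>auto simp: \<rho>_f act_in act_add act_smult act_id act_comp f_add[symmetric]
      f_smult[symmetric] add_in smult_in\<close>)

text \<open>The image of \<open>f\<close> is decomposed and preimages are taken; injectivity turns
  simplicity of \<open>Ms j\<close> into irreducibility of \<open>U j\<close> and preserves the
  uniqueness of sums.\<close>

lemma irreducible_decomposition:
  obtains l U where "\<forall>j<l. subrep n (U j) W \<and> irreducible_rep n (W\<lparr>carrier := U j\<rparr>)"
    "direct_decomp W l U"
proof -
  interpret P: perm_rep scale n \<rho> "f ` carrier W" F by (rule perm_rep_image)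
  have "P.invariant (f ` carrier W)" unfolding P.invariant_def using P.sub_M P.\<rho>_in by auto
  then obtain l :: nat and Ms where Ms: "\<forall>j<l. P.simple (Ms j)" "\<forall>j<l. Ms j \<subseteq> f ` carrier W"
    "\<forall>v\<in>f ` carrier W. \<exists>!u. u \<in> (\<Pi>\<^sub>E j\<in>{..<l}. Ms j) \<and> v = (\<Sum>j<l. u j)"
    by (rule P.complete_reducibility)
  define U where "U j = {x \<in> carrier W. f x \<in> Ms j}" for j
  have U: "U j \<subseteq> carrier W" "\<zero>\<^bsub>W\<^esub> \<in> U j"
    "\<And>x y. x \<in> U j \<Longrightarrow> y \<in> U j \<Longrightarrow> x \<oplus>\<^bsub>W\<^esub> y \<in> U j"
    "\<And>c x. x \<in> U j \<Longrightarrow> c \<odot>\<^bsub>W\<^esub> x \<in> U j"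
    "\<And>g x. g permutes {1..n} \<Longrightarrow> x \<in> U j \<Longrightarrow> act W g x \<in> U j" if "j < l" for j
  proof -
    have inv: "P.invariant (Ms j)" using Ms(1) that by (auto simp: P.simple_def)
    then have sub: "V.subspace (Ms j)" by (simp add: P.invariant_def)
    show "U j \<subseteq> carrier W" by (auto simp: U_def)
    show "\<zero>\<^bsub>W\<^esub> \<in> U j" using zero_in f_zero V.subspace_0[OF sub] by (simp add: U_def)
    show "x \<oplus>\<^bsub>W\<^esub> y \<in> U j" if "x \<in> U j" "y \<in> U j" for x y
      using that V.subspace_add[OF sub] by (auto simp: U_def add_in f_add)
    show "c \<odot>\<^bsub>W\<^esub> x \<in> U j" if "x \<in> U j" for c x
      using that V.subspace_scale[OF sub] by (auto simp: U_def smult_in f_smult)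
    show "act W g x \<in> U j" if "g permutes {1..n}" "x \<in> U j" for g x
      using that inv by (auto simp: U_def act_in P.invariant_def \<rho>_f[symmetric])
  qed
  have fU: "f ` U j = Ms j" if "j < l" for j
    using Ms(2) that by (auto simp: U_def)
  have irred: "subrep n (U j) W \<and> irreducible_rep n (W\<lparr>carrier := U j\<rparr>)" if j: "j < l" for j
  proof
    have "subrep n (U j) (W\<lparr>carrier := carrier W\<rparr>)"
      by (subst subrep_iff) (use zero_in add_in smult_in U[OF j] in auto)
    then show "subrep n (U j) W" by simp
    have simple: "P.simple (Ms j)" using Ms(1) j by blast
    have "V' = {\<zero>\<^bsub>W\<^esub>} \<or> V' = U j" if V': "subrep n V' (W\<lparr>carrier := U j\<rparr>)" for V'
    proof -
      have sub: "V' \<subseteq> U j" "\<zero>\<^bsub>W\<^esub> \<in> V'" "\<And>x y. x \<in> V' \<Longrightarrow> y \<in> V' \<Longrightarrow> x \<oplus>\<^bsub>W\<^esub> y \<in> V'"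
        "\<And>c x. x \<in> V' \<Longrightarrow> c \<odot>\<^bsub>W\<^esub> x \<in> V'"
        "\<And>g x. g permutes {1..n} \<Longrightarrow> x \<in> V' \<Longrightarrow> act W g x \<in> V'"
        using V' subrep_iff[OF U(2,1,3,4)[OF j]] by auto
      have V'W: "V' \<subseteq> carrier W" using sub(1) U(1)[OF j] by blast
      have "P.invariant (f ` V')"
        unfolding P.invariant_def V.subspace_def
      proof (intro conjI ballI allI impI)
        show "0 \<in> f ` V'" using sub(2) f_zero by (metis imageI)
        show "f ` V' \<subseteq> f ` carrier W" using V'W by blast
        fix x assume "x \<in> f ` V'"
        then obtain x' where x': "x = f x'" "x' \<in> V'" "x' \<in> carrier W" using V'W by blast
        show "scale c x \<in> f ` V'" for c using sub(4)[OF x'(2), of c] f_smult[OF x'(3)] x'(1) by (metis imageI)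
        show "\<rho> g x \<in> f ` V'" if "g permutes {1..n}" for g
          using sub(5)[OF that x'(2)] \<rho>_f[OF x'(3)] x'(1) by simp
        fix y assume "y \<in> f ` V'"
        then obtain y' where y': "y = f y'" "y' \<in> V'" "y' \<in> carrier W" using V'W by blast
        show "x + y \<in> f ` V'" using sub(3)[OF x'(2) y'(2)] f_add[OF x'(3) y'(3)] x'(1) y'(1) by (metis imageI)
      qed
      moreover have "f ` V' \<subseteq> Ms j" using sub(1) fU[OF j] by blast
      ultimately have "f ` V' = {0} \<or> f ` V' = Ms j" using simple by (simp add: P.simple_def)
      then have "f ` V' = f ` {\<zero>\<^bsub>W\<^esub>} \<or> f ` V' = f ` U j" using f_zero fU[OF j] by simp
      then show ?thesis
        using inj_on_image_eq_iff[OF f_inj V'W] zero_in U(1)[OF j] by blast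
    qed
    moreover have "U j \<noteq> {\<zero>\<^bsub>W\<^esub>}"
      using simple fU[OF j] f_zero by (auto simp: P.simple_def)
    moreover have "is_rep n (W\<lparr>carrier := U j\<rparr>)" by (rule is_rep_sub[OF U[OF j]])
    ultimately show "irreducible_rep n (W\<lparr>carrier := U j\<rparr>)"
      unfolding irreducible_rep_def by simp
  qed
  have "direct_decomp W l U"
    unfolding direct_decomp_def
  proof (intro conjI allI impI ballI)
    show "U j \<subseteq> carrier W" if "j < l" for j using U(1)[OF that] .
    fix x assume x: "x \<in> carrier W"
    from Ms(3)[rule_format, OF imageI[OF x]] obtain v where v: "v \<in> (\<Pi>\<^sub>E j\<in>{..<l}. Ms j)" "f x = (\<Sum>j<l. v j)"
      and v_unique: "\<forall>v'. v' \<in> (\<Pi>\<^sub>E j\<in>{..<l}. Ms j) \<and> f x = (\<Sum>j<l. v' j) \<longrightarrow> v' = v"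
      by (elim ex1E conjE)
    have "\<forall>j\<in>{..<l}. \<exists>y. y \<in> U j \<and> f y = v j"
    proof
      fix j assume "j \<in> {..<l}"
      then have "v j \<in> f ` U j" using v(1) fU by (auto simp: PiE_iff)
      then show "\<exists>y. y \<in> U j \<and> f y = v j" by auto
    qed
    from bchoice[OF this] obtain u where u: "\<forall>j\<in>{..<l}. u j \<in> U j \<and> f (u j) = v j" ..
    have f_sum: "f (\<Oplus>\<^bsub>W\<^esub>j\<in>{..<l}. u' j) = (\<Sum>j<l. f (u' j))" and sum_in: "(\<Oplus>\<^bsub>W\<^esub>j\<in>{..<l}. u' j) \<in> carrier W"
      if "\<forall>j\<in>{..<l}. u' j \<in> U j" for u'
    proof -
      have u': "u' j \<in> carrier W" if "j \<in> {..<l}" for j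
        using \<open>\<forall>j\<in>{..<l}. u' j \<in> U j\<close> that U(1) by auto
      then show "f (\<Oplus>\<^bsub>W\<^esub>j\<in>{..<l}. u' j) = (\<Sum>j<l. f (u' j))" by (intro f_finsum) auto
      interpret vectorspace class_ring W by (rule vectorspace_W)
      show "(\<Oplus>\<^bsub>W\<^esub>j\<in>{..<l}. u' j) \<in> carrier W" using u' by (intro finsum_closed) auto
    qed
    let ?u = "restrict u {..<l}"
    have u': "\<forall>j\<in>{..<l}. ?u j \<in> U j" using u by simp
    show "\<exists>!u. u \<in> (\<Pi>\<^sub>E j\<in>{..<l}. U j) \<and> x = (\<Oplus>\<^bsub>W\<^esub>j\<in>{..<l}. u j)"
    proof (rule ex1I[of _ ?u])
      have "f (\<Oplus>\<^bsub>W\<^esub>j\<in>{..<l}. ?u j) = f x" unfolding f_sum[OF u'] v(2) using u by simp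
      then have "x = (\<Oplus>\<^bsub>W\<^esub>j\<in>{..<l}. ?u j)" using f_eqD sum_in[OF u'] x by metis
      then show "?u \<in> (\<Pi>\<^sub>E j\<in>{..<l}. U j) \<and> x = (\<Oplus>\<^bsub>W\<^esub>j\<in>{..<l}. ?u j)" using u by auto
      fix w assume w: "w \<in> (\<Pi>\<^sub>E j\<in>{..<l}. U j) \<and> x = (\<Oplus>\<^bsub>W\<^esub>j\<in>{..<l}. w j)"
      then have w': "\<forall>j\<in>{..<l}. w j \<in> U j" by (auto simp: PiE_iff)
      have "f x = (\<Sum>j<l. restrict (f \<circ> w) {..<l} j)" using f_sum[OF w'] w by simp
      moreover have "restrict (f \<circ> w) {..<l} \<in> (\<Pi>\<^sub>E j\<in>{..<l}. Ms j)"
        using w' by (auto simp: U_def)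
      ultimately have fw: "restrict (f \<circ> w) {..<l} = v" using v_unique by blast
      show "w = ?u"
      proof (rule extensionalityI[where A = "{..<l}"])
        show "w \<in> extensional {..<l}" using w by (auto simp: PiE_iff)
        fix j assume j: "j \<in> {..<l}"
        then have "f (w j) = f (u j)" using fun_cong[OF fw, of j] u by simp
        moreover have "w j \<in> carrier W" "u j \<in> carrier W" using j w' u U(1) by auto
        ultimately show "w j = ?u j" using f_eqD j by simp
      qed simp
    qed
  qed
  with irred show thesis by (intro that[of l U]) blast+
qed

end

section \<open>A sign vector in the Specht module\<close>

text \<open>A label is the total length of the preceding rows plus its column. By minimality in
  \<open>row_of\<close> this length is at most \<open>m\<close>, so the subtraction in
  \<open>col_of\<close> is not truncated.\<close>

lemma row_col_determine:
  assumes "row_of \<mu> m = row_of \<mu> m'" "col_of \<mu> m = col_of \<mu> m'"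
  shows "m = m'"
proof -
  have le: "sum_list (take (row_of \<mu> m) \<mu>) \<le> m" for m
  proof (cases "row_of \<mu> m")
    case (Suc i)
    then have "\<not> m \<le> sum_list (take (Suc i) \<mu>)"
      unfolding row_of_def by (intro not_less_Least) simp
    then show ?thesis using Suc by simp
  qed simp
  show ?thesis using assms le[of m] le[of m'] by (simp add: col_of_def)
qed

lemma row_col_group_trivial: "g \<in> row_group n \<mu> \<Longrightarrow> g \<in> col_group n \<mu> \<Longrightarrow> g = id"
proof
  fix m assume g: "g \<in> row_group n \<mu>" "g \<in> col_group n \<mu>"
  show "g m = id m"
  proof (cases "m \<in> {1..n}")
    case True
    then have "row_of \<mu> (g m) = row_of \<mu> m" "col_of \<mu> (g m) = col_of \<mu> m"
      using g unfolding row_group_def col_group_def by blast+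
    then show ?thesis using row_col_determine by simp
  next
    case False
    then show ?thesis using g by (auto simp: row_group_def sym_group_carrier permutes_def)
  qed
qed

lemma id_in_groups: "id \<in> row_group n \<mu>" "id \<in> col_group n \<mu>"
  by (auto simp: row_group_def col_group_def sym_group_carrier permutes_id)

lemma col_group_permutes: "g \<in> col_group n \<mu> \<Longrightarrow> g permutes {1..n}"
  by (simp add: col_group_def sym_group_carrier)

lemma col_group_comp:
  assumes "g \<in> col_group n \<mu>" "h \<in> col_group n \<mu>"
  shows "g \<circ> h \<in> col_group n \<mu>"
proof -
  note g = col_group_permutes[OF assms(1)] and h = col_group_permutes[OF assms(2)]
  have "col_of \<mu> (g (h m)) = col_of \<mu> m" if "m \<in> {1..n}" for m
    using that assms permutes_in_image[OF h, of m] by (simp add: col_group_def)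
  then show ?thesis using permutes_compose[OF h g] by (simp add: col_group_def sym_group_carrier)
qed

lemma col_group_inv:
  assumes "g \<in> col_group n \<mu>"
  shows "inv' g \<in> col_group n \<mu>"
proof -
  have g: "g permutes {1..n}" using assms by (rule col_group_permutes)
  have "col_of \<mu> (inv' g m) = col_of \<mu> m" if "m \<in> {1..n}" for m
  proof -
    have "inv' g m \<in> {1..n}" using permutes_in_image[OF permutes_inv[OF g]] that by blast
    then have "col_of \<mu> (g (inv' g m)) = col_of \<mu> (inv' g m)" using assms by (simp add: col_group_def)
    then show ?thesis using permutes_inverses(1)[OF g] by simp
  qed
  then show ?thesis using permutes_inv[OF g] by (simp add: col_group_def sym_group_carrier)
qed

lemma sign_mult_self: "(of_int (sign g) :: complex) * of_int (sign g) = 1"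
  by (simp add: sign_def)

lemma sum_permutes_pair:
  fixes F :: "(nat \<Rightarrow> nat) \<Rightarrow> complex"
  assumes t: "t permutes {1..n}" and s: "s permutes {1..n}"
  shows "(\<Sum>u\<in>carrier (sym_group n). if t \<circ> u = s then F u else 0) = F (inv' t \<circ> s)"
proof -
  have "t \<circ> u = s \<longleftrightarrow> u = inv' t \<circ> s" for u
    using permutes_inv_o[OF t] by (metis comp_assoc id_o)
  moreover have "inv' t \<circ> s permutes {1..n}" by (rule permutes_compose[OF s permutes_inv[OF t]])
  moreover have "finite (carrier (sym_group n))" by (simp add: sym_group_def finite_permutations)
  ultimately show ?thesis by (simp add: sym_group_carrier sum.delta)
qed

lemma convolution_apply:
  assumes "s permutes {1..n}"
  shows "convolution n x y s = (\<Sum>t\<in>carrier (sym_group n). x t * y (inv' t \<circ> s))"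
  unfolding convolution_def
proof (rule sum.cong[OF refl])
  fix t assume "t \<in> carrier (sym_group n)"
  then show "(\<Sum>u\<in>carrier (sym_group n). if t \<circ> u = s then x t * y u else 0) = x t * y (inv' t \<circ> s)"
    using sum_permutes_pair[of t n s "\<lambda>u. x t * y u"] assms by (simp add: sym_group_carrier)
qed

lemma convolution_outside:
  assumes "\<not> s permutes {1..n}"
  shows "convolution n x y s = 0"
  unfolding convolution_def
proof (intro sum.neutral ballI)
  fix t u assume "t \<in> carrier (sym_group n)" "u \<in> carrier (sym_group n)"
  then have "t \<circ> u \<noteq> s" using assms permutes_compose by (metis sym_group_carrier)
  then show "(if t \<circ> u = s then x t * y u else 0) = 0" by simp
qed

definition col_sum :: "nat \<Rightarrow> nat list \<Rightarrow> (nat \<Rightarrow> nat) \<Rightarrow> complex" where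
  "col_sum n \<mu> s = (if s \<in> col_group n \<mu> then of_int (sign s) else 0)"

text \<open>The product b a b, with a the row sum and b the signed column sum. The right factor a b
  places it in the Specht module, and the left factor b makes the column group act by the
  sign.\<close>

definition sign_vector :: "nat \<Rightarrow> nat list \<Rightarrow> (nat \<Rightarrow> nat) \<Rightarrow> complex" where
  "sign_vector n \<mu> = convolution n (col_sum n \<mu>) (young_symmetrizer n \<mu>)"

lemma sign_vector_in_specht: "sign_vector n \<mu> \<in> carrier (specht n \<mu>)"
proof -
  have "col_sum n \<mu> \<in> carrier (group_algebra n)"
    by (auto simp: group_algebra_def col_sum_def col_group_def)
  then show ?thesis unfolding specht_def sign_vector_def by (auto simp: group_algebra_def)
qed

text \<open>Row and column group meet only in the identity, so an element of the column group has
  just one factorisation into a row and a column element, with trivial row part.\<close>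

lemma young_symmetrizer_inverse_col:
  assumes "t \<in> col_group n \<mu>"
  shows "young_symmetrizer n \<mu> (inv' t) = of_int (sign t)"
proof -
  let ?a = "\<lambda>s. if s \<in> row_group n \<mu> then 1 else (0 :: complex)"
  have t: "t permutes {1..n}" using assms by (rule col_group_permutes)
  have fin: "finite (carrier (sym_group n))" by (simp add: sym_group_def finite_permutations)
  have "young_symmetrizer n \<mu> (inv' t) = convolution n ?a (col_sum n \<mu>) (inv' t)"
    by (simp add: young_symmetrizer_def group_algebra_def col_sum_def[abs_def])
  also have "\<dots> = (\<Sum>r\<in>carrier (sym_group n). ?a r * col_sum n \<mu> (inv' r \<circ> inv' t))"
    by (rule convolution_apply[OF permutes_inv[OF t]])
  also have "\<dots> = (\<Sum>r\<in>carrier (sym_group n). if r = id then of_int (sign t) else 0)"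
  proof (rule sum.cong[OF refl])
    fix r assume r: "r \<in> carrier (sym_group n)"
    show "?a r * col_sum n \<mu> (inv' r \<circ> inv' t) = (if r = id then of_int (sign t) else 0)"
    proof (cases "r = id")
      case True
      have "sign (inv' t) = sign t" using t by (intro sign_inverse permutation_permutes[THEN iffD2]) auto
      then show ?thesis using True id_in_groups col_group_inv[OF assms] by (simp add: col_sum_def)
    next
      case False
      have "inv' r \<circ> inv' t \<notin> col_group n \<mu>" if "r \<in> row_group n \<mu>"
      proof
        assume "inv' r \<circ> inv' t \<in> col_group n \<mu>"
        from col_group_comp[OF this assms] have "inv' r \<in> col_group n \<mu>"
          using permutes_inv_o(2)[OF t] by (simp add: comp_assoc)
        from col_group_inv[OF this] have "r \<in> col_group n \<mu>"
          using permutes_inv_inv[OF r[unfolded sym_group_carrier]] by simp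
        with that False row_col_group_trivial show False by blast
      qed
      then show ?thesis using False by (simp add: col_sum_def)
    qed
  qed
  also have "\<dots> = of_int (sign t)" using fin by (simp add: sum.delta sym_group_carrier permutes_id)
  finally show ?thesis .
qed

text \<open>The coefficient at the identity is the order of the column group: each \<open>t\<close>
  contributes its sign twice, once from the column sum and once from the Young symmetrizer at the
  inverse of \<open>t\<close>.\<close>

lemma sign_vector_nonzero: "sign_vector n \<mu> id \<noteq> 0"
proof -
  have fin: "finite (carrier (sym_group n))" by (simp add: sym_group_def finite_permutations)
  have "sign_vector n \<mu> id = (\<Sum>t\<in>carrier (sym_group n). col_sum n \<mu> t * young_symmetrizer n \<mu> (inv' t))"
    unfolding sign_vector_def by (simp add: convolution_apply permutes_id)
  also have "\<dots> = (\<Sum>t\<in>carrier (sym_group n). if t \<in> col_group n \<mu> then 1 else 0)"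
    by (intro sum.cong refl) (simp add: col_sum_def young_symmetrizer_inverse_col sign_mult_self)
  also have "\<dots> = of_nat (card {t \<in> carrier (sym_group n). t \<in> col_group n \<mu>})"
    using fin by (simp add: sum.If_cases Int_def)
  finally have "sign_vector n \<mu> id = of_nat (card {t \<in> carrier (sym_group n). t \<in> col_group n \<mu>})" .
  moreover have "id \<in> {t \<in> carrier (sym_group n). t \<in> col_group n \<mu>}"
    by (simp add: id_in_groups sym_group_carrier permutes_id)
  ultimately show ?thesis using fin by auto
qed

text \<open>Left translation by \<open>g\<close> permutes the terms of the leftmost signed column
  sum and changes their signs by \<open>sign g\<close>.\<close>

lemma act_sign_vector:
  assumes g: "g \<in> col_group n \<mu>"
  shows "act (specht n \<mu>) g (sign_vector n \<mu>) = of_int (sign g) \<odot>\<^bsub>specht n \<mu>\<^esub> sign_vector n \<mu>"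
proof
  fix s
  have gp: "g permutes {1..n}" using g by (rule col_group_permutes)
  have fin: "finite (carrier (sym_group n))" by (simp add: sym_group_def finite_permutations)
  have act: "act (specht n \<mu>) g (sign_vector n \<mu>) = convolution n (\<lambda>s. if s = g then 1 else 0) (sign_vector n \<mu>)"
    by (simp add: specht_def group_algebra_def)
  have smult: "(of_int (sign g) \<odot>\<^bsub>specht n \<mu>\<^esub> sign_vector n \<mu>) s = of_int (sign g) * sign_vector n \<mu> s"
    by (simp add: specht_def group_algebra_def)
  show "act (specht n \<mu>) g (sign_vector n \<mu>) s = (of_int (sign g) \<odot>\<^bsub>specht n \<mu>\<^esub> sign_vector n \<mu>) s"
  proof (cases "s permutes {1..n}")
    case False
    then show ?thesis unfolding act smult by (simp add: convolution_outside sign_vector_def)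
  next
    case True
    let ?y = "young_symmetrizer n \<mu>"
    have gs: "inv' g \<circ> s permutes {1..n}" by (rule permutes_compose[OF True permutes_inv[OF gp]])
    have "act (specht n \<mu>) g (sign_vector n \<mu>) s
        = (\<Sum>t\<in>carrier (sym_group n). if t = g then sign_vector n \<mu> (inv' t \<circ> s) else 0)"
      unfolding act convolution_apply[OF True] by (intro sum.cong) auto
    also have "\<dots> = sign_vector n \<mu> (inv' g \<circ> s)" using fin gp by (simp add: sum.delta sym_group_carrier)
    also have "\<dots> = (\<Sum>t | t permutes {1..n}. col_sum n \<mu> t * ?y (inv' t \<circ> (inv' g \<circ> s)))"
      unfolding sign_vector_def convolution_apply[OF gs] by (simp add: sym_group_def)
    also have "\<dots> = (\<Sum>t | t permutes {1..n}. of_int (sign g) * (col_sum n \<mu> (g \<circ> t) * ?y (inv' (g \<circ> t) \<circ> s)))"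
    proof (rule sum.cong[OF refl])
      fix t assume "t \<in> {t. t permutes {1..n}}"
      then have t: "t permutes {1..n}" by simp
      have "inv' (g \<circ> t) = inv' t \<circ> inv' g" by (rule o_inv_distrib[OF permutes_bij[OF gp] permutes_bij[OF t]])
      moreover have "g \<circ> t \<in> col_group n \<mu> \<longleftrightarrow> t \<in> col_group n \<mu>"
      proof
        assume "g \<circ> t \<in> col_group n \<mu>"
        from col_group_comp[OF col_group_inv[OF g] this] show "t \<in> col_group n \<mu>"
          using permutes_inv_o(2)[OF gp] by (simp add: comp_assoc[symmetric])
      qed (rule col_group_comp[OF g])
      moreover have "sign (g \<circ> t) = sign g * sign t"
        using gp t by (intro sign_compose permutation_permutes[THEN iffD2]) auto
      ultimately show "col_sum n \<mu> t * ?y (inv' t \<circ> (inv' g \<circ> s))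
          = of_int (sign g) * (col_sum n \<mu> (g \<circ> t) * ?y (inv' (g \<circ> t) \<circ> s))"
        using sign_mult_self[of g] by (simp add: col_sum_def comp_assoc mult.assoc[symmetric])
    qed
    also have "\<dots> = of_int (sign g) * (\<Sum>t | t permutes {1..n}. col_sum n \<mu> (g \<circ> t) * ?y (inv' (g \<circ> t) \<circ> s))"
      by (simp add: sum_distrib_left)
    also have "(\<Sum>t | t permutes {1..n}. col_sum n \<mu> (g \<circ> t) * ?y (inv' (g \<circ> t) \<circ> s))
        = (\<Sum>t | t permutes {1..n}. col_sum n \<mu> t * ?y (inv' t \<circ> s))"
      by (rule setum_permutations_compose_left[OF gp, symmetric])
    also have "\<dots> = sign_vector n \<mu> s"
      unfolding sign_vector_def convolution_apply[OF True] by (simp add: sym_group_def)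
    finally show ?thesis unfolding smult .
  qed
qed

text \<open>The first box of a row has the label one more than the total length of the preceding
  rows, and positive rows have such a box. Permutations of these labels fix all others, hence
  preserve every column.\<close>

lemma first_column:
  assumes pos: "\<forall>x\<in>set \<mu>. x > 0" and sum: "sum_list \<mu> = n"
  obtains A where "A \<subseteq> {1..n}" "card A = length \<mu>" "\<forall>g. g permutes A \<longrightarrow> g \<in> col_group n \<mu>"
proof -
  let ?s = "\<lambda>j. sum_list (take j \<mu>)"
  have step: "?s j < ?s (Suc j)" if "j < length \<mu>" for j
    using that pos by (simp add: take_Suc_conv_app_nth)
  have mono: "?s i \<le> ?s j" if "i \<le> j" for i j
  proof -
    have "take j \<mu> = take i \<mu> @ drop i (take j \<mu>)"
      using that by (metis append_take_drop_id min.absorb1 take_take)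
    then have "?s j = ?s i + sum_list (drop i (take j \<mu>))" by (metis sum_list_append)
    then show ?thesis by simp
  qed
  have row: "row_of \<mu> (Suc (?s j)) = j" if "j < length \<mu>" for j
    unfolding row_of_def
  proof (rule Least_equality)
    show "Suc (?s j) \<le> ?s (Suc j)" using step[OF that] by simp
    show "j \<le> i" if "Suc (?s j) \<le> ?s (Suc i)" for i
      using that mono[of "Suc i" j] by (meson not_less_eq_eq not_less Suc_le_eq le_trans less_irrefl_nat)
  qed
  have col: "col_of \<mu> (Suc (?s j)) = 1" if "j < length \<mu>" for j
    using row[OF that] by (simp add: col_of_def)
  define A where "A = (\<lambda>j. Suc (?s j)) ` {..<length \<mu>}"
  have A_sub: "A \<subseteq> {1..n}"
  proof
    fix m assume "m \<in> A"
    then obtain j where j: "j < length \<mu>" "m = Suc (?s j)" by (auto simp: A_def)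
    have "?s (Suc j) \<le> n" using mono[of "Suc j" "length \<mu>"] j(1) sum by simp
    then show "m \<in> {1..n}" using step[OF j(1)] j(2) by simp
  qed
  have "inj_on (\<lambda>j. Suc (?s j)) {..<length \<mu>}"
    using row by (metis (no_types, lifting) inj_onI lessThan_iff)
  then have "card A = length \<mu>" by (simp add: A_def card_image)
  moreover have "g \<in> col_group n \<mu>" if g: "g permutes A" for g
  proof -
    have colA: "col_of \<mu> m = 1" if "m \<in> A" for m using that col by (auto simp: A_def)
    have "col_of \<mu> (g m) = col_of \<mu> m" for m
    proof (cases "m \<in> A")
      case True
      then show ?thesis using colA permutes_in_image[OF g] by simp
    next
      case False
      then show ?thesis using g by (simp add: permutes_def)
    qed
    then show ?thesis using permutes_subset[OF g A_sub] by (simp add: col_group_def sym_group_carrier)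
  qed
  ultimately show thesis using A_sub that by blast
qed

section \<open>The cohomology of configuration spaces as a representation\<close>

definition complex_scale :: "complex \<Rightarrow> ('s \<Rightarrow>\<^sub>0 complex) \<Rightarrow> 's \<Rightarrow>\<^sub>0 complex" where
  "complex_scale q f = Poly_Mapping.map ((*) q) f"

lemma lookup_complex_scale [simp]: "Poly_Mapping.lookup (complex_scale q f) s = q * Poly_Mapping.lookup f s"
  by (simp add: complex_scale_def map.rep_eq when_def)

lemma vector_space_complex_scale: "vector_space complex_scale"
  by unfold_locales (auto intro!: poly_mapping_eqI simp: lookup_add algebra_simps)

lemma PConf_eq_PC: "PConf n = PC {1..n}"
proof -
  have "{x :: nat \<Rightarrow> complex. \<forall>i\<in>{1..n}. \<forall>j\<in>{1..n}. i \<noteq> j \<longrightarrow> x i \<noteq> x j} = {x. inj_on x {1..n}}"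
    by (auto simp: inj_on_def)
  then show ?thesis by (simp only: PConf_def PC_def CC_def)
qed

lemma cocycle_add: "\<phi> \<in> cocycles p X \<Longrightarrow> singular_chain p X a \<Longrightarrow> singular_chain p X b \<Longrightarrow> \<phi> (a + b) = \<phi> a + \<phi> b"
  by (simp add: cocycles_iff carrier_cochain_space)

lemma cocycle_shom:
  assumes "\<phi> \<in> cocycles p X" "shom p X a b" "singular_chain p X b"
  shows "\<phi> a = \<phi> b"
proof -
  obtain d where d: "singular_chain (Suc p) X d" "chain_boundary (Suc p) d = a - b"
    using assms(2) by (rule shomE)
  have "\<phi> ((a - b) + b) = \<phi> (a - b) + \<phi> b"
    using singular_chain_boundary_alt[OF d(1)] d(2) assms(3) by (intro cocycle_add[OF assms(1)]) simp_all
  moreover have "\<phi> (a - b) = 0" using assms(1) d by (simp add: cocycles_iff flip: d(2))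
  ultimately show ?thesis by simp
qed

lemma cocycle_sum_cmul:
  assumes "\<phi> \<in> cocycles p X" "\<And>s. s \<in> S \<Longrightarrow> singular_chain p X (f s)"
  shows "\<phi> (\<Sum>s\<in>S. frag_cmul (m s) (f s)) = (\<Sum>s\<in>S. of_int (m s) * \<phi> (f s))"
proof -
  have "\<phi> (\<Sum>s\<in>S. frag_cmul (m s) (f s)) = (\<Sum>s\<in>S. \<phi> (frag_cmul (m s) (f s)))"
    by (rule additive_chain_sum[OF cocycle_add[OF assms(1)]]) (auto intro: singular_chain_cmul assms(2))
  also have "\<dots> = (\<Sum>s\<in>S. of_int (m s) * \<phi> (f s))"
    by (rule sum.cong[OF refl], rule additive_chain_cmul[OF cocycle_add[OF assms(1)]]) (auto intro: assms(2))
  finally show ?thesis .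
qed

lemma coclass_eqI:
  assumes "\<And>c. scycle p X c \<Longrightarrow> \<phi> c = \<psi> c"
  shows "coclass p X \<phi> = coclass p X \<psi>"
  using assms by (auto simp: coclass_def)

text \<open>Evaluation on the generating cycles, written as a finitely supported function on chains
  so that the target is a vector space on a type whatever \<open>S\<close> is.\<close>

definition coords :: "'a chain set \<Rightarrow> ('a chain \<Rightarrow> complex) set \<Rightarrow> 'a chain \<Rightarrow>\<^sub>0 complex" where
  "coords S K = (\<Sum>s\<in>S. Poly_Mapping.single s (coclass_at s K))"

lemma lookup_coords:
  "finite S \<Longrightarrow> Poly_Mapping.lookup (coords S K) c = (if c \<in> S then coclass_at c K else 0)"
  by (simp add: coords_def lookup_sum lookup_single when_def)

abbreviation permute_pullback :: "nat \<Rightarrow> nat \<Rightarrow> (nat \<Rightarrow> nat) \<Rightarrow>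
    ((nat \<Rightarrow> complex) chain \<Rightarrow> complex) \<Rightarrow> (nat \<Rightarrow> complex) chain \<Rightarrow> complex" where
  "permute_pullback i n g \<equiv> cochain_pullback i (PC {1..n}) (permute_conf {1..n} g)"

lemma permute_conf_eta: "(\<lambda>x. \<lambda>j\<in>N. x (g j)) = permute_conf N g"
  by (simp add: permute_conf_def fun_eq_iff)

lemma PConf_cohomology_simps:
  "carrier (PConf_cohomology i n) = coclass i (PC {1..n}) ` cocycles i (PC {1..n})"
  "\<phi> \<in> cocycles i (PC {1..n}) \<Longrightarrow> \<psi> \<in> cocycles i (PC {1..n}) \<Longrightarrow>
    coclass i (PC {1..n}) \<phi> \<oplus>\<^bsub>PConf_cohomology i n\<^esub> coclass i (PC {1..n}) \<psi>
      = coclass i (PC {1..n}) (\<phi> \<oplus>\<^bsub>cochain_space i (PC {1..n})\<^esub> \<psi>)"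
  "\<phi> \<in> cocycles i (PC {1..n}) \<Longrightarrow> z \<odot>\<^bsub>PConf_cohomology i n\<^esub> coclass i (PC {1..n}) \<phi>
      = coclass i (PC {1..n}) (z \<odot>\<^bsub>cochain_space i (PC {1..n})\<^esub> \<phi>)"
  "\<zero>\<^bsub>PConf_cohomology i n\<^esub> = coclass i (PC {1..n}) (\<lambda>c\<in>Collect (singular_chain i (PC {1..n})). 0)"
  "\<phi> \<in> cocycles i (PC {1..n}) \<Longrightarrow> g permutes {1..n} \<Longrightarrow>
    act (PConf_cohomology i n) g (coclass i (PC {1..n}) \<phi>) = coclass i (PC {1..n}) (permute_pullback i n g \<phi>)"
  by (simp_all add: carrier_cohomology PConf_cohomology_def PConf_eq_PC permute_conf_eta module.defs rep.defs
    add_cohomology smult_cohomology zero_cohomology coclass_pullback continuous_permute_PC del: One_nat_def)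

lemma cocycles_zero: "(\<lambda>c\<in>Collect (singular_chain p X). 0) \<in> cocycles p X"
  by (auto simp: cocycles_iff carrier_cochain_space singular_chain_add singular_chain_boundary_alt)

text \<open>Finitely many cycles generate the homology, so evaluating classes on them is injective
  and embeds the cohomology linearly in a finite-dimensional space.\<close>

lemma coord_rep_PConf_cohomology:
  obtains S where "\<forall>s\<in>S. scycle i (PC {1..n}) s"
    "coord_rep complex_scale n (PConf_cohomology i n) (coords S) ((\<lambda>s. Poly_Mapping.single s 1) ` S)"
proof -
  let ?X = "PC {1..n}"
  have "fin_gen_homology i ?X" by (rule fin_gen_PC) simp
  then obtain S where S: "finite S" "\<forall>s\<in>S. scycle i ?X s"
    "\<forall>c. scycle i ?X c \<longrightarrow> (\<exists>n. shom i ?X c (\<Sum>s\<in>S. frag_cmul (n s) s))"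
    by (rule fin_gen_homologyE)
  let ?W = "PConf_cohomology i n"
  note W = PConf_cohomology_simps[where i = i and n = n]
  have pull: "permute_pullback i n g \<phi> \<in> cocycles i ?X" if "\<phi> \<in> cocycles i ?X" "g permutes {1..n}" for g \<phi>
    by (rule cocycles_pullback[OF that(1) continuous_permute_PC[OF that(2)]])
  have lookup: "Poly_Mapping.lookup (coords S (coclass i ?X \<phi>)) c = (if c \<in> S then \<phi> c else 0)"
    if "\<phi> \<in> cocycles i ?X" for \<phi> c
    using that S(2) by (simp add: lookup_coords[OF S(1)] coclass_at_coclass)
  have chain: "singular_chain i ?X c" if "scycle i ?X c" for c using that by (rule scycle_chain)
  have pull_at: "permute_pullback i n g \<phi> c = \<phi> (chain_map i (permute_conf {1..n} g) c)"
    if "singular_chain i ?X c" for g \<phi> c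
    using that by (simp add: cochain_pullback_def)
  have "coord_rep complex_scale n ?W (coords S) ((\<lambda>s. Poly_Mapping.single s 1) ` S)"
  proof (rule coord_rep.intro)
    show "vector_space complex_scale" by (rule vector_space_complex_scale)
    show "\<zero>\<^bsub>?W\<^esub> \<in> carrier ?W" unfolding W(1,4) by (intro imageI cocycles_zero)
    show "inj_on (coords S) (carrier ?W)"
      unfolding W(1)
    proof (rule inj_onI, elim imageE, simp only:)
      fix \<phi> \<psi> assume \<phi>: "\<phi> \<in> cocycles i ?X" and \<psi>: "\<psi> \<in> cocycles i ?X"
        and eq: "coords S (coclass i ?X \<phi>) = coords S (coclass i ?X \<psi>)"
      have on_S: "\<phi> s = \<psi> s" if "s \<in> S" for s
        using lookup[OF \<phi>, of s] lookup[OF \<psi>, of s] eq that by simp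
      show "coclass i ?X \<phi> = coclass i ?X \<psi>"
      proof (rule coclass_eqI)
        fix c assume "scycle i ?X c"
        \<comment> \<open>Every cycle is homologous to an integral combination of the generators,
          and cocycles are additive, so agreement on \<open>S\<close> spreads to all cycles.\<close>
        with S(3) obtain m where m: "shom i ?X c (\<Sum>s\<in>S. frag_cmul (m s) s)" by blast
        have ch: "singular_chain i ?X s" if "s \<in> S" for s using S(2) that chain by blast
        then have "singular_chain i ?X (\<Sum>s\<in>S. frag_cmul (m s) s)"
          by (intro singular_chain_sum singular_chain_cmul)
        then show "\<phi> c = \<psi> c"
          using cocycle_shom[OF \<phi> m] cocycle_shom[OF \<psi> m] on_S
          by (simp add: cocycle_sum_cmul[OF \<phi> ch] cocycle_sum_cmul[OF \<psi> ch])
      qed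
    qed
    show "coords S \<zero>\<^bsub>?W\<^esub> = 0"
      unfolding W(4) using S(2) chain by (intro poly_mapping_eqI) (simp add: lookup[OF cocycles_zero] del: One_nat_def)
    show "finite ((\<lambda>s. Poly_Mapping.single s (1 :: complex)) ` S)" using S(1) by simp
    interpret vector_space "complex_scale :: complex \<Rightarrow> ((nat \<Rightarrow> complex) chain \<Rightarrow>\<^sub>0 complex) \<Rightarrow> _"
      by (rule vector_space_complex_scale)
    show "coords S ` carrier ?W \<subseteq> Modules.module.span complex_scale ((\<lambda>s. Poly_Mapping.single s 1) ` S)"
    proof
      fix v assume "v \<in> coords S ` carrier ?W"
      then obtain K where v: "v = coords S K" by blast
      have "Poly_Mapping.single s (coclass_at s K) = complex_scale (coclass_at s K) (Poly_Mapping.single s 1)" for s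
        by (rule poly_mapping_eqI) (simp add: lookup_single when_def)
      then show "v \<in> span ((\<lambda>s. Poly_Mapping.single s 1) ` S)"
        unfolding v coords_def by (simp only:) (intro span_sum span_scale span_base imageI)
    qed
    fix x assume "x \<in> carrier ?W"
    then obtain \<phi> where \<phi>: "\<phi> \<in> cocycles i ?X" "x = coclass i ?X \<phi>" unfolding W(1) by blast
    show "z \<odot>\<^bsub>?W\<^esub> x \<in> carrier ?W" for z
      unfolding \<phi>(2) W(3)[OF \<phi>(1)] W(1) by (intro imageI cocycles_smult \<phi>(1))
    show "coords S (z \<odot>\<^bsub>?W\<^esub> x) = complex_scale z (coords S x)" for z
      unfolding \<phi>(2) W(3)[OF \<phi>(1)] using S(2) chain
      by (intro poly_mapping_eqI, simp only: lookup_complex_scale lookup[OF \<phi>(1)] lookup[OF cocycles_smult[OF \<phi>(1)]])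
        (simp add: cochain_smult del: One_nat_def)
    show "act ?W id x = x"
    proof -
      have "act ?W id x = coclass i ?X (permute_pullback i n id \<phi>)"
        unfolding \<phi>(2) by (rule W(5)[OF \<phi>(1) permutes_id])
      also have "\<dots> = coclass i ?X \<phi>"
      proof (rule coclass_eqI)
        fix c assume c: "scycle i ?X c"
        have "chain_map i (permute_conf {1..n} id) c = c"
          by (rule chain_map_id_gen[OF chain[OF c]]) (simp add: permute_conf_id)
        then show "permute_pullback i n id \<phi> c = \<phi> c" by (simp add: pull_at[OF chain[OF c]] del: One_nat_def)
      qed
      finally show ?thesis unfolding \<phi>(2) .
    qed
    {
      fix y assume "y \<in> carrier ?W"
      then obtain \<psi> where \<psi>: "\<psi> \<in> cocycles i ?X" "y = coclass i ?X \<psi>" unfolding W(1) by blast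
      show "x \<oplus>\<^bsub>?W\<^esub> y \<in> carrier ?W"
        unfolding \<phi>(2) \<psi>(2) W(2)[OF \<phi>(1) \<psi>(1)] W(1) by (intro imageI cocycles_add \<phi>(1) \<psi>(1))
      show "coords S (x \<oplus>\<^bsub>?W\<^esub> y) = coords S x + coords S y"
        unfolding \<phi>(2) \<psi>(2) W(2)[OF \<phi>(1) \<psi>(1)] using S(2) chain
        by (intro poly_mapping_eqI, simp only: lookup[OF \<phi>(1)] lookup[OF \<psi>(1)] lookup[OF cocycles_add[OF \<phi>(1) \<psi>(1)]] lookup_add)
          (simp add: cochain_add del: One_nat_def)
      fix g :: "nat \<Rightarrow> nat" assume g: "g permutes {1..n}"
      show "act ?W g (x \<oplus>\<^bsub>?W\<^esub> y) = act ?W g x \<oplus>\<^bsub>?W\<^esub> act ?W g y"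
        unfolding \<phi>(2) \<psi>(2) W(2)[OF \<phi>(1) \<psi>(1)] W(5)[OF \<phi>(1) g] W(5)[OF \<psi>(1) g]
          W(5)[OF cocycles_add[OF \<phi>(1) \<psi>(1)] g] W(2)[OF pull[OF \<phi>(1) g] pull[OF \<psi>(1) g]]
        by (rule coclass_eqI)
          (simp add: cochain_add pull_at chain singular_chain_chain_map[OF chain continuous_permute_PC[OF g]] del: One_nat_def)
    }
    fix g :: "nat \<Rightarrow> nat" assume g: "g permutes {1..n}"
    show "act ?W g x \<in> carrier ?W"
      unfolding \<phi>(2) W(5)[OF \<phi>(1) g] W(1) by (intro imageI pull \<phi>(1) g)
    show "act ?W g (z \<odot>\<^bsub>?W\<^esub> x) = z \<odot>\<^bsub>?W\<^esub> act ?W g x" for z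
      unfolding \<phi>(2) W(3)[OF \<phi>(1)] W(5)[OF \<phi>(1) g] W(5)[OF cocycles_smult[OF \<phi>(1)] g] W(3)[OF pull[OF \<phi>(1) g]]
      by (rule coclass_eqI)
        (simp add: cochain_smult pull_at chain singular_chain_chain_map[OF chain continuous_permute_PC[OF g]] del: One_nat_def)
    fix h :: "nat \<Rightarrow> nat" assume h: "h permutes {1..n}"
    show "act ?W (g \<circ> h) x = act ?W g (act ?W h x)"
      unfolding \<phi>(2) W(5)[OF \<phi>(1) h] W(5)[OF \<phi>(1) permutes_compose[OF h g]] W(5)[OF pull[OF \<phi>(1) h] g]
    proof (rule coclass_eqI)
      fix c assume c: "scycle i ?X c"
      \<comment> \<open>Permuting coordinates and pulling back both reverse composites, which leaves
        a left action.\<close>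
      have "permute_conf {1..n} (g \<circ> h) = permute_conf {1..n} h \<circ> permute_conf {1..n} g"
        using permute_conf_comp[OF h] by (auto simp: fun_eq_iff)
      then show "permute_pullback i n (g \<circ> h) \<phi> c = permute_pullback i n g (permute_pullback i n h \<phi>) c"
        unfolding pull_at[OF chain[OF c]]
          pull_at[OF singular_chain_chain_map[OF chain[OF c] continuous_permute_PC[OF g]]]
        by (simp only: chain_map_compose o_apply)
    qed
  qed
  with S(2) that show thesis by blast
qed

section \<open>Vanishing of the multiplicity\<close>

text \<open>A representing cocycle is evaluated on the antisymmetrised cycle. By the sign rule every
  permutation contributes the value at \<open>c\<close>, which gives that value times the order of
  the group; by \<open>alternate_cycle_null\<close> the result is 0.\<close>

lemma sign_class_zero:
  assumes A: "A \<subseteq> {1..n}" "i + 2 \<le> card A" and K: "K \<in> carrier (PConf_cohomology i n)"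
    and sgn: "\<And>g. g permutes A \<Longrightarrow> act (PConf_cohomology i n) g K = of_int (sign g) \<odot>\<^bsub>PConf_cohomology i n\<^esub> K"
    and c: "scycle i (PC {1..n}) c"
  shows "coclass_at c K = 0"
proof -
  let ?X = "PC {1..n}" and ?G = "{g. g permutes A}"
  note W = PConf_cohomology_simps[where i = i and n = n]
  obtain \<phi> where \<phi>: "\<phi> \<in> cocycles i ?X" "K = coclass i ?X \<phi>" using K unfolding W(1) by blast
  have perm: "g permutes {1..n}" if "g permutes A" for g using permutes_subset[OF that A(1)] .
  have chain: "singular_chain i ?X (chain_map i (permute_conf {1..n} g) c)" if "g permutes A" for g
    by (rule singular_chain_chain_map[OF scycle_chain[OF c] continuous_permute_PC[OF perm[OF that]]])
  have "\<phi> (chain_map i (permute_conf {1..n} g) c) = of_int (sign g) * \<phi> c" if g: "g permutes A" for g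
  proof -
    have "coclass i ?X (permute_pullback i n g \<phi>) = coclass i ?X (of_int (sign g) \<odot>\<^bsub>cochain_space i ?X\<^esub> \<phi>)"
      using sgn[OF g] unfolding \<phi>(2) W(3)[OF \<phi>(1)] W(5)[OF \<phi>(1) perm[OF g]] .
    then have "coclass_at c (coclass i ?X (permute_pullback i n g \<phi>))
        = coclass_at c (coclass i ?X (of_int (sign g) \<odot>\<^bsub>cochain_space i ?X\<^esub> \<phi>))" by simp
    then have "permute_pullback i n g \<phi> c = (of_int (sign g) \<odot>\<^bsub>cochain_space i ?X\<^esub> \<phi>) c"
      by (simp only: coclass_at_coclass[OF cocycles_pullback[OF \<phi>(1) continuous_permute_PC[OF perm[OF g]]] c]
          coclass_at_coclass[OF cocycles_smult[OF \<phi>(1)] c])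
    then show ?thesis using scycle_chain[OF c] by (simp add: cochain_pullback_def cochain_smult)
  qed
  then have "(\<Sum>g\<in>?G. of_int (sign g) * \<phi> (chain_map i (permute_conf {1..n} g) c)) = (\<Sum>g\<in>?G. \<phi> c)"
    by (intro sum.cong refl) (simp add: sign_mult_self mult.assoc[symmetric])
  moreover have "\<phi> (alternate i {1..n} A c) = (\<Sum>g\<in>?G. of_int (sign g) * \<phi> (chain_map i (permute_conf {1..n} g) c))"
    unfolding alternate_def by (rule cocycle_sum_cmul[OF \<phi>(1)]) (simp add: chain del: One_nat_def)
  moreover have "\<phi> (alternate i {1..n} A c) = \<phi> 0"
    by (rule cocycle_shom[OF \<phi>(1) alternate_cycle_null[OF _ A c]]) simp_all
  moreover have "\<phi> 0 = 0" using cocycle_add[OF \<phi>(1), of 0 0] by simp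
  ultimately have "of_nat (card ?G) * \<phi> c = 0" by simp
  moreover have "finite A" using A(1) finite_subset by blast
  then have "card ?G \<noteq> 0" by (simp add: card_permutations)
  ultimately show ?thesis using \<phi> c by (simp add: coclass_at_coclass)
qed

text \<open>An isomorphism from a subrepresentation onto the Specht module would provide a preimage
  of \<open>sign_vector\<close>, a class on which the permutations of the first column act by the
  sign. By \<open>sign_class_zero\<close> it vanishes on all generating cycles, so it is zero,
  whereas \<open>sign_vector\<close> is not.\<close>

lemma rep_multiplicity_zero:
  assumes pos: "\<forall>x\<in>set \<mu>. x > 0" and sum: "sum_list \<mu> = n" and len: "i + 2 \<le> length \<mu>"
  shows "rep_multiplicity n (specht n \<mu>) (PConf_cohomology i n) = 0"
proof -
  let ?W = "PConf_cohomology i n" and ?V = "specht n \<mu>"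
  obtain S where S: "\<forall>s\<in>S. scycle i (PC {1..n}) s"
    "coord_rep complex_scale n ?W (coords S) ((\<lambda>s. Poly_Mapping.single s 1) ` S)"
    by (rule coord_rep_PConf_cohomology)
  interpret coord_rep complex_scale n ?W "coords S" "(\<lambda>s. Poly_Mapping.single s 1) ` S" by (rule S(2))
  obtain A where A: "A \<subseteq> {1..n}" "card A = length \<mu>" "\<forall>g. g permutes A \<longrightarrow> g \<in> col_group n \<mu>"
    by (rule first_column[OF pos sum])
  have no_iso: "\<not> rep_iso n (?W\<lparr>carrier := U\<rparr>) ?V" if U: "subrep n U ?W" for U
  proof
    assume "rep_iso n (?W\<lparr>carrier := U\<rparr>) ?V"
    then obtain f where hom: "f \<in> module_hom class_ring (?W\<lparr>carrier := U\<rparr>) ?V"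
      and bij: "bij_betw f U (carrier ?V)"
      and equiv: "\<And>g v. g \<in> carrier (sym_group n) \<Longrightarrow> v \<in> U \<Longrightarrow> f (act ?W g v) = act ?V g (f v)"
      unfolding rep_iso_def by auto
    have "subrep n U (?W\<lparr>carrier := carrier ?W\<rparr>)" using U by simp
    then have sub: "U \<subseteq> carrier ?W" "\<zero>\<^bsub>?W\<^esub> \<in> U" "\<And>c x. x \<in> U \<Longrightarrow> c \<odot>\<^bsub>?W\<^esub> x \<in> U"
      "\<And>g x. g permutes {1..n} \<Longrightarrow> x \<in> U \<Longrightarrow> act ?W g x \<in> U"
      by (subst (asm) subrep_iff; use zero_in add_in smult_in in auto)+
    have f_smult': "f (c \<odot>\<^bsub>?W\<^esub> x) = c \<odot>\<^bsub>?V\<^esub> f x" if "x \<in> U" for c x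
      using hom that by (auto simp: module_hom_def)
    have inj: "inj_on f U" using bij by (simp add: bij_betw_def)
    obtain u where u: "u \<in> U" "f u = sign_vector n \<mu>"
      using sign_vector_in_specht[of n \<mu>] bij by (metis bij_betw_imp_surj_on imageE)
    have "act ?W g u = of_int (sign g) \<odot>\<^bsub>?W\<^esub> u" if g: "g permutes A" for g
    proof -
      have gc: "g \<in> col_group n \<mu>" using A(3) g by blast
      then have gp: "g permutes {1..n}" by (rule col_group_permutes)
      have "f (act ?W g u) = f (of_int (sign g) \<odot>\<^bsub>?W\<^esub> u)"
        using equiv[of g u] u gp act_sign_vector[OF gc] f_smult'[OF u(1)] by (simp add: sym_group_carrier)
      then show ?thesis using inj_onD[OF inj] sub(3)[OF u(1)] sub(4)[OF gp u(1)] by blast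
    qed
    then have "coclass_at c u = 0" if "scycle i (PC {1..n}) c" for c
      using A(1,2) len u(1) sub(1) that by (intro sign_class_zero[of A n i u]) auto
    then have "coords S u = 0" using S(1) by (simp add: coords_def)
    \<comment> \<open>The zero class enters as 0 times \<open>u\<close>, since compatibility of
      \<open>f\<close> with scalars is what has been extracted.\<close>
    moreover have "coords S (0 \<odot>\<^bsub>?W\<^esub> u) = complex_scale 0 (coords S u)"
      using f_smult[of u 0] u(1) sub(1) by blast
    moreover have "complex_scale 0 (coords S u) = 0" by (rule poly_mapping_eqI) simp
    ultimately have "u = 0 \<odot>\<^bsub>?W\<^esub> u"
      using f_eqD[of u "0 \<odot>\<^bsub>?W\<^esub> u"] u(1) sub(1) sub(3)[OF u(1), of 0] by auto
    then have "f u = 0 \<odot>\<^bsub>?V\<^esub> f u" using f_smult'[OF u(1), of 0] by simp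
    then have "sign_vector n \<mu> = (\<lambda>s. 0)" unfolding u(2) by (simp add: specht_def group_algebra_def)
    then show False using sign_vector_nonzero[of n \<mu>] by simp
  qed
  obtain l U where dec: "\<forall>j<l. subrep n (U j) ?W \<and> irreducible_rep n (?W\<lparr>carrier := U j\<rparr>)"
    "direct_decomp ?W l U"
    by (rule irreducible_decomposition)
  have empty: "{j. j < l \<and> rep_iso n (?W\<lparr>carrier := U j\<rparr>) ?V} = {}"
    if "\<forall>j<l. subrep n (U j) ?W \<and> irreducible_rep n (?W\<lparr>carrier := U j\<rparr>)" for l U
    using that no_iso by auto
  \<comment> \<open>No summand of any decomposition is isomorphic to the Specht module, so every
    admissible count is 0, and \<open>dec\<close> provides one.\<close>
  show ?thesis
    unfolding rep_multiplicity_def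
  proof (rule the_equality)
    show "\<exists>l U. (\<forall>j<l. subrep n (U j) ?W \<and> irreducible_rep n (?W\<lparr>carrier := U j\<rparr>)) \<and>
      direct_decomp ?W l U \<and> 0 = card {j. j < l \<and> rep_iso n (?W\<lparr>carrier := U j\<rparr>) ?V}"
      using dec empty[OF dec(1)] by (intro exI[of _ l] exI[of _ U]) simp
    fix m assume "\<exists>l U. (\<forall>j<l. subrep n (U j) ?W \<and> irreducible_rep n (?W\<lparr>carrier := U j\<rparr>)) \<and>
      direct_decomp ?W l U \<and> m = card {j. j < l \<and> rep_iso n (?W\<lparr>carrier := U j\<rparr>) ?V}"
    then obtain l :: nat and U where "\<forall>j<l. subrep n (U j) ?W \<and> irreducible_rep n (?W\<lparr>carrier := U j\<rparr>)"
      "m = card {j. j < l \<and> rep_iso n (?W\<lparr>carrier := U j\<rparr>) ?V}" by (elim exE conjE)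
    then show "m = 0" using empty[of l U] by (simp only: card.empty)
  qed
qed

theorem theorem3:
  fixes k r i :: nat and a :: "nat list"
  assumes "k > 0"
    and "partition_of k a"
    and "length a = r"
    and "i < r"
  shows "stable_multiplicity i a = 0"
proof -
  \<comment> \<open>For \<open>n > k\<close> the first row \<open>n - k\<close> is positive, so
    there are \<open>r + 1\<close> positive rows with sum \<open>n\<close>, and \<open>i < r\<close>
    gives \<open>i + 2 \<le> r + 1\<close>.\<close>
  have "rep_multiplicity n (padded_specht a n) (PConf_cohomology i n) = 0" if "n > k" for n
    unfolding padded_specht_def using assms that
    by (intro rep_multiplicity_zero) (auto simp: partition_of_def)
  then have ev: "\<forall>\<^sub>F n in sequentially. rep_multiplicity n (padded_specht a n) (PConf_cohomology i n) = 0"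
    using eventually_gt_at_top[of k] by (rule eventually_mono[rotated])
  show ?thesis
    unfolding stable_multiplicity_def
  proof (rule the_equality)
    show "\<forall>\<^sub>F n in sequentially. rep_multiplicity n (padded_specht a n) (PConf_cohomology i n) = 0" by (rule ev)
    fix d assume "\<forall>\<^sub>F n in sequentially. rep_multiplicity n (padded_specht a n) (PConf_cohomology i n) = d"
    from eventually_conj[OF this ev] show "d = 0"
      using eventually_happens'[OF sequentially_bot] by fastforce
  qed
qed

end
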